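(* Let $\Delta\subset M_{\mathbb R}$ be a reflexive polytope, $h:\Delta\cap M\to\mathbb Z$ a height function, and let $\nu$ be a positive measure on $B^\circ$ of total mass $\mu_M(A)$. Then there is a function $\Psi\in\mathcal P(\Delta)$ satisfying $$\mathrm{MA}(\Psi|_{B^\circ})=\nu$$ if and only if $(\Delta,h,\nu)$ is stable. Moreover, if $\Psi,\Psi'\in\mathcal P(\Delta)$ both satisfy this equation, then $\Psi-\Psi'$ is constant on $B$.
   Context: Let $d\ge 1$, $M\cong\mathbb Z^{d+1}$ a lattice, $N=\mathrm{Hom}(M,\mathbb Z)$, $M_{\mathbb R}=M\otimes\mathbb R$, $N_{\mathbb R}=N\otimes\mathbb R$, with pairing $\langle\cdot,\cdot\rangle$. A reflexive polytope $\Delta\subset M_{\mathbb R}$ is a lattice polytope with $0$ in its interior whose dual $\Delta^\vee=\{n\in N_{\mathbb R}:\langle m,n\rangle\le 1\ \forall m\in\Delta\}$ is a lattice polytope. A height function is a map $h:\Delta\cap M\to\mathbb Z$ with $h(0)=0<h(m)$ for $m\ne 0$. Put $\Delta_h^\vee=\{n\in N_{\mathbb R}:\langle m,n\rangle\le h(m)\ \forall m\in\Delta\cap M\}$, $A=\partial\Delta$, $B=\partial\Delta_h^\vee$. $A^\circ$ and $B^\circ$ are the unions of the relative interiors of the facets of $\Delta$ and $\Delta_h^\vee$. For a facet $\sigma$ of $\Delta$, $n_\sigma\in N$ is its primitive outward normal; for a facet $\tau$ of $\Delta_h^\vee$, $m_\tau\in M$ is its primitive outward normal (one has $m_\tau\in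 A\cap M$), and $\tau^\circ$ is its relative interior. For $m\in A\cap M$, $\tau_m=\{n\in\Delta_h^\vee:\langle m,n\rangle=h(m)\}$ (a possibly empty face) and $\mathrm{St}(m)$ is the union of all closed faces of $A$ containing $m$. $\mu_M$ is the measure on $A$ giving no mass to $A\setminus A^\circ$ and equal, on the interior of each facet $\sigma$, to Lebesgue measure on the affine hull of $\sigma$ normalized so that a fundamental domain of the lattice $n_\sigma^\perp\cap M$ has volume $1$. $\mathcal P(\Delta)$ is the set of convex functions $\Psi$ on $N_{\mathbb R}$ with $\sup_{n\in N_{\mathbb R}}|\Psi(n)-\sup_{m\in\Delta\cap M}\langle m,n\rangle|<\infty$. For a facet $\sigma$ of $\Delta$, fix a $\mathbb Z$-basis $m_1,\dots,m_d$ of $n_\sigma^\perp\cap M$ and let $\beta_\sigma(n)=(\langle m_1,n\rangle,\dots,\langle m_d,n\rangle)\in\mathbb R^d$; $\beta_\sigma$ is injective on each facet $\tau$ of $\Delta_h^\vee$ with $m_\tau\in\sigma$. The equation $\mathrm{MA}(\Psi|_{B^\circ})=\nu$ means: for every facet $\tau$ of $\Delta_h^\vee$, every facet $\sigma$ of $\Delta$ with $m_\tau\in\sigma$ and every measurable $E\subset\tau^\circ$, $|\partial(\Psi\circ\beta_\sigma^{-1})(\beta_\sigma(E))|=\nu(E)$, where $\beta_\sigma^{-1}$ is the inverse of $\beta_\sigma|_{\tau^\circ}$, $\partial$ is the (multivalued) subgradient of the convex function $\Psi\circ\beta_\sigma^{-1}$ on $\beta_\sigma(\tau^\circ)$, and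 $|\cdot|$ is Lebesgue measure. $(\Delta,h,\nu)$ is stable if there is an optimal transport plan from $\mu_M$ to $\nu$, i.e. a positive measure $\gamma$ on $A\times B$ with marginals $\mu_M$ and $\nu$ minimizing $C(\gamma)=-\int_{A\times B}\langle m,n\rangle\,\gamma$ among all such measures, which is supported on $\bigcup_{m\in A\cap M}(\mathrm{St}(m)\times\tau_m)$. (Here $\nu$ is regarded as a measure on $B$ giving no mass to $B\setminus B^\circ$.) *)

theory Defs
  imports "HOL-Analysis.Analysis"
begin

text \<open>
  A basis of the lattice $M$ is fixed, so that $M = \mathbb{Z}^{d+1}$ inside \<^typ>\<open>real ^ 'n\<close>, where
  $d + 1$ is the cardinality of \<^typ>\<open>'n\<close>. With the dual basis, $N = \mathbb{Z}^{d+1}$ as well and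
  the pairing is the standard inner product. The space $\mathbb{R}^d$ is \<^typ>\<open>real ^ 'd\<close>, where
  $d$ is the cardinality of \<^typ>\<open>'d\<close>.
\<close>

definition int_lattice :: "(real ^ 'n) set" where
  "int_lattice = {x. \<forall>i. x $ i \<in> \<int>}"

definition lattice_polytope :: "(real ^ 'n) set \<Rightarrow> bool" where
  "lattice_polytope P \<longleftrightarrow> (\<exists>V. finite V \<and> V \<subseteq> int_lattice \<and> P = convex hull V)"

definition dual_polytope :: "(real ^ 'n) set \<Rightarrow> (real ^ 'n) set" where
  "dual_polytope \<Delta> = {n. \<forall>m\<in>\<Delta>. m \<bullet> n \<le> 1}"

definition reflexive_polytope :: "(real ^ 'n) set \<Rightarrow> bool" where
  "reflexive_polytope \<Delta> \<longleftrightarrow>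
     lattice_polytope \<Delta> \<and> 0 \<in> interior \<Delta> \<and> lattice_polytope (dual_polytope \<Delta>)"

text \<open>Only the values of a height function on $\Delta \cap M$ are constrained or used.\<close>

definition height_function :: "(real ^ 'n) set \<Rightarrow> (real ^ 'n \<Rightarrow> int) \<Rightarrow> bool" where
  "height_function \<Delta> h \<longleftrightarrow> h 0 = 0 \<and> (\<forall>m \<in> \<Delta> \<inter> int_lattice - {0}. 0 < h m)"

definition height_dual :: "(real ^ 'n) set \<Rightarrow> (real ^ 'n \<Rightarrow> int) \<Rightarrow> (real ^ 'n) set" where
  "height_dual \<Delta> h = {n. \<forall>m \<in> \<Delta> \<inter> int_lattice. m \<bullet> n \<le> real_of_int (h m)}"

definition facet_interiors :: "(real ^ 'n) set \<Rightarrow> (real ^ 'n) set" where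
  "facet_interiors P = \<Union> {rel_interior F | F. F facet_of P}"

definition primitive :: "real ^ 'n \<Rightarrow> bool" where
  "primitive v \<longleftrightarrow> v \<in> int_lattice \<and> (\<forall>w \<in> int_lattice. \<forall>k::nat. v = real k *\<^sub>R w \<longrightarrow> k = 1)"

text \<open>Well defined for the facets of a full-dimensional polytope with rational facet normals.\<close>

definition facet_normal :: "(real ^ 'n) set \<Rightarrow> (real ^ 'n) set \<Rightarrow> real ^ 'n" where
  "facet_normal P F = (THE v. primitive v \<and> (\<forall>y\<in>F. \<forall>x\<in>P. v \<bullet> x \<le> v \<bullet> y))"

definition lattice_basis :: "('d::finite \<Rightarrow> real ^ 'n) \<Rightarrow> (real ^ 'n) set \<Rightarrow> bool" where
  "lattice_basis v L \<longleftrightarrow>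
     bij_betw (\<lambda>c :: 'd \<Rightarrow> int. \<Sum>i\<in>UNIV. real_of_int (c i) *\<^sub>R v i) UNIV L"

text \<open>A choice, for every facet $\sigma$ of $\Delta$, of a $\mathbb{Z}$-basis of $n_\sigma^\perp \cap M$.\<close>

definition facet_bases ::
  "(real ^ 'n) set \<Rightarrow> ((real ^ 'n) set \<Rightarrow> 'd::finite \<Rightarrow> real ^ 'n) \<Rightarrow> bool" where
  "facet_bases \<Delta> b \<longleftrightarrow>
     (\<forall>\<sigma>. \<sigma> facet_of \<Delta> \<longrightarrow> lattice_basis (b \<sigma>) {m \<in> int_lattice. m \<bullet> facet_normal \<Delta> \<sigma> = 0})"

text \<open>
  Lebesgue measure on the affine hull of a facet $\sigma$ with lattice basis $v$, normalized so that
  the fundamental parallelotope spanned by $v$ has volume 1. It depends neither on the chosen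
  base point in $\sigma$ nor on $v$.
\<close>

definition facet_lebesgue ::
  "('d::finite \<Rightarrow> real ^ 'n) \<Rightarrow> (real ^ 'n) set \<Rightarrow> (real ^ 'n) measure" where
  "facet_lebesgue v \<sigma> =
     distr lborel borel (\<lambda>x :: real ^ 'd. (SOME p. p \<in> \<sigma>) + (\<Sum>i\<in>UNIV. (x $ i) *\<^sub>R v i))"

text \<open>
  Measures on $A$, on $B$ and on $A \times B$ are Borel measures on the ambient space that give no
  mass to the complement.
\<close>

definition mu_M ::
  "(real ^ 'n) set \<Rightarrow> ((real ^ 'n) set \<Rightarrow> 'd::finite \<Rightarrow> real ^ 'n) \<Rightarrow> (real ^ 'n) measure" where
  "mu_M \<Delta> b = measure_of UNIV (sets borel)
     (\<lambda>E. \<Sum>\<sigma> | \<sigma> facet_of \<Delta>. emeasure (facet_lebesgue (b \<sigma>) \<sigma>) (E \<inter> rel_interior \<sigma>))"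

lemma sets_mu_M [simp, measurable_cong]: "sets (mu_M \<Delta> b) = sets borel"
  by (simp add: mu_M_def sets.sigma_sets_eq[of borel, simplified])

lemma space_mu_M [simp]: "space (mu_M \<Delta> b) = UNIV"
  by (simp add: mu_M_def)

lemma sets_facet_lebesgue [simp]: "sets (facet_lebesgue v \<sigma>) = sets borel"
  by (simp add: facet_lebesgue_def)

lemma borel_rel_interior: "rel_interior (S :: (real ^ 'n) set) \<in> sets borel"
proof -
  obtain T where "open T" and "rel_interior S = affine hull S \<inter> T"
    using openin_rel_interior[of S] by (auto simp: openin_open)
  then show ?thesis
    using borel_closed[OF closed_affine_hull[of S]] by auto
qed

lemma emeasure_mu_M:
  assumes "E \<in> sets borel"
  shows "emeasure (mu_M \<Delta> b) E =
    (\<Sum>\<sigma> | \<sigma> facet_of \<Delta>. emeasure (facet_lebesgue (b \<sigma>) \<sigma>) (E \<inter> rel_interior \<sigma>))"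
proof (rule emeasure_measure_of[OF mu_M_def])
  show "countably_additive (sets (mu_M \<Delta> b))
    (\<lambda>E. \<Sum>\<sigma> | \<sigma> facet_of \<Delta>. emeasure (facet_lebesgue (b \<sigma>) \<sigma>) (E \<inter> rel_interior \<sigma>))"
  proof (rule countably_additiveI)
    fix E :: "nat \<Rightarrow> (real ^ 'a) set"
    assume E: "range E \<subseteq> sets (mu_M \<Delta> b)" "disjoint_family E"
    have "(\<Sum>i. emeasure (facet_lebesgue (b \<sigma>) \<sigma>) (E i \<inter> rel_interior \<sigma>)) =
        emeasure (facet_lebesgue (b \<sigma>) \<sigma>) ((\<Union>i. E i) \<inter> rel_interior \<sigma>)" for \<sigma>
    proof -
      have "range (\<lambda>i. E i \<inter> rel_interior \<sigma>) \<subseteq> sets (facet_lebesgue (b \<sigma>) \<sigma>)"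
        using E(1) borel_rel_interior[of \<sigma>] by auto
      moreover have "disjoint_family (\<lambda>i. E i \<inter> rel_interior \<sigma>)"
        using E(2) by (auto simp: disjoint_family_on_def)
      ultimately show ?thesis
        by (subst suminf_emeasure) auto
    qed
    then show "(\<Sum>i. \<Sum>\<sigma> | \<sigma> facet_of \<Delta>. emeasure (facet_lebesgue (b \<sigma>) \<sigma>) (E i \<inter> rel_interior \<sigma>)) =
        (\<Sum>\<sigma> | \<sigma> facet_of \<Delta>. emeasure (facet_lebesgue (b \<sigma>) \<sigma>) ((\<Union>i. E i) \<inter> rel_interior \<sigma>))"
      by (subst suminf_sum) auto
  qed
qed (use assms in \<open>auto simp: positive_def\<close>)

definition P_class :: "(real ^ 'n) set \<Rightarrow> (real ^ 'n \<Rightarrow> real) set" where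
  "P_class \<Delta> = {\<Psi>. convex_on UNIV \<Psi> \<and>
     bdd_above (range (\<lambda>n. \<bar>\<Psi> n - (SUP m \<in> \<Delta> \<inter> int_lattice. m \<bullet> n)\<bar>))}"

definition beta :: "('d::finite \<Rightarrow> real ^ 'n) \<Rightarrow> real ^ 'n \<Rightarrow> real ^ 'd" where
  "beta v n = (\<chi> i. v i \<bullet> n)"

definition subgradient :: "(real ^ 'd) set \<Rightarrow> (real ^ 'd \<Rightarrow> real) \<Rightarrow> real ^ 'd \<Rightarrow> (real ^ 'd) set" where
  "subgradient S f x = {p. \<forall>y\<in>S. f x + p \<bullet> (y - x) \<le> f y}"

text \<open>
  \<^term>\<open>MA_eq \<Delta> h b \<Psi> \<nu>\<close> is the equation $\mathrm{MA}(\Psi|_{B^\circ}) = \nu$. The set of all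
  subgradients over a Borel set is in general only Lebesgue measurable, hence \<^term>\<open>lebesgue\<close>.
\<close>

definition MA_eq ::
  "(real ^ 'n) set \<Rightarrow> (real ^ 'n \<Rightarrow> int) \<Rightarrow> ((real ^ 'n) set \<Rightarrow> 'd::finite \<Rightarrow> real ^ 'n) \<Rightarrow>
     (real ^ 'n \<Rightarrow> real) \<Rightarrow> (real ^ 'n) measure \<Rightarrow> bool" where
  "MA_eq \<Delta> h b \<Psi> \<nu> \<longleftrightarrow>
     (\<forall>\<tau> \<sigma> E. \<tau> facet_of height_dual \<Delta> h \<longrightarrow> \<sigma> facet_of \<Delta> \<longrightarrow>
        facet_normal (height_dual \<Delta> h) \<tau> \<in> \<sigma> \<longrightarrow> E \<in> sets borel \<longrightarrow> E \<subseteq> rel_interior \<tau> \<longrightarrow>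
        emeasure lebesgue
          (\<Union>x \<in> beta (b \<sigma>) ` E.
             subgradient (beta (b \<sigma>) ` rel_interior \<tau>)
               (\<Psi> \<circ> inv_into (rel_interior \<tau>) (beta (b \<sigma>))) x)
        = emeasure \<nu> E)"

definition transport_plan ::
  "(real ^ 'n) set \<Rightarrow> (real ^ 'n \<Rightarrow> int) \<Rightarrow> (real ^ 'n) measure \<Rightarrow> (real ^ 'n) measure \<Rightarrow>
     ((real ^ 'n) \<times> (real ^ 'n)) measure \<Rightarrow> bool" where
  "transport_plan \<Delta> h \<mu> \<nu> \<gamma> \<longleftrightarrow>
     sets \<gamma> = sets borel \<and>
     emeasure \<gamma> (- (frontier \<Delta> \<times> frontier (height_dual \<Delta> h))) = 0 \<and>
     distr \<gamma> borel fst = \<mu> \<and> distr \<gamma> borel snd = \<nu>"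

definition transport_cost ::
  "(real ^ 'n) set \<Rightarrow> (real ^ 'n \<Rightarrow> int) \<Rightarrow> ((real ^ 'n) \<times> (real ^ 'n)) measure \<Rightarrow> real" where
  "transport_cost \<Delta> h \<gamma> =
     - (LINT z : frontier \<Delta> \<times> frontier (height_dual \<Delta> h) | \<gamma>. fst z \<bullet> snd z)"

definition optimal_plan ::
  "(real ^ 'n) set \<Rightarrow> (real ^ 'n \<Rightarrow> int) \<Rightarrow> (real ^ 'n) measure \<Rightarrow> (real ^ 'n) measure \<Rightarrow>
     ((real ^ 'n) \<times> (real ^ 'n)) measure \<Rightarrow> bool" where
  "optimal_plan \<Delta> h \<mu> \<nu> \<gamma> \<longleftrightarrow>
     transport_plan \<Delta> h \<mu> \<nu> \<gamma> \<and>
     (\<forall>\<gamma>'. transport_plan \<Delta> h \<mu> \<nu> \<gamma>' \<longrightarrow> transport_cost \<Delta> h \<gamma> \<le> transport_cost \<Delta> h \<gamma>')"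

definition St :: "(real ^ 'n) set \<Rightarrow> real ^ 'n \<Rightarrow> (real ^ 'n) set" where
  "St \<Delta> m = \<Union> {F. F face_of \<Delta> \<and> F \<noteq> \<Delta> \<and> m \<in> F}"

definition tau_face ::
  "(real ^ 'n) set \<Rightarrow> (real ^ 'n \<Rightarrow> int) \<Rightarrow> real ^ 'n \<Rightarrow> (real ^ 'n) set" where
  "tau_face \<Delta> h m = {n \<in> height_dual \<Delta> h. m \<bullet> n = real_of_int (h m)}"

definition stable ::
  "(real ^ 'n) set \<Rightarrow> (real ^ 'n \<Rightarrow> int) \<Rightarrow> ((real ^ 'n) set \<Rightarrow> 'd::finite \<Rightarrow> real ^ 'n) \<Rightarrow>
     (real ^ 'n) measure \<Rightarrow> bool" where
  "stable \<Delta> h b \<nu> \<longleftrightarrow>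
     (\<exists>\<gamma>. optimal_plan \<Delta> h (mu_M \<Delta> b) \<nu> \<gamma> \<and>
        emeasure \<gamma> (- (\<Union>m \<in> frontier \<Delta> \<inter> int_lattice. St \<Delta> m \<times> tau_face \<Delta> h m)) = 0)"

end

theory Submission
  imports Defs
begin

text \<open>
  Put $\Phi(m) = \sup_{n \in B} (\langle m, n\rangle - \Psi(n))$ and call $(m, n) \in A \times B$ a contact
  pair if $\Phi(m) + \Psi(n) = \langle m, n\rangle$. Let $\tau$ be a facet of $\Delta_h^\vee$ and $n \in \tau^\circ$.
  A subgradient of $\Psi|_\tau$ at $n$ is a class modulo $\mathbb{R} m_\tau$; it lifts to a subgradient of $\Psi$ on
  $N_{\mathbb{R}}$, which lies in $\Delta$ because $\Psi \in \mathcal{P}(\Delta)$, and moving it in the direction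
  $m_\tau$ until it leaves $\Delta$ gives the unique representative in $\mathrm{St}(m_\tau)$, which is in contact
  with $n$. The projection along $m_\tau$ is injective on $\mathrm{St}(m_\tau)$ and carries $\mu_M$ to
  Lebesgue measure. Hence $\mathrm{MA}(\Psi)(E)$ is the $\mu_M$-measure of the points of $\mathrm{St}(m_\tau)$ that
  are in contact with $E \subseteq \tau^\circ$.

  For $\mu_M$-almost every $m$ there is at most one such $n$: two contact points of $m$ differ by a multiple of
  $n_\sigma$ on each facet $\sigma \ni m$ outside a null set, and $n \in \tau$ with $m_\tau \in \sigma$ determines the sign of the
  multiple. So the equation says that the map $m \mapsto n$ pushes $\mu_M$ forward to $\nu$, and its
  graph is an optimal plan by duality. Conversely, the support of an optimal plan is cyclically
  monotone, Rockafellar's theorem yields $\Psi$, and stability makes the plan live on the graph of the same map. Any two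
  solutions have common contact points over almost all of $A$, so their transforms $\Phi$ differ by a
  constant on every facet of $\Delta$, and $A$ is connected.
\<close>

section \<open>Lattice points and facets\<close>

text \<open>Reflexivity acts through integrality. Every facet \<sigma> of \<Delta> lies at lattice
  distance 1 from 0, so a lattice point u of \<Delta> has pairing 1 with n_\<sigma> if it lies on
  \<sigma>, and at most 0 otherwise. Moving in the direction u therefore never crosses a facet that
  misses u, which is why the ray in direction m_\<tau> leaves \<Delta> inside St(m_\<tau>). Likewise
  projection along u identifies the lattices of all facets through u by an integral matrix of
  determinant 1 or -1, which is why \<mu>_M becomes Lebesgue measure. The obstacle is that contact
  need not be stable: for a general \<Psi>, a point m may be in contact only with points of facets
  \<tau> for which m is outside St(m_\<tau>), so the map from m to n is only partially defined. That
  its domain has full measure is deduced from the equation together with the equality of total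
  masses. Measurability is kept elementary: the relevant projections are countable unions of compact
  sets, and rational thresholds make the null set of non-uniqueness a countable union.\<close>

lemma int_lattice_inner: "x \<in> int_lattice \<Longrightarrow> y \<in> int_lattice \<Longrightarrow> x \<bullet> y \<in> \<int>"
  by (auto simp: int_lattice_def inner_vec_def intro!: Ints_sum Ints_mult)

lemma int_lattice_diff: "x \<in> int_lattice \<Longrightarrow> y \<in> int_lattice \<Longrightarrow> x - y \<in> int_lattice"
  by (auto simp: int_lattice_def)

lemma int_lattice_scaleR: "x \<in> int_lattice \<Longrightarrow> c \<in> \<int> \<Longrightarrow> c *\<^sub>R x \<in> int_lattice"
  by (auto simp: int_lattice_def)

lemma int_lattice_axis: "axis i 1 \<in> int_lattice"
  by (auto simp: int_lattice_def axis_def)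

lemma finite_bounded_int_lattice:
  fixes S :: "(real ^ 'n) set"
  assumes "bounded S"
  shows "finite (S \<inter> int_lattice)"
proof -
  obtain B where B: "\<And>x. x \<in> S \<Longrightarrow> norm x \<le> B"
    using assms by (auto simp: bounded_iff)
  let ?I = "real_of_int ` {- \<lceil>B\<rceil>..\<lceil>B\<rceil>}"
  have "x $ i \<in> ?I" if "x \<in> S \<inter> int_lattice" for x i
  proof -
    have "\<bar>x $ i\<bar> \<le> B" using component_le_norm_cart[of x i] B[of x] that by simp
    moreover have "x $ i \<in> \<int>" using that by (simp add: int_lattice_def)
    then obtain k where "x $ i = of_int k" by (rule Ints_cases)
    ultimately show ?thesis by (intro image_eqI[of _ _ k]) (auto, linarith+)
  qed
  then have "vec_nth ` (S \<inter> int_lattice) \<subseteq> PiE UNIV (\<lambda>_. ?I)" by auto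
  moreover have "finite (PiE (UNIV::'n set) (\<lambda>_. ?I))" by (intro finite_PiE) auto
  ultimately have "finite (vec_nth ` (S \<inter> int_lattice))" using finite_subset by blast
  then show ?thesis by (rule finite_imageD) (auto simp: inj_on_def vec_eq_iff)
qed

text \<open>A relative interior point of F is not interior to P, so some constraint is tight there,
  and the face it cuts out contains F. A proper inclusion would mean two drops of dimension below P,
  one more than a facet allows.\<close>

lemma facet_of_halfspace_system:
  fixes P :: "'a::euclidean_space set"
  assumes P: "P = {x. \<forall>v\<in>W. v \<bullet> x \<le> 1}" and fin: "finite W" and F: "F facet_of P"
  obtains v where "v \<in> W" "F = {x\<in>P. v \<bullet> x = 1}"
proof -
  have conv: "convex P"
  proof -
    have "P = (\<Inter>v\<in>W. {x. v \<bullet> x \<le> 1})" using P by auto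
    then show ?thesis by (simp add: convex_INT convex_halfspace_le)
  qed
  have Fc: "convex F" using F conv facet_of_imp_face_of face_of_imp_convex by blast
  have "F \<noteq> {}" using F by (simp add: facet_of_def)
  then obtain x where x: "x \<in> rel_interior F" using rel_interior_eq_empty[OF Fc] by auto
  then have xF: "x \<in> F" using rel_interior_subset by blast
  then have xP: "x \<in> P" using F facet_of_imp_subset by blast
  have "\<exists>v\<in>W. v \<bullet> x = 1"
  proof (rule ccontr)
    assume "\<not> ?thesis"
    then have "\<forall>v\<in>W. v \<bullet> x < 1" using xP P by force
    then have "x \<in> (\<Inter>v\<in>W. {x. v \<bullet> x < 1})" by auto
    moreover have "open (\<Inter>v\<in>W. {x. v \<bullet> x < 1})" using fin by (intro open_INT) (auto simp: open_halfspace_lt)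
    moreover have "(\<Inter>v\<in>W. {x. v \<bullet> x < 1}) \<subseteq> P" using P by force
    ultimately have "x \<in> interior P" using interiorI by blast
    moreover have "F face_of P" "F \<noteq> P" using F by (auto simp: facet_of_def)
    ultimately show False using face_of_disjoint_interior[of F P] xF by auto
  qed
  then obtain v where v: "v \<in> W" "v \<bullet> x = 1" by blast
  let ?G = "P \<inter> {y. v \<bullet> y = 1}"
  have G: "?G face_of P"
    by (rule face_of_Int_supporting_hyperplane_le[OF conv]) (use v P in auto)
  have FG: "F \<subseteq> ?G"
    by (rule subset_of_face_of[OF G facet_of_imp_subset[OF F]]) (use x v xP in auto)
  have "F = ?G"
  proof (rule ccontr)
    assume ne: "F \<noteq> ?G"
    have "F face_of ?G" using face_of_subset[OF facet_of_imp_face_of[OF F] FG] by auto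
    then have "aff_dim F < aff_dim ?G" using face_of_aff_dim_lt[OF face_of_imp_convex[OF G]] ne by blast
    \<comment> \<open>All right-hand sides are 1, so 0 lies in P and satisfies no constraint with
      equality.\<close>
    moreover have "?G \<noteq> P"
    proof
      assume "?G = P"
      moreover have "0 \<in> P" using P by auto
      ultimately have "0 \<in> ?G" by blast
      then show False by simp
    qed
    then have "aff_dim ?G < aff_dim P" using face_of_aff_dim_lt[OF conv G] by blast
    ultimately show False using F by (auto simp: facet_of_def)
  qed
  then show thesis using that v by blast
qed

lemma facet_affine_hull_eq_hyperplane:
  fixes P :: "'a::euclidean_space set"
  assumes "interior P \<noteq> {}" and F: "F facet_of P" and v: "F \<subseteq> {x. v \<bullet> x = c}" and nz: "v \<noteq> 0"
  shows "affine hull F = {x. v \<bullet> x = c}"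
proof (rule affine_dim_equal)
  show "affine hull F \<subseteq> {x. v \<bullet> x = c}" using v by (simp add: hull_minimal affine_hyperplane)
  show "aff_dim (affine hull F) = aff_dim {x. v \<bullet> x = c}"
    using F assms(1) nz aff_dim_nonempty_interior[of P] by (simp add: facet_of_def aff_dim_affine_hull)
qed (use F in \<open>auto simp: facet_of_def affine_hyperplane\<close>)

text \<open>The difference z of the two sides is orthogonal to v, so adding z stays in the
  hyperplane; constancy of w along this step gives z \<bullet> z = 0.\<close>

lemma const_on_hyperplane:
  fixes v w :: "'a::real_inner"
  assumes nz: "v \<noteq> 0" and w: "\<And>x. v \<bullet> x = 1 \<Longrightarrow> w \<bullet> x = c"
  shows "w = c *\<^sub>R v"
proof -
  let ?z = "w - c *\<^sub>R v" and ?x = "(1 / (v \<bullet> v)) *\<^sub>R v"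
  have vx: "v \<bullet> ?x = 1" using nz by simp
  have zx: "?z \<bullet> ?x = 0" using w[OF vx] vx by (metis inner_diff_left inner_scaleR_left diff_self mult_1_right)
  then have zv: "v \<bullet> ?z = 0" using nz by (simp add: inner_commute)
  then have "v \<bullet> (?x + ?z) = 1" using vx by (simp add: inner_add_right)
  then have "?z \<bullet> (?x + ?z) = 0" using w[of "?x + ?z"] by (simp add: inner_diff_left)
  then have "?z \<bullet> ?z = 0" using zx by (simp only: inner_add_right)
  then show ?thesis by simp
qed

lemma const_on_facet:
  fixes P :: "'a::euclidean_space set"
  assumes "interior P \<noteq> {}" "F facet_of P" and v: "F \<subseteq> {x. v \<bullet> x = 1}" and w: "F \<subseteq> {x. w \<bullet> x = c}"
  shows "w = c *\<^sub>R v"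
proof -
  have "v \<noteq> 0" using assms(2,3) by (auto simp: facet_of_def)
  moreover have "affine hull F \<subseteq> {x. w \<bullet> x = c}" using w by (simp add: hull_minimal affine_hyperplane)
  ultimately show ?thesis
    using facet_affine_hull_eq_hyperplane[OF assms(1,2) v] by (intro const_on_hyperplane) auto
qed

text \<open>The lattice vector w of pairing 1 certifies that v is primitive. A competing normal is a
  nonnegative multiple of v because both are constant on the facet; pairing with w makes the factor
  an integer, and primitivity makes it 1. The level c is any positive number so that facets of
  \<Delta> and of \<open>height_dual \<Delta> h\<close> are both covered.\<close>

lemma facet_normal_eq:
  fixes P :: "(real ^ 'n) set"
  assumes int0: "0 \<in> interior P" and F: "F facet_of P" and v: "v \<in> int_lattice"
    and vF: "F \<subseteq> {x. v \<bullet> x = c}" and vP: "P \<subseteq> {x. v \<bullet> x \<le> c}" and c: "c > 0"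
    and w: "w \<in> int_lattice" "v \<bullet> w = 1"
  shows "facet_normal P F = v"
  unfolding facet_normal_def
proof (rule the_equality)
  show "primitive v \<and> (\<forall>y\<in>F. \<forall>x\<in>P. v \<bullet> x \<le> v \<bullet> y)"
  proof
    show "primitive v"
      unfolding primitive_def
    proof (intro conjI ballI allI impI)
      fix w' and k :: nat assume w': "w' \<in> int_lattice" "v = real k *\<^sub>R w'"
      then obtain j where j: "w' \<bullet> w = of_int j" using int_lattice_inner[OF w'(1) w(1)] by (auto simp: Ints_def)
      have "real k * of_int j = 1" using w w' j by simp
      then have "int k * j = 1" by (metis of_int_eq_1_iff of_int_mult of_int_of_nat_eq)
      then show "k = 1" using pos_zmult_eq_1_iff_lemma zmult_eq_1_iff by fastforce
    qed (rule v)
    show "\<forall>y\<in>F. \<forall>x\<in>P. v \<bullet> x \<le> v \<bullet> y" using vF vP by auto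
  qed
next
  fix v' assume v': "primitive v' \<and> (\<forall>y\<in>F. \<forall>x\<in>P. v' \<bullet> x \<le> v' \<bullet> y)"
  have FP: "F \<subseteq> P" "F \<noteq> {}" using F by (auto simp: facet_of_def face_of_imp_subset)
  then obtain y where y: "y \<in> F" "y \<in> P" by auto
  define e where "e = v' \<bullet> y"
  have e0: "e \<ge> 0" using v' y int0 interior_subset[of P] by (force simp: e_def)
  have "F \<subseteq> {x. v' \<bullet> x = e}" using v' y FP by (auto simp: e_def intro!: antisym)
  moreover have "F \<subseteq> {x. ((1 / c) *\<^sub>R v) \<bullet> x = 1}" using vF c by auto
  ultimately have "v' = e *\<^sub>R (1 / c) *\<^sub>R v" using const_on_facet[OF _ F] int0 by blast
  then have v'e: "v' = (e / c) *\<^sub>R v" by simp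
  have "v' \<bullet> w \<in> \<int>" using v' w int_lattice_inner primitive_def by blast
  then have "e / c \<in> \<int>" using v'e w by simp
  then obtain k where "e / c = of_int k" by (auto simp: Ints_def)
  moreover have "e / c \<ge> 0" using e0 c by simp
  ultimately have k: "e / c = real (nat k)" by simp
  then have "nat k = 1" using v' v v'e unfolding primitive_def by metis
  then show "v' = v" using v'e k by simp
qed

lemma frontier_polytope_eq_facets:
  fixes P :: "'a::euclidean_space set"
  assumes "polytope P" "interior P \<noteq> {}"
  shows "frontier P = \<Union> {F. F facet_of P}"
proof -
  have "frontier P = P - rel_interior P"
    using assms by (simp add: frontier_def closure_closed polytope_imp_closed rel_interior_nonempty_interior)
  then show ?thesis using rel_boundary_of_polyhedron[OF polytope_imp_polyhedron[OF assms(1)]] by simp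
qed

lemma zero_in_interior_halfspaces:
  fixes W :: "'a::euclidean_space set"
  assumes "finite W"
  shows "0 \<in> interior {x. \<forall>v\<in>W. v \<bullet> x \<le> 1}"
proof (rule interiorI)
  show "open (\<Inter>v\<in>W. {x. v \<bullet> x < 1})" using assms by (intro open_INT) (auto simp: open_halfspace_lt)
qed force+

lemma ray_meets_frontier:
  fixes P :: "'a::euclidean_space set"
  assumes "0 \<in> interior P" "closed P" "x \<notin> P"
  obtains s where "0 < s" "s < 1" "s *\<^sub>R x \<in> frontier P"
proof -
  have "closed_segment 0 x \<inter> frontier P \<noteq> {}"
    using assms interior_subset[of P] by (intro connected_Int_frontier) auto
  then obtain s where s: "0 \<le> s" "s \<le> 1" "s *\<^sub>R x \<in> frontier P" by (auto simp: in_segment)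
  have "s \<noteq> 0" using s assms(1) by (auto simp: frontier_def)
  moreover have "s \<noteq> 1" using s assms(2,3) frontier_subset_closed[of P] by auto
  ultimately show thesis using that[of s] s by simp
qed

lemma facet_of_unique:
  fixes P :: "'a::euclidean_space set"
  assumes "F facet_of P" "F' facet_of P" "x \<in> rel_interior F" "x \<in> F'" "convex P"
  shows "F = F'"
proof (rule ccontr)
  assume ne: "F \<noteq> F'"
  have sub: "F \<subseteq> F'"
    by (rule subset_of_face_of[OF facet_of_imp_face_of[OF assms(2)] facet_of_imp_subset[OF assms(1)]])
      (use assms in blast)
  have "F face_of F'"
    using face_of_subset[OF facet_of_imp_face_of[OF assms(1)] sub] facet_of_imp_subset[OF assms(2)] by auto
  then have "aff_dim F < aff_dim F'"
    using face_of_aff_dim_lt ne face_of_imp_convex facet_of_imp_face_of assms by blast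
  then show False using assms by (simp add: facet_of_def)
qed

section \<open>Lebesgue measure and lattice automorphisms\<close>

text \<open>
  The change of variables formula of the library requires a well-ordered index type; every finite
  type has a well-ordered copy.
\<close>

typedef 'a well_ordered_copy = "UNIV :: 'a set" ..

instance well_ordered_copy :: (finite) finite
proof
  have "(UNIV :: 'a well_ordered_copy set) = range Abs_well_ordered_copy"
    by (metis Rep_well_ordered_copy_inverse surjI)
  then show "finite (UNIV :: 'a well_ordered_copy set)" by (metis finite finite_imageI)
qed

instantiation well_ordered_copy :: (finite) wellorder
begin

definition less_eq_well_ordered_copy :: "'a well_ordered_copy \<Rightarrow> 'a well_ordered_copy \<Rightarrow> bool" where
  "x \<le> y \<longleftrightarrow> to_nat (Rep_well_ordered_copy x) \<le> to_nat (Rep_well_ordered_copy y)"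

definition less_well_ordered_copy :: "'a well_ordered_copy \<Rightarrow> 'a well_ordered_copy \<Rightarrow> bool" where
  "x < y \<longleftrightarrow> to_nat (Rep_well_ordered_copy x) < to_nat (Rep_well_ordered_copy y)"

instance
proof
  fix P :: "'a well_ordered_copy \<Rightarrow> bool" and a
  assume *: "\<And>x. (\<And>y. y < x \<Longrightarrow> P y) \<Longrightarrow> P x"
  show "P a"
    by (rule measure_induct_rule[of "\<lambda>x. to_nat (Rep_well_ordered_copy x)"])
      (rule *, simp add: less_well_ordered_copy_def)
qed (auto simp: less_eq_well_ordered_copy_def less_well_ordered_copy_def Rep_well_ordered_copy_inject)

end

lemma prod_Basis_cart: "(\<Prod>e\<in>Basis. f (x \<bullet> e)) = (\<Prod>i\<in>UNIV. f (x $ i))" for x :: "real ^ 'n"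
proof -
  have B: "(Basis :: (real ^ 'n) set) = range (\<lambda>i. axis i 1)" by (auto simp: Basis_vec_def)
  have "inj (\<lambda>i::'n. axis i (1::real))" by (auto simp: inj_def axis_eq_axis)
  then show ?thesis unfolding B by (subst prod.reindex) (auto simp: inner_axis)
qed

text \<open>Relabelling coordinates maps boxes to boxes and permutes their edge lengths, and boxes
  determine Lebesgue measure.\<close>

lemma lborel_distr_reindex:
  fixes p :: "'m::finite \<Rightarrow> 'n::finite"
  assumes "bij p"
  shows "distr lborel borel (\<lambda>x :: real ^ 'n. \<chi> i. x $ p i) = (lborel :: (real ^ 'm) measure)"
proof (rule lborel_eqI[symmetric])
  let ?R = "\<lambda>x :: real ^ 'n. (\<chi> i. x $ p i) :: real ^ 'm"
  let ?R' = "\<lambda>y :: real ^ 'm. (\<chi> i. y $ inv p i) :: real ^ 'n"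
  have [measurable]: "?R \<in> borel_measurable borel"
    by (intro borel_measurable_continuous_onI continuous_intros)
  fix l u :: "real ^ 'm" assume le: "\<And>e. e \<in> Basis \<Longrightarrow> l \<bullet> e \<le> u \<bullet> e"
  have pinv: "p (inv p i) = i" "inv p (p j) = j" for i j
    using assms by (auto simp: bij_is_inj bij_is_surj surj_f_inv_f)
  have le': "l $ i \<le> u $ i" for i
    using le[OF axis_in_Basis_iff[THEN iffD2], of 1 i] by (simp add: inner_axis)
  have "?R -` box l u = box (?R' l) (?R' u)"
  proof -
    have "(\<forall>i. l $ i < x $ p i \<and> x $ p i < u $ i) \<longleftrightarrow> (\<forall>j. l $ inv p j < x $ j \<and> x $ j < u $ inv p j)" for x
    proof
      assume *: "\<forall>i. l $ i < x $ p i \<and> x $ p i < u $ i"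
      show "\<forall>j. l $ inv p j < x $ j \<and> x $ j < u $ inv p j"
        using *[rule_format, of "inv p _"] unfolding pinv by blast
    next
      assume *: "\<forall>j. l $ inv p j < x $ j \<and> x $ j < u $ inv p j"
      show "\<forall>i. l $ i < x $ p i \<and> x $ p i < u $ i"
        using *[rule_format, of "p _"] unfolding pinv by blast
    qed
    then show ?thesis by (simp add: mem_box_cart set_eq_iff)
  qed
  then have "emeasure (distr lborel borel ?R) (box l u) = emeasure lborel (box (?R' l) (?R' u))"
    by (subst emeasure_distr) auto
  also have "\<dots> = (\<Prod>e\<in>Basis. (?R' u - ?R' l) \<bullet> e)"
    using le' by (intro emeasure_lborel_box) (auto simp: Basis_vec_def inner_axis)
  also have "(\<Prod>e\<in>Basis. (?R' u - ?R' l) \<bullet> e) = (\<Prod>i\<in>UNIV. (u - l) $ inv p i)"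
    by (subst prod_Basis_cart[of "\<lambda>x. x"]) simp
  also have "\<dots> = (\<Prod>i\<in>UNIV. (u - l) $ i)"
    by (rule prod.reindex_bij_betw) (simp add: assms bij_imp_bij_inv)
  also have "\<dots> = (\<Prod>e\<in>Basis. (u - l) \<bullet> e)"
    by (subst prod_Basis_cart[of "\<lambda>x. x"]) simp
  finally show "emeasure (distr lborel borel ?R) (box l u) = (\<Prod>e\<in>Basis. (u - l) \<bullet> e)" .
qed simp

lemma det_Ints: "(\<And>i j. A $ i $ j \<in> \<int>) \<Longrightarrow> det A \<in> \<int>" for A :: "real ^ 'n ^ 'n"
  by (auto simp: det_def intro!: Ints_sum Ints_mult Ints_prod)

text \<open>Both matrices have integer entries, so their determinants are integers with product
  1.\<close>

lemma det_lattice_automorphism: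
  fixes f g :: "real ^ 'n \<Rightarrow> real ^ 'n"
  assumes "linear f" "linear g" "\<And>x. g (f x) = x"
    and "f ` int_lattice \<subseteq> int_lattice" "g ` int_lattice \<subseteq> int_lattice"
  shows "\<bar>det (matrix f)\<bar> = 1"
proof -
  have int: "det (matrix k) \<in> \<int>" if "k ` int_lattice \<subseteq> int_lattice" for k :: "real ^ 'n \<Rightarrow> real ^ 'n"
  proof (rule det_Ints)
    fix i j
    have "k (axis j 1) \<in> int_lattice" using that int_lattice_axis by blast
    then show "matrix k $ i $ j \<in> \<int>" by (simp add: matrix_def int_lattice_def)
  qed
  have "g \<circ> f = id" using assms by auto
  then have "matrix g ** matrix f = mat 1"
    using matrix_compose[OF assms(1,2)] matrix_id_mat_1 by metis
  then have "det (matrix g) * det (matrix f) = 1" by (metis det_mul det_I)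
  moreover obtain a where a: "det (matrix g) = of_int a" using int[OF assms(5)] by (rule Ints_cases)
  moreover obtain b where b: "det (matrix f) = of_int b" using int[OF assms(4)] by (rule Ints_cases)
  ultimately have "of_int (a * b) = (1::real)" by simp
  then have "a * b = 1" using of_int_eq_1_iff by blast
  then have "b = 1 \<or> b = -1" using zmult_eq_1_iff by blast
  with b show ?thesis by auto
qed

text \<open>The determinant formula is applied to the conjugate of f by the relabelling
  \<open>?R\<close> of coordinates, which preserves Lebesgue measure. Boundedness of S keeps the
  measures finite, as that formula requires.\<close>

lemma emeasure_lattice_automorphism_image:
  fixes f g :: "real ^ 'n \<Rightarrow> real ^ 'n"
  assumes f: "linear f" and g: "linear g" and gf: "\<And>x. g (f x) = x" and fg: "\<And>x. f (g x) = x"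
    and fint: "f ` int_lattice \<subseteq> int_lattice" and gint: "g ` int_lattice \<subseteq> int_lattice"
    and S: "S \<in> sets borel" "bounded S"
  shows "f ` S \<in> sets borel" "emeasure lborel (f ` S) = emeasure lborel S"
proof -
  have imv: "F ` T = G -` T" if "\<And>x. G (F x) = x" "\<And>x. F (G x) = x"
    for F :: "'u \<Rightarrow> 'v" and G T
  proof safe
    fix x assume "G x \<in> T"
    then show "x \<in> F ` T" using that(2)[of x] by (intro image_eqI[of _ _ "G x"]) simp_all
  qed (simp add: that)
  have fm: "f ` S = g -` S" by (rule imv[OF gf fg])
  have lin_borel: "k \<in> borel_measurable borel" if "linear k" for k :: "real ^ 'm::finite \<Rightarrow> real ^ 'k::finite"
    using that by (intro borel_measurable_continuous_onI linear_continuous_on linear_conv_bounded_linear[THEN iffD1])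
  show "f ` S \<in> sets borel" unfolding fm using measurable_sets[OF lin_borel[OF g] S(1)] by simp
  let ?R = "\<lambda>x :: real ^ 'n. (\<chi> i. x $ Rep_well_ordered_copy i) :: real ^ 'n well_ordered_copy"
  let ?R' = "\<lambda>y :: real ^ 'n well_ordered_copy. (\<chi> i. y $ Abs_well_ordered_copy i) :: real ^ 'n"
  have RR: "?R (?R' y) = y" "?R' (?R x) = x" for x y
    by (auto simp: Rep_well_ordered_copy_inverse Abs_well_ordered_copy_inverse vec_eq_iff)
  have linR: "linear ?R" "linear ?R'" by (auto intro!: linearI simp: vec_eq_iff)
  have bij: "bij (Rep_well_ordered_copy :: 'n well_ordered_copy \<Rightarrow> 'n)"
    by (rule bij_betw_byWitness[where f' = Abs_well_ordered_copy])
      (simp_all add: Rep_well_ordered_copy_inverse Abs_well_ordered_copy_inverse)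
  have Rpres: "emeasure lborel (?R -` T) = emeasure lborel T" if "T \<in> sets borel" for T
  proof -
    have "emeasure lborel T = emeasure (distr lborel borel ?R) T" by (simp add: lborel_distr_reindex[OF bij])
    then show ?thesis using that lin_borel[OF linR(1)] by (subst (asm) emeasure_distr) auto
  qed
  define f' where "f' = (\<lambda>y. ?R (f (?R' y)))"
  define g' where "g' = (\<lambda>y. ?R (g (?R' y)))"
  have lin': "linear f'" "linear g'"
    using linear_compose[OF linR(2) linear_compose[OF f linR(1)]] linear_compose[OF linR(2) linear_compose[OF g linR(1)]]
    unfolding f'_def g'_def by (simp_all add: o_def)
  have gf': "g' (f' y) = y" "f' (g' y) = y" for y
    unfolding f'_def g'_def RR(2) gf fg by (rule RR(1))+
  have "?R ` int_lattice \<subseteq> int_lattice" "?R' ` int_lattice \<subseteq> int_lattice"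
    by (auto simp: int_lattice_def)
  then have int': "f' ` int_lattice \<subseteq> int_lattice" "g' ` int_lattice \<subseteq> int_lattice"
    using fint gint unfolding f'_def g'_def by (simp_all add: image_subset_iff)
  define S' where "S' = ?R' -` S"
  have S'b: "S' \<in> sets borel" unfolding S'_def using measurable_sets[OF lin_borel[OF linR(2)] S(1)] by simp
  have "S' = ?R ` S" unfolding S'_def by (rule imv[symmetric]) (use RR in auto)
  then have S'bd: "bounded S'" using S(2) linR(1) by (simp add: bounded_linear_image linear_conv_bounded_linear)
  have f'S: "f' ` S' = g' -` S'" by (rule imv[OF gf'])
  have f'Sb: "f' ` S' \<in> sets borel" unfolding f'S using measurable_sets[OF lin_borel[OF lin'(2)] S'b] by simp
  have S'l: "S' \<in> lmeasurable" using S'b S'bd by (intro bounded_set_imp_lmeasurable) auto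
  have f'Sl: "f' ` S' \<in> lmeasurable" by (rule measurable_linear_image[OF lin'(1) S'l])
  have "measure lebesgue (f' ` S') = measure lebesgue S'"
    using measure_linear_image[OF lin'(1) S'l] det_lattice_automorphism[OF lin' gf'(1) int'] by simp
  then have "emeasure lebesgue (f' ` S') = emeasure lebesgue S'"
    using S'l f'Sl by (simp add: emeasure_eq_measure2 fmeasurableD2)
  then have eq: "emeasure lborel (f' ` S') = emeasure lborel S'" using S'b f'Sb by simp
  have "?R -` S' = S" unfolding S'_def using RR by auto
  moreover have "?R -` (f' ` S') = f ` S"
  proof -
    have "?R -` (g' -` S') = {x. ?R' (?R (g (?R' (?R x)))) \<in> S}"
      unfolding S'_def g'_def by auto
    then show ?thesis unfolding f'S fm RR(2) by auto
  qed
  ultimately show "emeasure lborel (f ` S) = emeasure lborel S"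
    using Rpres[OF S'b] Rpres[OF f'Sb] eq by simp
qed

text \<open>The translates of a bounded piece by e / (k + 1) are pairwise disjoint, of equal measure
  and contained in one ball, so infinitely many of them fit only if this measure is 0.\<close>

lemma negligible_if_translates_disjoint:
  fixes Y :: "'a::euclidean_space set"
  assumes "closed Y" and disj: "\<And>t y. t > 0 \<Longrightarrow> y \<in> Y \<Longrightarrow> y + t *\<^sub>R e \<notin> Y"
  shows "negligible Y"
proof -
  have "negligible (Y \<inter> cball 0 R)" for R
  proof -
    let ?C = "Y \<inter> cball 0 R"
    define D where "D k = (+) ((1 / real (Suc k)) *\<^sub>R e) ` ?C" for k :: nat
    have C: "?C \<in> lmeasurable" using assms(1) by (intro lmeasurable_compact closed_Int_compact) auto
    have D: "D k \<in> lmeasurable" for k unfolding D_def by (rule measurable_translation[OF C])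
    have "D i \<inter> D j = {}" if "i < j" for i j
    proof (rule ccontr)
      assume "D i \<inter> D j \<noteq> {}"
      then obtain y z where yz: "y \<in> Y" "z \<in> Y"
        "(1 / real (Suc i)) *\<^sub>R e + y = (1 / real (Suc j)) *\<^sub>R e + z" by (auto simp: D_def)
      then have "z = y + (1 / real (Suc i) - 1 / real (Suc j)) *\<^sub>R e"
        by (simp add: algebra_simps)
      moreover have "1 / real (Suc i) - 1 / real (Suc j) > 0" using that by (simp add: frac_less2)
      ultimately show False using disj yz by blast
    qed
    then have dis: "disjoint_family_on D {..<n}" for n
      unfolding disjoint_family_on_def by (metis inf_commute linorder_neqE_nat)
    have sub: "(\<Union>k<n. D k) \<subseteq> cball 0 (R + norm e)" for n
    proof -
      have "norm ((1 / real (Suc k)) *\<^sub>R e + y) \<le> R + norm e" if "norm y \<le> R" for k y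
      proof -
        have "norm ((1 / real (Suc k)) *\<^sub>R e) \<le> norm e"
          by (simp add: divide_le_eq mult_le_cancel_left1)
        then show ?thesis using norm_triangle_ineq[of "(1 / real (Suc k)) *\<^sub>R e" y] that by linarith
      qed
      then show ?thesis by (auto simp: D_def)
    qed
    have "real n * measure lebesgue ?C \<le> measure lebesgue (cball (0::'a) (R + norm e))" for n
    proof -
      have "real n * measure lebesgue ?C = (\<Sum>k<n. measure lebesgue (D k))"
        unfolding D_def by (simp add: measure_translation)
      also have "\<dots> = measure lebesgue (\<Union>k<n. D k)"
        using D by (intro measure_finite_Union[symmetric] dis) (auto simp del: emeasure_completion dest: fmeasurableD2)
      also have "\<dots> \<le> measure lebesgue (cball (0::'a) (R + norm e))"
        using D by (intro measure_mono_fmeasurable sub) (auto intro!: sets.finite_UN)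
      finally show ?thesis .
    qed
    then have "\<not> measure lebesgue ?C > 0"
      using ex_less_of_nat_mult[of "measure lebesgue ?C"] by (meson not_le)
    then have "measure lebesgue ?C = 0" by (simp add: order_antisym)
    then show ?thesis using C by (simp add: negligible_iff_measure)
  qed
  then have "negligible (\<Union>k::nat. Y \<inter> cball 0 (real k))" by (intro negligible_countable_Union) auto
  moreover have "Y = (\<Union>k::nat. Y \<inter> cball 0 (real k))" using real_arch_simple by auto
  ultimately show ?thesis by simp
qed

section \<open>Reflexive polytopes\<close>

locale tropical_reflexive =
  fixes \<Delta> :: "(real ^ 'n) set"
    and h :: "real ^ 'n \<Rightarrow> int"
    and b :: "(real ^ 'n) set \<Rightarrow> 'd::finite \<Rightarrow> real ^ 'n"
  assumes card: "CARD('n) = CARD('d) + 1"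
    and reflexive: "reflexive_polytope \<Delta>"
    and height: "height_function \<Delta> h"
    and bases: "facet_bases \<Delta> b"
begin

abbreviation "K \<equiv> height_dual \<Delta> h"
abbreviation "A \<equiv> frontier \<Delta>"
abbreviation "B \<equiv> frontier K"
abbreviation "L \<equiv> \<Delta> \<inter> int_lattice"
abbreviation "N \<equiv> facet_normal \<Delta>"
abbreviation "mt \<equiv> facet_normal K"

lemma polytope_Delta: "polytope \<Delta>"
  using reflexive by (auto simp: reflexive_polytope_def lattice_polytope_def polytope_def)

lemma compact_Delta: "compact \<Delta>" and convex_Delta: "convex \<Delta>" and closed_Delta: "closed \<Delta>"
  using polytope_Delta by (auto simp: polytope_imp_compact polytope_imp_convex polytope_imp_closed)

lemma zero_interior_Delta: "0 \<in> interior \<Delta>"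
  using reflexive by (simp add: reflexive_polytope_def)

lemma zero_in_L: "0 \<in> L"
  using zero_interior_Delta interior_subset by (auto simp: int_lattice_def)

lemma Delta_eq_hull_L: "\<Delta> = convex hull L"
proof -
  obtain V where V: "V \<subseteq> int_lattice" "\<Delta> = convex hull V"
    using reflexive by (auto simp: reflexive_polytope_def lattice_polytope_def)
  then have "V \<subseteq> L" using hull_subset[of V] by auto
  then show ?thesis using V(2) convex_Delta by (metis Int_lower1 hull_minimal hull_mono subset_antisym)
qed

lemma finite_L: "finite L"
  by (rule finite_bounded_int_lattice[OF compact_imp_bounded[OF compact_Delta]])

text \<open>Bipolar duality: a hyperplane separating z from \<Delta> has negative level c because 0
  is in \<Delta>. Rescaled by 1 / c, its normal is a point of the dual polytope, and z violates the
  inequality which that point inherits from the generators W.\<close>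

lemma Delta_halfspaces:
  obtains W where "finite W" "W \<subseteq> int_lattice" "\<Delta> = {m. \<forall>w\<in>W. w \<bullet> m \<le> 1}"
proof -
  obtain W where W: "finite W" "W \<subseteq> int_lattice" "dual_polytope \<Delta> = convex hull W"
    using reflexive by (auto simp: reflexive_polytope_def lattice_polytope_def)
  have "\<Delta> = {m. \<forall>w\<in>W. w \<bullet> m \<le> 1}"
  proof (intro equalityI subsetI CollectI ballI)
    fix m w assume "m \<in> \<Delta>" "w \<in> W"
    have "w \<in> dual_polytope \<Delta>" unfolding W(3) using \<open>w \<in> W\<close> by (rule hull_inc)
    then show "w \<bullet> m \<le> 1" using \<open>m \<in> \<Delta>\<close> by (auto simp: dual_polytope_def inner_commute)
  next
    fix z assume z: "z \<in> {m. \<forall>w\<in>W. w \<bullet> m \<le> 1}"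
    show "z \<in> \<Delta>"
    proof (rule ccontr)
      assume "z \<notin> \<Delta>"
      then obtain a c where ac: "a \<bullet> z < c" "\<forall>x\<in>\<Delta>. a \<bullet> x > c"
        using separating_hyperplane_closed_point[OF convex_Delta closed_Delta] by blast
      have c: "c < 0" using ac(2) zero_in_L by auto
      have "\<forall>x\<in>\<Delta>. x \<bullet> ((1 / c) *\<^sub>R a) \<le> 1" using ac(2) c by (auto simp: inner_commute divide_simps)
      then have "(1 / c) *\<^sub>R a \<in> convex hull W" unfolding W(3)[symmetric] by (simp add: dual_polytope_def)
      moreover have "W \<subseteq> {n. z \<bullet> n \<le> 1}" using z by (auto simp: inner_commute)
      then have "convex hull W \<subseteq> {n. z \<bullet> n \<le> 1}" by (rule hull_minimal) (rule convex_halfspace_le)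
      ultimately have "z \<bullet> ((1 / c) *\<^sub>R a) \<le> 1" by blast
      then show False using ac(1) c by (simp add: inner_commute divide_simps)
    qed
  qed
  then show thesis using that W by blast
qed

text \<open>The dual polytope supplies a lattice vector w of level 1 on the facet, and the facet,
  being a face of a lattice polytope, contains a lattice point u. Now w \<bullet> u = 1 shows that w
  is primitive, hence the facet normal; every facet is thus at lattice distance 1 from 0.\<close>

lemma facet_Delta:
  assumes "\<sigma> facet_of \<Delta>"
  shows "N \<sigma> \<in> int_lattice" "\<sigma> = {m\<in>\<Delta>. m \<bullet> N \<sigma> = 1}" "\<And>m. m \<in> \<Delta> \<Longrightarrow> m \<bullet> N \<sigma> \<le> 1"
    "\<exists>u\<in>int_lattice. u \<in> \<sigma>"
proof -
  obtain W where W: "finite W" "W \<subseteq> int_lattice" "\<Delta> = {m. \<forall>w\<in>W. w \<bullet> m \<le> 1}"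
    using Delta_halfspaces by blast
  obtain w where w: "w \<in> W" "\<sigma> = {m\<in>\<Delta>. w \<bullet> m = 1}"
    using facet_of_halfspace_system[OF W(3,1) assms] by blast
  obtain V where V: "finite V" "V \<subseteq> int_lattice" "\<Delta> = convex hull V"
    using reflexive by (auto simp: reflexive_polytope_def lattice_polytope_def)
  have "\<sigma> face_of convex hull V" using assms V by (simp add: facet_of_def)
  then obtain V' where V': "V' \<subseteq> V" "\<sigma> = convex hull V'"
    using face_of_convex_hull_subset[of V] finite_imp_compact[OF V(1)] by blast
  have "\<sigma> \<noteq> {}" using assms by (simp add: facet_of_def)
  then obtain u where "u \<in> V'" using V' by auto
  then have u: "u \<in> int_lattice" "u \<in> \<sigma>" using V V' hull_subset[of V'] by auto
  then show "\<exists>u\<in>int_lattice. u \<in> \<sigma>" by blast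
  have Nw: "N \<sigma> = w"
    by (rule facet_normal_eq[OF zero_interior_Delta assms, where c = 1 and w = u]) (use W w u in auto)
  then show "N \<sigma> \<in> int_lattice" "\<sigma> = {m\<in>\<Delta>. m \<bullet> N \<sigma> = 1}" "\<And>m. m \<in> \<Delta> \<Longrightarrow> m \<bullet> N \<sigma> \<le> 1"
    using W w by (auto simp: inner_commute)
qed

lemma facet_inner: "\<sigma> facet_of \<Delta> \<Longrightarrow> x \<in> \<sigma> \<Longrightarrow> x \<bullet> N \<sigma> = 1"
  using facet_Delta(2) by blast

lemma facetI: "\<sigma> facet_of \<Delta> \<Longrightarrow> x \<in> \<Delta> \<Longrightarrow> x \<bullet> N \<sigma> = 1 \<Longrightarrow> x \<in> \<sigma>"
  using facet_Delta(2) by blast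

lemma A_eq_facets: "A = \<Union> {\<sigma>. \<sigma> facet_of \<Delta>}"
  using frontier_polytope_eq_facets[OF polytope_Delta] zero_interior_Delta by blast

lemma finite_facets_Delta: "finite {\<sigma>. \<sigma> facet_of \<Delta>}"
  by (rule finite_polytope_facets[OF polytope_Delta])

lemma A_subset_Delta: "A \<subseteq> \<Delta>"
  by (rule frontier_subset_closed[OF closed_Delta])

lemma facet_subset_A: "\<sigma> facet_of \<Delta> \<Longrightarrow> \<sigma> \<subseteq> A"
  using A_eq_facets by blast

lemma in_A_obtain_facet:
  assumes "x \<in> A" obtains \<sigma> where "\<sigma> facet_of \<Delta>" "x \<in> \<sigma>"
  using assms A_eq_facets by blast

text \<open>If x were outside, its ray would cross A at some s x with 0 < s < 1, on a facet whose
  normal pairs with x to 1 / s > 1.\<close>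

lemma Delta_facet_ineqs: "x \<in> \<Delta> \<longleftrightarrow> (\<forall>\<sigma>. \<sigma> facet_of \<Delta> \<longrightarrow> x \<bullet> N \<sigma> \<le> 1)"
proof
  assume *: "\<forall>\<sigma>. \<sigma> facet_of \<Delta> \<longrightarrow> x \<bullet> N \<sigma> \<le> 1"
  show "x \<in> \<Delta>"
  proof (rule ccontr)
    assume "x \<notin> \<Delta>"
    then obtain s where s: "0 < s" "s < 1" "s *\<^sub>R x \<in> A"
      using ray_meets_frontier[OF zero_interior_Delta closed_Delta] by blast
    then obtain \<sigma> where \<sigma>: "\<sigma> facet_of \<Delta>" "s *\<^sub>R x \<in> \<sigma>" by (blast elim: in_A_obtain_facet)
    then have "s * (x \<bullet> N \<sigma>) = 1" using facet_inner[OF \<sigma>] by simp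
    moreover have "s * (x \<bullet> N \<sigma>) \<le> s * 1" using * \<sigma> s by (intro mult_left_mono) auto
    ultimately show False using s by simp
  qed
qed (use facet_Delta in blast)

text \<open>The normal that is 1 at x bounds t from above, and the normal that is 1 at t x bounds it
  from below.\<close>

lemma A_ray_unique:
  assumes "x \<in> A" "t *\<^sub>R x \<in> A" "t > 0"
  shows "t = 1"
proof -
  obtain \<sigma> where \<sigma>: "\<sigma> facet_of \<Delta>" "x \<in> \<sigma>" using assms by (blast elim: in_A_obtain_facet)
  obtain \<sigma>' where \<sigma>': "\<sigma>' facet_of \<Delta>" "t *\<^sub>R x \<in> \<sigma>'" using assms by (blast elim: in_A_obtain_facet)
  have "x \<bullet> N \<sigma> = 1" "t * (x \<bullet> N \<sigma>') = 1" using facet_inner[OF \<sigma>] facet_inner[OF \<sigma>'] by simp_all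
  moreover have "x \<bullet> N \<sigma>' \<le> 1" "t * (x \<bullet> N \<sigma>) \<le> 1"
    using facet_Delta(3)[OF \<sigma>'(1), of x] facet_Delta(3)[OF \<sigma>(1), of "t *\<^sub>R x"] A_subset_Delta assms by auto
  moreover have "t * (x \<bullet> N \<sigma>') \<le> t" using calculation(3) assms(3) by (simp add: mult_left_le)
  ultimately show ?thesis by simp
qed

text \<open>The pairing is an integer at most 1, and the value 1 occurs only on the facet. This gap
  lets \<open>ray_exits_in_St\<close> ignore the facets that miss u.\<close>

lemma lattice_inner_normal:
  assumes "u \<in> L" "\<sigma> facet_of \<Delta>" "u \<notin> \<sigma>"
  shows "u \<bullet> N \<sigma> \<le> 0"
proof -
  obtain k where k: "u \<bullet> N \<sigma> = of_int k"
    using int_lattice_inner[of u "N \<sigma>"] facet_Delta(1)[OF assms(2)] assms(1) by (auto elim: Ints_cases)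
  have "u \<bullet> N \<sigma> \<le> 1" using facet_Delta(3)[OF assms(2)] assms(1) by auto
  moreover have "u \<bullet> N \<sigma> \<noteq> 1" using facetI[OF assms(2)] assms(1,3) by blast
  ultimately show ?thesis using k by simp
qed

text \<open>A nonzero interior lattice point would pair nonpositively with every facet normal, so
  its whole ray would stay in the bounded set \<Delta>.\<close>

lemma L_subset_A:
  assumes "m \<in> L" "m \<noteq> 0"
  shows "m \<in> A"
proof (rule ccontr)
  assume "m \<notin> A"
  then have "m \<bullet> N \<sigma> \<le> 0" if "\<sigma> facet_of \<Delta>" for \<sigma>
    using lattice_inner_normal[OF assms(1) that] facet_subset_A[OF that] by blast
  then have "r *\<^sub>R m \<in> \<Delta>" if "r \<ge> 0" for r
    using that by (force simp: Delta_facet_ineqs intro: order_trans[OF mult_nonneg_nonpos])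
  moreover obtain C where C: "\<And>x. x \<in> \<Delta> \<Longrightarrow> norm x \<le> C" "C > 0"
    using compact_imp_bounded[OF compact_Delta] by (auto simp: bounded_pos)
  ultimately have "norm (((C + 1) / norm m) *\<^sub>R m) \<le> C" by (meson divide_nonneg_nonneg add_nonneg_nonneg less_imp_le norm_ge_zero zero_le_one)
  moreover have "norm (((C + 1) / norm m) *\<^sub>R m) = C + 1" using assms(2) C(2) by simp
  ultimately show False by simp
qed

lemma height_pos: "m \<in> L \<Longrightarrow> m \<noteq> 0 \<Longrightarrow> 0 < h m" and height_zero: "h 0 = 0"
  using height by (auto simp: height_function_def)

lemma lattice_A_iff: "m \<in> A \<inter> int_lattice \<longleftrightarrow> m \<in> L \<and> m \<noteq> 0"
  using L_subset_A A_subset_Delta zero_interior_Delta by (auto simp: frontier_def)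

section \<open>The polytope \<open>K\<close> and its facets\<close>

lemma K_eq_halfspaces: "K = {n. \<forall>v\<in>(\<lambda>m. (1 / real_of_int (h m)) *\<^sub>R m) ` (L - {0}). v \<bullet> n \<le> 1}"
proof -
  have "m \<bullet> n \<le> h m \<longleftrightarrow> m \<bullet> n / h m \<le> 1" if "m \<in> L" "m \<noteq> 0" for m n
    using height_pos[OF that] by (simp add: divide_le_eq)
  then show ?thesis using height_zero by (auto simp: height_dual_def) fastforce
qed

lemma zero_interior_K: "0 \<in> interior K"
  unfolding K_eq_halfspaces by (rule zero_in_interior_halfspaces) (use finite_L in simp)

lemma K_ineq: "n \<in> K \<Longrightarrow> m \<in> L \<Longrightarrow> m \<bullet> n \<le> h m"
  by (auto simp: height_dual_def)

lemma bounded_K: "bounded K"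
proof -
  obtain r where r: "r > 0" "ball 0 r \<subseteq> \<Delta>"
    using zero_interior_Delta mem_interior by blast
  define H where "H = (\<Sum>m\<in>L. \<bar>real_of_int (h m)\<bar>)"
  have "norm n \<le> 2 * H / r" if n: "n \<in> K" for n
  proof (cases "n = 0")
    case False
    have "m \<bullet> n \<le> H" if "m \<in> L" for m
      using K_ineq[OF n that] member_le_sum[OF that, of "\<lambda>m. \<bar>real_of_int (h m)\<bar>"] finite_L
      unfolding H_def by fastforce
    then have "L \<subseteq> {m. n \<bullet> m \<le> H}" by (auto simp: inner_commute)
    then have "\<Delta> \<subseteq> {m. n \<bullet> m \<le> H}"
      using hull_minimal[of L _ convex] convex_halfspace_le Delta_eq_hull_L by metis
    \<comment> \<open>Length r / 2 keeps the test vector inside the open ball; pairing it with n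
      bounds the norm of n.\<close>
    moreover have "(r / 2 / norm n) *\<^sub>R n \<in> \<Delta>" using r False by (intro subsetD[OF r(2)]) simp
    ultimately have "n \<bullet> ((r / 2 / norm n) *\<^sub>R n) \<le> H" by blast
    then have "(r / 2) * norm n \<le> H" using False by (simp add: power2_norm_eq_inner[symmetric] power2_eq_square)
    then show ?thesis using r by (simp add: field_simps)
  qed (use r in \<open>simp add: H_def sum_nonneg\<close>)
  then show ?thesis by (auto simp: bounded_iff)
qed

lemma polytope_K: "polytope K"
proof -
  have "K = \<Inter> ((\<lambda>m. {n. m \<bullet> n \<le> h m}) ` L)" by (auto simp: height_dual_def)
  moreover have "polyhedron (\<Inter> ((\<lambda>m. {n. m \<bullet> n \<le> h m}) ` L))"
    using finite_L by (intro polyhedron_Inter) (auto intro: polyhedron_halfspace_le)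
  ultimately have "polyhedron K" by simp
  then show ?thesis using bounded_K polytope_eq_bounded_polyhedron by blast
qed

lemma compact_K: "compact K" and convex_K: "convex K" and closed_K: "closed K"
  using polytope_K by (auto simp: polytope_imp_compact polytope_imp_convex polytope_imp_closed)

lemma B_eq_facets: "B = \<Union> {\<tau>. \<tau> facet_of K}"
  using frontier_polytope_eq_facets[OF polytope_K] zero_interior_K by blast

lemma finite_facets_K: "finite {\<tau>. \<tau> facet_of K}"
  by (rule finite_polytope_facets[OF polytope_K])

lemma B_subset_K: "B \<subseteq> K"
  by (rule frontier_subset_closed[OF closed_K])

lemma compact_A: "compact A" and compact_B: "compact B"
  using compact_Delta compact_K by (simp_all add: compact_frontier)

text \<open>Some nonzero m in \<open>L\<close> cuts out the facet. This m lies on a facet \<sigma>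
  of \<Delta>, and its pairing 1 with \<open>N \<sigma>\<close> certifies that it is
  primitive.\<close>

lemma facet_K:
  assumes "\<tau> facet_of K"
  shows "mt \<tau> \<in> L" "mt \<tau> \<noteq> 0" "\<tau> = {n\<in>K. mt \<tau> \<bullet> n = h (mt \<tau>)}"
proof -
  have "finite ((\<lambda>m. (1 / real_of_int (h m)) *\<^sub>R m) ` (L - {0}))" using finite_L by simp
  then obtain v where v: "v \<in> (\<lambda>m. (1 / real_of_int (h m)) *\<^sub>R m) ` (L - {0})" "\<tau> = {x \<in> K. v \<bullet> x = 1}"
    using facet_of_halfspace_system[OF K_eq_halfspaces _ assms] by blast
  then obtain m where m: "m \<in> L" "m \<noteq> 0" "v = (1 / real_of_int (h m)) *\<^sub>R m" by blast
  have hm: "real_of_int (h m) > 0" using height_pos m by simp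
  have \<tau>: "\<tau> = {n\<in>K. m \<bullet> n = h m}" using v(2) hm by (simp add: m(3) divide_eq_eq)
  obtain \<sigma> where \<sigma>: "\<sigma> facet_of \<Delta>" "m \<in> \<sigma>" using L_subset_A[OF m(1,2)] by (blast elim: in_A_obtain_facet)
  have "mt \<tau> = m"
    by (rule facet_normal_eq[OF zero_interior_K assms, where c = "h m" and w = "N \<sigma>"])
      (use m \<tau> hm \<sigma> facet_Delta(1) facet_inner K_ineq in auto)
  with m \<tau> show "mt \<tau> \<in> L" "mt \<tau> \<noteq> 0" "\<tau> = {n\<in>K. mt \<tau> \<bullet> n = h (mt \<tau>)}" by simp_all
qed

lemma facet_K_inner: "\<tau> facet_of K \<Longrightarrow> n \<in> \<tau> \<Longrightarrow> mt \<tau> \<bullet> n = h (mt \<tau>)"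
  using facet_K(3) by blast

lemma mt_in_A: "\<tau> facet_of K \<Longrightarrow> mt \<tau> \<in> A"
  using facet_K L_subset_A by blast

lemma tau_face_mt: "\<tau> facet_of K \<Longrightarrow> tau_face \<Delta> h (mt \<tau>) = \<tau>"
  using facet_K(3) unfolding tau_face_def by blast

text \<open>A relative interior point forces the whole facet into the hyperplane of m, so m is a
  positive multiple of \<open>mt \<tau>\<close>; both lie on A, and a ray from 0 meets A only once.
  Hence over \<open>rel_interior \<tau>\<close> the stable region reduces to
  \<open>St \<Delta> (mt \<tau>)\<close>.\<close>

lemma tau_face_rel_interior:
  assumes \<tau>: "\<tau> facet_of K" and n: "n \<in> rel_interior \<tau>" and m: "m \<in> A \<inter> int_lattice" "n \<in> tau_face \<Delta> h m"
  shows "m = mt \<tau>"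
proof -
  have mL: "m \<in> L" "m \<noteq> 0" using m lattice_A_iff by auto
  let ?F = "K \<inter> {x. m \<bullet> x = h m}"
  have "?F face_of K"
    by (rule face_of_Int_supporting_hyperplane_le[OF convex_K]) (use K_ineq mL in blast)
  then have "\<tau> \<subseteq> ?F"
    by (rule subset_of_face_of[OF _ facet_of_imp_subset[OF \<tau>]]) (use n m in \<open>auto simp: tau_face_def\<close>)
  then have "\<tau> \<subseteq> {x. m \<bullet> x = h m}" by blast
  moreover have hpos: "0 < h (mt \<tau>)" "0 < h m" using height_pos facet_K[OF \<tau>] mL by auto
  moreover have "\<tau> \<subseteq> {x. ((1 / h (mt \<tau>)) *\<^sub>R mt \<tau>) \<bullet> x = 1}" using facet_K_inner[OF \<tau>] hpos(1) by auto
  ultimately have eq: "m = h m *\<^sub>R (1 / h (mt \<tau>)) *\<^sub>R mt \<tau>" using const_on_facet[OF _ \<tau>] zero_interior_K by blast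
  then have "(h m / h (mt \<tau>)) *\<^sub>R mt \<tau> \<in> A" using m(1) by simp
  then have "h m / h (mt \<tau>) = (1::real)" using hpos by (intro A_ray_unique[OF mt_in_A[OF \<tau>]]) auto
  then show ?thesis using eq by simp
qed

section \<open>Stars, and rays in the direction of a lattice point\<close>

lemma St_iff: "x \<in> St \<Delta> m \<longleftrightarrow> (\<exists>\<sigma>. \<sigma> facet_of \<Delta> \<and> m \<in> \<sigma> \<and> x \<in> \<sigma>)"
proof
  assume "x \<in> St \<Delta> m"
  then obtain F where F: "F face_of \<Delta>" "F \<noteq> \<Delta>" "m \<in> F" "x \<in> F" by (auto simp: St_def)
  have "F \<noteq> {}" using F(3) by blast
  then obtain \<sigma> where "\<sigma> facet_of \<Delta>" "F \<subseteq> \<sigma>"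
    using face_of_polyhedron_subset_facet[OF polytope_imp_polyhedron[OF polytope_Delta] F(1) _ F(2)] by metis
  with F(3,4) show "\<exists>\<sigma>. \<sigma> facet_of \<Delta> \<and> m \<in> \<sigma> \<and> x \<in> \<sigma>" by blast
next
  assume "\<exists>\<sigma>. \<sigma> facet_of \<Delta> \<and> m \<in> \<sigma> \<and> x \<in> \<sigma>"
  then obtain \<sigma> where \<sigma>: "\<sigma> facet_of \<Delta>" "m \<in> \<sigma>" "x \<in> \<sigma>" by blast
  moreover have "\<sigma> \<noteq> \<Delta>" using \<sigma>(1) facet_of_irrefl by blast
  ultimately show "x \<in> St \<Delta> m" unfolding St_def using facet_of_imp_face_of by blast
qed

lemma St_subset_A: "St \<Delta> m \<subseteq> A"
  using St_iff facet_subset_A by blast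

lemma closed_St: "closed (St \<Delta> m)"
proof -
  have "St \<Delta> m = \<Union> {\<sigma>. \<sigma> facet_of \<Delta> \<and> m \<in> \<sigma>}" using St_iff by blast
  moreover have "finite {\<sigma>. \<sigma> facet_of \<Delta> \<and> m \<in> \<sigma>}" using finite_facets_Delta by simp
  moreover have "closed \<sigma>" if "\<sigma> facet_of \<Delta>" for \<sigma>
    using that face_of_imp_closed[OF convex_Delta closed_Delta] facet_of_imp_face_of by blast
  ultimately show ?thesis by (simp add: closed_Union)
qed

text \<open>t is the least slack among the facets through u, whose pairings grow at unit speed along
  u. The other facets cannot be crossed earlier, since their normals pair with u to at most
  0.\<close>

lemma ray_exits_in_St:
  assumes "u \<in> L" "u \<noteq> 0" "x \<in> \<Delta>"
  obtains t where "t \<ge> 0" "x + t *\<^sub>R u \<in> St \<Delta> u"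
proof -
  let ?S = "{\<sigma>. \<sigma> facet_of \<Delta> \<and> u \<in> \<sigma>}"
  have fin: "finite ?S" using finite_facets_Delta by simp
  obtain \<sigma>0 where "\<sigma>0 facet_of \<Delta>" "u \<in> \<sigma>0" using L_subset_A[OF assms(1,2)] by (rule in_A_obtain_facet)
  then have ne: "?S \<noteq> {}" by blast
  define t where "t = Min ((\<lambda>\<sigma>. 1 - x \<bullet> N \<sigma>) ` ?S)"
  have "t \<in> (\<lambda>\<sigma>. 1 - x \<bullet> N \<sigma>) ` ?S" unfolding t_def by (rule Min_in) (use fin ne in auto)
  then obtain \<sigma> where \<sigma>: "\<sigma> facet_of \<Delta>" "u \<in> \<sigma>" "t = 1 - x \<bullet> N \<sigma>" by blast
  have t0: "t \<ge> 0" using \<sigma> facet_Delta(3)[OF \<sigma>(1) assms(3)] by simp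
  have uN: "u \<bullet> N \<sigma>' = 1" if "\<sigma>' facet_of \<Delta>" "u \<in> \<sigma>'" for \<sigma>' using facet_inner that by blast
  have "(x + t *\<^sub>R u) \<bullet> N \<sigma>' \<le> 1" if s: "\<sigma>' facet_of \<Delta>" for \<sigma>'
  proof (cases "u \<in> \<sigma>'")
    case True
    then have "t \<le> 1 - x \<bullet> N \<sigma>'" unfolding t_def using fin s by (intro Min_le) auto
    then show ?thesis using uN[OF s True] by (simp add: inner_add_left)
  next
    case False
    then have "t * (u \<bullet> N \<sigma>') \<le> 0" using lattice_inner_normal[OF assms(1) s] t0 by (simp add: mult_nonneg_nonpos)
    then show ?thesis using facet_Delta(3)[OF s assms(3)] by (simp add: inner_add_left)
  qed
  then have "x + t *\<^sub>R u \<in> \<Delta>" using Delta_facet_ineqs by blast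
  moreover have "(x + t *\<^sub>R u) \<bullet> N \<sigma> = 1" using uN[OF \<sigma>(1,2)] \<sigma>(3) by (simp add: inner_add_left)
  ultimately have "x + t *\<^sub>R u \<in> \<sigma>" using facetI[OF \<sigma>(1)] by blast
  then have "x + t *\<^sub>R u \<in> St \<Delta> u" using \<sigma>(1,2) unfolding St_iff by blast
  then show thesis using that t0 by blast
qed

text \<open>On a facet through u the pairing with the normal is already maximal, so a step forward
  along u leaves \<Delta>; the argument applies from either of the two points.\<close>

lemma St_line_unique:
  assumes "x \<in> St \<Delta> u" "x + s *\<^sub>R u \<in> St \<Delta> u"
  shows "s = 0"
proof -
  have *: "r \<le> 0" if y: "y \<in> St \<Delta> u" "y + r *\<^sub>R u \<in> \<Delta>" for y r
  proof -
    obtain \<sigma> where \<sigma>: "\<sigma> facet_of \<Delta>" "u \<in> \<sigma>" "y \<in> \<sigma>" using y(1) unfolding St_iff by blast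
    have "u \<bullet> N \<sigma> = 1" "y \<bullet> N \<sigma> = 1" by (rule facet_inner[OF \<sigma>(1) \<sigma>(2)], rule facet_inner[OF \<sigma>(1) \<sigma>(3)])
    then show ?thesis using facet_Delta(3)[OF \<sigma>(1) y(2)] by (simp add: inner_add_left)
  qed
  have St: "St \<Delta> u \<subseteq> \<Delta>" using St_subset_A A_subset_Delta by (rule order_trans)
  have "s \<le> 0" by (rule *[OF assms(1) subsetD[OF St assms(2)]])
  moreover have "- s \<le> 0" by (rule *[OF assms(2)]) (use subsetD[OF St assms(1)] in simp)
  ultimately show ?thesis by simp
qed

end

section \<open>Facet charts\<close>

text \<open>The adjoint of \<open>beta v\<close>, see \<open>inner_basis_map\<close>.\<close>

definition basis_map :: "('d::finite \<Rightarrow> real ^ 'n) \<Rightarrow> real ^ 'd \<Rightarrow> real ^ 'n" where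
  "basis_map v p = (\<Sum>i\<in>UNIV. (p $ i) *\<^sub>R v i)"

lemma linear_basis_map: "linear (basis_map v)"
  by (rule linearI) (simp_all add: basis_map_def scaleR_add_left sum.distrib scaleR_sum_right)

lemma basis_map_axis: "basis_map v (axis i 1) = v i"
  by (simp add: basis_map_def axis_def if_distrib[of "\<lambda>c. c *\<^sub>R _"] cong: if_cong)

lemma inner_basis_map: "basis_map v p \<bullet> n = p \<bullet> beta v n"
  by (simp add: basis_map_def beta_def inner_sum_left) (simp add: inner_vec_def)

lemma basis_map_image_int_lattice:
  assumes "lattice_basis v L"
  shows "basis_map v ` int_lattice = L"
proof -
  have "L = (\<lambda>c :: 'a \<Rightarrow> int. \<Sum>i\<in>UNIV. real_of_int (c i) *\<^sub>R v i) ` UNIV"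
    using assms by (simp add: lattice_basis_def bij_betw_def)
  also have "\<dots> = basis_map v ` int_lattice"
  proof (intro equalityI image_subsetI)
    fix c :: "'a \<Rightarrow> int"
    show "(\<Sum>i\<in>UNIV. real_of_int (c i) *\<^sub>R v i) \<in> basis_map v ` int_lattice"
      by (rule image_eqI[of _ _ "\<chi> i. of_int (c i)"]) (auto simp: basis_map_def int_lattice_def)
  next
    fix p :: "real ^ 'a" assume "p \<in> int_lattice"
    then have "p $ i = of_int \<lfloor>p $ i\<rfloor>" for i by (simp add: int_lattice_def)
    then have "basis_map v p = (\<Sum>i\<in>UNIV. real_of_int \<lfloor>p $ i\<rfloor> *\<^sub>R v i)" unfolding basis_map_def by metis
    then show "basis_map v p \<in> range (\<lambda>c :: 'a \<Rightarrow> int. \<Sum>i\<in>UNIV. real_of_int (c i) *\<^sub>R v i)" by auto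
  qed
  finally show ?thesis by simp
qed

lemma emeasure_lborel_translation:
  fixes S :: "'a::euclidean_space set"
  assumes "S \<in> sets borel"
  shows "(+) a ` S \<in> sets borel" "emeasure lborel ((+) a ` S) = emeasure lborel S"
proof -
  have "(+) a ` S = (+) (- a) -` S" by (auto intro!: image_eqI[of _ _ "x - a" for x])
  moreover have m: "(+) (- a) \<in> borel_measurable borel" by measurable
  ultimately show "(+) a ` S \<in> sets borel" using measurable_sets[OF m assms] by simp
  have "emeasure lborel S = emeasure (distr lborel borel ((+) (- a))) S" by (simp add: lborel_distr_plus)
  also have "\<dots> = emeasure lborel ((+) a ` S)"
    using \<open>(+) a ` S = (+) (- a) -` S\<close> assms by (subst emeasure_distr) auto
  finally show "emeasure lborel ((+) a ` S) = emeasure lborel S" by simp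
qed

context tropical_reflexive
begin

abbreviation "\<mu> \<equiv> mu_M \<Delta> b"
abbreviation "J \<sigma> \<equiv> basis_map (b \<sigma>)"
abbreviation "base \<sigma> \<equiv> (SOME p. p \<in> \<sigma>)"

text \<open>Projection along \<open>u\<close> to \<open>n_\<sigma>\<^sup>\<perp>\<close>, in the coordinates of the basis \<open>b \<sigma>\<close>.\<close>

definition crd :: "(real ^ 'n) set \<Rightarrow> real ^ 'n \<Rightarrow> real ^ 'n \<Rightarrow> real ^ 'd" where
  "crd \<sigma> u x = inv (J \<sigma>) (x - (x \<bullet> N \<sigma>) *\<^sub>R u)"

lemma base_in: "\<sigma> facet_of \<Delta> \<Longrightarrow> base \<sigma> \<in> \<sigma>"
  by (rule someI_ex) (auto simp: facet_of_def)

lemma J_int_lattice: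
  assumes "\<sigma> facet_of \<Delta>"
  shows "J \<sigma> ` int_lattice = {m \<in> int_lattice. m \<bullet> N \<sigma> = 0}"
  using bases assms by (intro basis_map_image_int_lattice) (simp add: facet_bases_def)

lemma b_inner_normal: "\<sigma> facet_of \<Delta> \<Longrightarrow> b \<sigma> i \<bullet> N \<sigma> = 0"
  using J_int_lattice[of \<sigma>] basis_map_axis[of "b \<sigma>" i] int_lattice_axis[of i] by force

lemma J_inner_normal: "\<sigma> facet_of \<Delta> \<Longrightarrow> J \<sigma> p \<bullet> N \<sigma> = 0"
  by (simp add: basis_map_def inner_sum_left b_inner_normal)

lemma normal_nonzero: "\<sigma> facet_of \<Delta> \<Longrightarrow> N \<sigma> \<noteq> 0"
  using facet_Delta(4)[of \<sigma>] facet_inner[of \<sigma>] by fastforce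

text \<open>Subtracting a multiple of a lattice point u of the facet turns each standard basis
  vector into a lattice vector orthogonal to the normal, hence into a point of the range. A vector x
  orthogonal to the normal is the combination of these with its own coordinates, because the
  multiples of u cancel.\<close>

lemma range_J:
  assumes \<sigma>: "\<sigma> facet_of \<Delta>"
  shows "range (J \<sigma>) = {x. x \<bullet> N \<sigma> = 0}"
proof (intro equalityI subsetI)
  fix x assume "x \<in> {x. x \<bullet> N \<sigma> = 0}"
  then have x: "x \<bullet> N \<sigma> = 0" by simp
  obtain u where u: "u \<in> int_lattice" "u \<bullet> N \<sigma> = 1" using facet_Delta(4)[OF \<sigma>] facet_inner[OF \<sigma>] by blast
  have sub: "subspace (range (J \<sigma>))"
    by (rule linear_subspace_image[OF linear_basis_map subspace_UNIV])
  have "axis j 1 - (N \<sigma> $ j) *\<^sub>R u \<in> range (J \<sigma>)" for j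
  proof -
    have "axis j 1 \<bullet> N \<sigma> = N \<sigma> $ j" by (simp add: inner_axis')
    moreover have "N \<sigma> $ j \<in> \<int>" using facet_Delta(1)[OF \<sigma>] by (simp add: int_lattice_def)
    ultimately have "axis j 1 - (N \<sigma> $ j) *\<^sub>R u \<in> {m \<in> int_lattice. m \<bullet> N \<sigma> = 0}"
      using u by (auto simp: inner_diff_left intro!: int_lattice_diff int_lattice_scaleR int_lattice_axis)
    then show ?thesis using J_int_lattice[OF \<sigma>] by auto
  qed
  then have "(\<Sum>j\<in>UNIV. (x $ j) *\<^sub>R (axis j 1 - (N \<sigma> $ j) *\<^sub>R u)) \<in> range (J \<sigma>)"
    by (intro subspace_sum[OF sub] subspace_scale[OF sub])
  moreover have "(\<Sum>j\<in>UNIV. (x $ j) *\<^sub>R (axis j 1 - (N \<sigma> $ j) *\<^sub>R u)) = x"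
  proof -
    have "(\<Sum>j\<in>UNIV. (x $ j) *\<^sub>R axis j 1) = x"
      using basis_expansion[of x] by (simp add: scalar_mult_eq_scaleR)
    moreover have "(\<Sum>j\<in>UNIV. x $ j * N \<sigma> $ j) = 0" using x by (simp add: inner_vec_def)
    ultimately show ?thesis
      by (simp add: scaleR_diff_right sum_subtractf scaleR_sum_left[symmetric])
  qed
  ultimately show "x \<in> range (J \<sigma>)" by simp
qed (auto simp: J_inner_normal[OF \<sigma>])

text \<open>Being a \<int>-basis gives injectivity only on integer coefficients. Over the reals, the
  vectors \<open>b \<sigma> i\<close> span a hyperplane whose dimension equals the size of the index
  type, so they are independent.\<close>

lemma inj_J:
  assumes \<sigma>: "\<sigma> facet_of \<Delta>"
  shows "inj (J \<sigma>)"
proof -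
  let ?H = "{x. x \<bullet> N \<sigma> = 0}"
  have bH: "range (b \<sigma>) \<subseteq> ?H" using b_inner_normal[OF \<sigma>] by auto
  have "J \<sigma> p \<in> span (range (b \<sigma>))" for p
    unfolding basis_map_def by (intro span_sum span_scale span_base) auto
  then have Hs: "?H \<subseteq> span (range (b \<sigma>))" unfolding range_J[OF \<sigma>, symmetric] by blast
  have dim: "dim ?H = CARD('d)"
    using dim_hyperplane[OF normal_nonzero[OF \<sigma>]] card by (simp add: inner_commute)
  have "CARD('d) \<le> card (range (b \<sigma>))" using dim_le_card[OF Hs] dim by simp
  then have cardb: "card (range (b \<sigma>)) = CARD('d)" by (simp add: antisym card_image_le)
  then have injb: "inj (b \<sigma>)" by (simp add: eq_card_imp_inj_on)
  have ind: "independent (range (b \<sigma>))"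
    by (rule card_le_dim_spanning[OF bH Hs]) (simp_all add: dim cardb)
  show ?thesis
  proof (subst linear_injective_0[OF linear_basis_map], intro allI impI)
    fix p assume "J \<sigma> p = 0"
    then have "(\<Sum>x\<in>range (b \<sigma>). (p $ inv (b \<sigma>) x) *\<^sub>R x) = 0"
      using injb by (subst sum.reindex) (auto simp: basis_map_def inv_f_f)
    then have "p $ inv (b \<sigma>) (b \<sigma> i) = 0" for i
      using independentD[OF ind finite_imageI[OF finite] order_refl, of "\<lambda>x. p $ inv (b \<sigma>) x" "b \<sigma> i"] by simp
    then show "p = 0" using injb by (simp add: vec_eq_iff inv_f_f)
  qed
qed

context
  fixes \<sigma> u assumes \<sigma>: "\<sigma> facet_of \<Delta>" and u: "u \<bullet> N \<sigma> = 1"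
begin

lemma J_crd: "J \<sigma> (crd \<sigma> u x) = x - (x \<bullet> N \<sigma>) *\<^sub>R u"
proof -
  have "x - (x \<bullet> N \<sigma>) *\<^sub>R u \<in> range (J \<sigma>)" using range_J[OF \<sigma>] u by (simp add: inner_diff_left)
  then show ?thesis by (simp add: crd_def f_inv_into_f)
qed

lemma crd_eqI: "x = J \<sigma> p + s *\<^sub>R u \<Longrightarrow> crd \<sigma> u x = p"
  using u J_inner_normal[OF \<sigma>] inj_J[OF \<sigma>] by (simp add: crd_def inner_add_left)

lemma linear_crd: "linear (crd \<sigma> u)"
proof (rule linearI)
  fix x y show "crd \<sigma> u (x + y) = crd \<sigma> u x + crd \<sigma> u y"
    by (rule crd_eqI[of _ _ "(x + y) \<bullet> N \<sigma>"])
      (simp add: linear_add[OF linear_basis_map] J_crd inner_add_left scaleR_add_left)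
next
  fix c x show "crd \<sigma> u (c *\<^sub>R x) = c *\<^sub>R crd \<sigma> u x"
    by (rule crd_eqI[of _ _ "(c *\<^sub>R x) \<bullet> N \<sigma>"])
      (simp add: linear_scale[OF linear_basis_map] J_crd scaleR_diff_right)
qed

lemma crd_J: "crd \<sigma> u (J \<sigma> p) = p"
  by (rule crd_eqI[of _ _ 0]) simp

lemma crd_eq_iff: "crd \<sigma> u x = crd \<sigma> u y \<longleftrightarrow> (\<exists>s. x = y + s *\<^sub>R u)"
proof
  assume "crd \<sigma> u x = crd \<sigma> u y"
  then have "x - (x \<bullet> N \<sigma>) *\<^sub>R u = y - (y \<bullet> N \<sigma>) *\<^sub>R u" using J_crd[of x] J_crd[of y] by simp
  then have "x = y + ((x \<bullet> N \<sigma>) - (y \<bullet> N \<sigma>)) *\<^sub>R u" by (simp add: algebra_simps)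
  then show "\<exists>s. x = y + s *\<^sub>R u" by blast
next
  assume "\<exists>s. x = y + s *\<^sub>R u"
  then obtain s where s: "x = y + s *\<^sub>R u" by blast
  show "crd \<sigma> u x = crd \<sigma> u y"
    by (rule crd_eqI[of _ _ "y \<bullet> N \<sigma> + s"]) (simp add: J_crd s scaleR_add_left)
qed

lemma crd_int_lattice: "u \<in> int_lattice \<Longrightarrow> x \<in> int_lattice \<Longrightarrow> crd \<sigma> u x \<in> int_lattice"
proof -
  assume *: "u \<in> int_lattice" "x \<in> int_lattice"
  have "x - (x \<bullet> N \<sigma>) *\<^sub>R u \<in> {m \<in> int_lattice. m \<bullet> N \<sigma> = 0}"
    using * u facet_Delta(1)[OF \<sigma>]
    by (auto simp: inner_diff_left intro!: int_lattice_diff int_lattice_scaleR int_lattice_inner)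
  then obtain p where "p \<in> int_lattice" "x - (x \<bullet> N \<sigma>) *\<^sub>R u = J \<sigma> p" using J_int_lattice[OF \<sigma>] by blast
  then show ?thesis using crd_J unfolding J_crd[symmetric] by (metis inj_J[OF \<sigma>] injD)
qed

end

section \<open>The measure \<mu> in facet charts\<close>

lemma facet_lebesgue_eq:
  assumes "X \<in> sets borel"
  shows "emeasure (facet_lebesgue (b \<sigma>) \<sigma>) X = emeasure lborel ((\<lambda>x. base \<sigma> + J \<sigma> x) -` X)"
proof -
  have "(\<lambda>x. base \<sigma> + J \<sigma> x) \<in> borel_measurable borel"
    by (intro borel_measurable_continuous_onI continuous_intros linear_continuous_on)
      (simp add: linear_conv_bounded_linear[symmetric] linear_basis_map)
  then show ?thesis using assms unfolding facet_lebesgue_def basis_map_def by (subst emeasure_distr) auto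
qed

lemma emeasure_mu:
  assumes "X \<in> sets borel"
  shows "emeasure \<mu> X = (\<Sum>\<sigma> | \<sigma> facet_of \<Delta>. emeasure lborel ((\<lambda>x. base \<sigma> + J \<sigma> x) -` (X \<inter> rel_interior \<sigma>)))"
  unfolding emeasure_mu_M[OF assms]
  by (intro sum.cong refl facet_lebesgue_eq sets.Int assms borel_rel_interior)

lemma borel_facet_chart:
  assumes "X \<in> sets borel"
  shows "(\<lambda>x. base \<sigma> + J \<sigma> x) -` X \<in> sets borel"
proof -
  have m: "(\<lambda>x. base \<sigma> + J \<sigma> x) \<in> borel_measurable borel"
    by (intro borel_measurable_continuous_onI continuous_intros linear_continuous_on)
      (simp add: linear_conv_bounded_linear[symmetric] linear_basis_map)
  show ?thesis using measurable_sets[OF m assms] by simp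
qed

lemma bounded_facet_chart:
  assumes "\<sigma> facet_of \<Delta>" "bounded X"
  shows "bounded ((\<lambda>x. base \<sigma> + J \<sigma> x) -` X)"
proof -
  obtain u where u: "u \<in> \<sigma>" using facet_Delta(4)[OF assms(1)] by blast
  note uN = facet_inner[OF assms(1) u]
  \<comment> \<open>The linear map \<open>crd\<close> inverts the chart up to a translation, so
    preimages of bounded sets stay bounded.\<close>
  have "x = crd \<sigma> u (base \<sigma> + J \<sigma> x - base \<sigma>)" for x using crd_J[OF assms(1) uN] by simp
  then have "(\<lambda>x. base \<sigma> + J \<sigma> x) -` X \<subseteq> crd \<sigma> u ` ((\<lambda>m. m - base \<sigma>) ` X)" by (fastforce simp: image_iff)
  moreover have "bounded (crd \<sigma> u ` ((\<lambda>m. m - base \<sigma>) ` X))"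
    using assms(2) linear_crd[OF assms(1) uN]
    by (intro bounded_linear_image bounded_translation_minus) (auto simp: linear_conv_bounded_linear)
  ultimately show ?thesis by (rule bounded_subset[rotated])
qed

lemma facet_chart_surj:
  assumes "\<sigma> facet_of \<Delta>" "m \<in> \<sigma>"
  obtains x where "m = base \<sigma> + J \<sigma> x"
proof -
  have "(m - base \<sigma>) \<bullet> N \<sigma> = 0"
    using facet_inner[OF assms] facet_inner[OF assms(1) base_in[OF assms(1)]] by (simp add: inner_diff_left)
  then obtain x where "m - base \<sigma> = J \<sigma> x" using range_J[OF assms(1)] by blast
  then show thesis using that[of x] by (simp add: algebra_simps)
qed

lemma finite_measure_mu: "finite_measure \<mu>"
proof
  have "emeasure lborel ((\<lambda>x. base \<sigma> + J \<sigma> x) -` (UNIV \<inter> rel_interior \<sigma>)) < \<infinity>" if "\<sigma> facet_of \<Delta>" for \<sigma>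
  proof -
    have "bounded (rel_interior \<sigma>)"
      using compact_imp_bounded[OF compact_Delta] facet_of_imp_subset[OF that] rel_interior_subset bounded_subset by blast
    then have "bounded ((\<lambda>x. base \<sigma> + J \<sigma> x) -` (UNIV \<inter> rel_interior \<sigma>))"
      using bounded_facet_chart[OF that] by simp
    then show ?thesis by (rule emeasure_bounded_finite)
  qed
  then show "emeasure \<mu> (space \<mu>) \<noteq> \<infinity>" by (subst emeasure_mu) (auto simp: less_top finite_facets_Delta)
qed

lemma emeasure_mu_outside: "emeasure \<mu> (- A) = 0"
proof -
  have "(- A) \<inter> rel_interior \<sigma> = {}" if "\<sigma> facet_of \<Delta>" for \<sigma>
    using facet_subset_A[OF that] rel_interior_subset by blast
  then show ?thesis using frontier_closed by (subst emeasure_mu) auto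
qed

text \<open>In the chart of \<sigma>, translation along \<open>b \<sigma> i\<close> is translation
  along a coordinate axis, so \<open>negligible_if_translates_disjoint\<close> applies; the
  interiors of the other facets do not meet Z.\<close>

lemma mu_null_if_translates_disjoint:
  assumes \<sigma>: "\<sigma> facet_of \<Delta>" and Z: "closed Z" "Z \<subseteq> \<sigma>"
    and disj: "\<And>m t. m \<in> Z \<Longrightarrow> t > 0 \<Longrightarrow> m + t *\<^sub>R b \<sigma> i \<notin> Z"
  shows "emeasure \<mu> Z = 0"
proof -
  let ?c = "\<lambda>\<sigma> x. base \<sigma> + J \<sigma> x"
  have "emeasure lborel (?c \<sigma>' -` (Z \<inter> rel_interior \<sigma>')) = 0" if \<sigma>': "\<sigma>' facet_of \<Delta>" for \<sigma>'
  proof (cases "\<sigma>' = \<sigma>")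
    case True
    have "closed (?c \<sigma> -` Z)"
      by (intro continuous_closed_vimage Z continuous_intros linear_continuous_at)
        (simp add: linear_conv_bounded_linear[symmetric] linear_basis_map)
    then have "negligible (?c \<sigma> -` Z)"
    proof (rule negligible_if_translates_disjoint[where e = "axis i 1"])
      fix t :: real and y assume "t > 0" "y \<in> ?c \<sigma> -` Z"
      then show "y + t *\<^sub>R axis i 1 \<notin> ?c \<sigma> -` Z"
        using disj[of "?c \<sigma> y" t]
        by (simp add: linear_add[OF linear_basis_map] linear_scale[OF linear_basis_map] basis_map_axis add.assoc)
    qed
    then have "negligible (?c \<sigma> -` (Z \<inter> rel_interior \<sigma>))" by (rule negligible_subset) auto
    moreover have "?c \<sigma> -` (Z \<inter> rel_interior \<sigma>) \<in> sets borel"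
      by (intro borel_facet_chart sets.Int borel_closed Z(1) borel_rel_interior)
    ultimately show ?thesis using True by (simp add: negligible_iff_emeasure0)
  next
    case False
    have "Z \<inter> rel_interior \<sigma>' = {}"
      using facet_of_unique[OF \<sigma>' \<sigma> _ _ convex_Delta] Z(2) False by blast
    then show ?thesis by simp
  qed
  then show ?thesis using Z(1) by (subst emeasure_mu) auto
qed

text \<open>In the chart of \<sigma>' the relative boundary lies in the frontier of a convex set in
  \<open>real ^ 'd\<close>, which is null, and the passage to the coordinates
  \<open>crd \<sigma> u\<close> is an affine map between spaces of equal dimension.\<close>

lemma negligible_crd_rel_boundary:
  assumes \<sigma>: "\<sigma> facet_of \<Delta>" "u \<in> \<sigma>" and \<sigma>': "\<sigma>' facet_of \<Delta>"
  shows "negligible (crd \<sigma> u ` (\<sigma>' - rel_interior \<sigma>'))"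
proof -
  note lin = linear_crd[OF \<sigma>(1) facet_inner[OF \<sigma>]]
  let ?Q = "J \<sigma>' -` ((+) (- base \<sigma>') ` \<sigma>')"
  have conv: "convex \<sigma>'" using \<sigma>' convex_Delta face_of_imp_convex facet_of_imp_face_of by blast
  have "convex ?Q"
    by (intro convex_linear_vimage linear_basis_map convex_translation conv)
  then have negQ: "negligible (frontier ?Q)" by (rule negligible_convex_frontier)
  have im: "\<sigma>' = (+) (base \<sigma>') ` J \<sigma>' ` ?Q"
  proof (intro equalityI subsetI)
    fix m assume m: "m \<in> \<sigma>'"
    obtain x where x: "m = base \<sigma>' + J \<sigma>' x" by (rule facet_chart_surj[OF \<sigma>' m])
    then have "x \<in> ?Q" using m by (auto intro!: image_eqI[of _ _ m])
    then show "m \<in> (+) (base \<sigma>') ` J \<sigma>' ` ?Q" using x by blast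
  qed (auto simp: algebra_simps)
  have "rel_interior (J \<sigma>' ` ?Q) = J \<sigma>' ` rel_interior ?Q"
    using linear_basis_map inj_J[OF \<sigma>']
    by (intro rel_interior_injective_linear_image) (simp_all add: linear_conv_bounded_linear)
  then have "rel_interior ((+) (base \<sigma>') ` J \<sigma>' ` ?Q) = (+) (base \<sigma>') ` J \<sigma>' ` rel_interior ?Q"
    unfolding rel_interior_translation by (rule arg_cong)
  then have "rel_interior \<sigma>' = (+) (base \<sigma>') ` J \<sigma>' ` rel_interior ?Q"
    unfolding im[symmetric] .
  then have "(+) (base \<sigma>') ` J \<sigma>' ` interior ?Q \<subseteq> rel_interior \<sigma>'"
    using interior_subset_rel_interior[of ?Q] by blast
  then have "\<sigma>' - rel_interior \<sigma>' \<subseteq> (+) (base \<sigma>') ` J \<sigma>' ` ?Q - (+) (base \<sigma>') ` J \<sigma>' ` interior ?Q"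
    unfolding im[symmetric] by (rule Diff_mono[OF order_refl])
  also have "\<dots> \<subseteq> (+) (base \<sigma>') ` J \<sigma>' ` (?Q - interior ?Q)" by blast
  also have "?Q - interior ?Q \<subseteq> frontier ?Q"
    unfolding frontier_def by (rule Diff_mono[OF closure_subset order_refl])
  finally have "crd \<sigma> u ` (\<sigma>' - rel_interior \<sigma>') \<subseteq> (\<lambda>x. crd \<sigma> u (base \<sigma>' + J \<sigma>' x)) ` frontier ?Q"
    by blast
  moreover have "(\<lambda>x. crd \<sigma> u (base \<sigma>' + J \<sigma>' x)) differentiable_on frontier ?Q"
  proof -
    have "linear (\<lambda>x. crd \<sigma> u (J \<sigma>' x))" using linear_compose[OF linear_basis_map lin] by (simp add: o_def)
    then have "(\<lambda>x. crd \<sigma> u (base \<sigma>') + crd \<sigma> u (J \<sigma>' x)) differentiable_on frontier ?Q"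
      by (intro derivative_intros) (simp_all add: linear_imp_differentiable_on)
    then show ?thesis by (simp add: linear_add[OF lin])
  qed
  then have "negligible ((\<lambda>x. crd \<sigma> u (base \<sigma>' + J \<sigma>' x)) ` frontier ?Q)"
    by (intro negligible_differentiable_image_negligible negQ) auto
  ultimately show ?thesis by (rule negligible_subset[rotated])
qed

lemma inj_on_crd_St:
  assumes \<sigma>: "\<sigma> facet_of \<Delta>" "u \<in> \<sigma>"
  shows "inj_on (crd \<sigma> u) (St \<Delta> u)"
proof (rule inj_onI)
  fix x y assume xy: "x \<in> St \<Delta> u" "y \<in> St \<Delta> u" "crd \<sigma> u x = crd \<sigma> u y"
  then obtain s where "x = y + s *\<^sub>R u" using crd_eq_iff[OF \<sigma>(1) facet_inner[OF \<sigma>]] by blast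
  then show "x = y" using St_line_unique[OF xy(2), of s] xy(1) by simp
qed

text \<open>
  The lattices \<open>M \<inter> n_\<sigma>\<^sup>\<perp>\<close> and \<open>M \<inter> n_\<sigma>'\<^sup>\<perp>\<close> both project isomorphically to
  \<open>M / \<int>u\<close>, so the change of coordinates is unimodular.
\<close>

lemma emeasure_crd_facet_piece:
  assumes \<sigma>: "\<sigma> facet_of \<Delta>" "u \<in> \<sigma>" and \<sigma>': "\<sigma>' facet_of \<Delta>" "u \<in> \<sigma>'" and u: "u \<in> int_lattice"
    and X: "X \<in> sets borel" "X \<subseteq> \<sigma>'"
  shows "crd \<sigma> u ` X \<in> sets borel"
    "emeasure lborel (crd \<sigma> u ` X) = emeasure lborel ((\<lambda>x. base \<sigma>' + J \<sigma>' x) -` X)"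
proof -
  note uN = facet_inner[OF \<sigma>] and uN' = facet_inner[OF \<sigma>']
  note lin = linear_crd[OF \<sigma>(1) uN] and lin' = linear_crd[OF \<sigma>'(1) uN']
  define g where "g = (\<lambda>x. crd \<sigma> u (J \<sigma>' x))"
  define g' where "g' = (\<lambda>x. crd \<sigma>' u (J \<sigma> x))"
  let ?Y = "(\<lambda>x. base \<sigma>' + J \<sigma>' x) -` X"
  have ling: "linear g" "linear g'"
    unfolding g_def g'_def using linear_compose[OF linear_basis_map lin] linear_compose[OF linear_basis_map lin']
    by (simp_all add: o_def)
  have g'g: "g' (g p) = p" for p
  proof -
    have "crd \<sigma>' u (J \<sigma>' p - (J \<sigma>' p \<bullet> N \<sigma>) *\<^sub>R u) = crd \<sigma>' u (J \<sigma>' p)"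
      by (subst crd_eq_iff[OF \<sigma>'(1) uN']) (rule exI[of _ "- (J \<sigma>' p \<bullet> N \<sigma>)"], simp)
    then show ?thesis unfolding g_def g'_def using J_crd[OF \<sigma>(1) uN] crd_J[OF \<sigma>'(1) uN'] by simp
  qed
  have gg': "g (g' p) = p" for p
  proof -
    have "crd \<sigma> u (J \<sigma> p - (J \<sigma> p \<bullet> N \<sigma>') *\<^sub>R u) = crd \<sigma> u (J \<sigma> p)"
      by (subst crd_eq_iff[OF \<sigma>(1) uN]) (rule exI[of _ "- (J \<sigma> p \<bullet> N \<sigma>')"], simp)
    then show ?thesis unfolding g_def g'_def using J_crd[OF \<sigma>'(1) uN'] crd_J[OF \<sigma>(1) uN] by simp
  qed
  have Jint: "J \<sigma>'' p \<in> int_lattice" if "\<sigma>'' facet_of \<Delta>" "p \<in> int_lattice" for \<sigma>'' p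
    using J_int_lattice[OF that(1)] that(2) by blast
  have gint: "g ` int_lattice \<subseteq> int_lattice" "g' ` int_lattice \<subseteq> int_lattice"
    unfolding g_def g'_def using crd_int_lattice[OF \<sigma>(1) uN u] crd_int_lattice[OF \<sigma>'(1) uN' u] Jint \<sigma> \<sigma>' by auto
  have "bounded X"
    using X(2) compact_imp_bounded[OF compact_Delta] facet_of_imp_subset[OF \<sigma>'(1)] bounded_subset by blast
  then have Y: "?Y \<in> sets borel" "bounded ?Y"
    using borel_facet_chart[OF X(1)] bounded_facet_chart[OF \<sigma>'(1)] by auto
  have "X = (\<lambda>x. base \<sigma>' + J \<sigma>' x) ` ?Y"
  proof (intro equalityI subsetI)
    fix m assume m: "m \<in> X"
    obtain x where "m = base \<sigma>' + J \<sigma>' x" by (rule facet_chart_surj[OF \<sigma>'(1) subsetD[OF X(2) m]])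
    then show "m \<in> (\<lambda>x. base \<sigma>' + J \<sigma>' x) ` ?Y" using m by blast
  qed blast
  then have "crd \<sigma> u ` X = crd \<sigma> u ` ((\<lambda>x. base \<sigma>' + J \<sigma>' x) ` ?Y)" by (rule arg_cong)
  also have "\<dots> = (\<lambda>x. crd \<sigma> u (base \<sigma>' + J \<sigma>' x)) ` ?Y" by (rule image_image)
  also have "\<dots> = (+) (crd \<sigma> u (base \<sigma>')) ` g ` ?Y"
    unfolding image_image g_def by (simp only: linear_add[OF lin])
  finally have eq: "crd \<sigma> u ` X = (+) (crd \<sigma> u (base \<sigma>')) ` g ` ?Y" .
  note gY = emeasure_lattice_automorphism_image[OF ling g'g gg' gint Y]
  show "crd \<sigma> u ` X \<in> sets borel" "emeasure lborel (crd \<sigma> u ` X) = emeasure lborel ?Y"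
    unfolding eq using emeasure_lborel_translation[OF gY(1)] gY(2) by auto
qed

text \<open>X is cut along the relative interiors of the facets through u. Each piece keeps its
  measure, and injectivity on the star keeps the images disjoint. The image of the remainder is
  known only to be negligible, hence \<open>lebesgue\<close> in place of
  \<open>borel\<close>.\<close>

lemma emeasure_crd_image:
  assumes \<sigma>: "\<sigma> facet_of \<Delta>" "u \<in> \<sigma>" and u: "u \<in> int_lattice" and X: "X \<in> sets borel" "X \<subseteq> St \<Delta> u"
  shows "crd \<sigma> u ` X \<in> sets lebesgue" "emeasure lebesgue (crd \<sigma> u ` X) = emeasure \<mu> X"
proof -
  let ?F = "{\<sigma>'. \<sigma>' facet_of \<Delta> \<and> u \<in> \<sigma>'}"
  let ?X = "\<lambda>\<sigma>'. X \<inter> rel_interior \<sigma>'"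
  have fin: "finite ?F" using finite_facets_Delta by simp
  have XX: "?X \<sigma>' \<in> sets borel" "?X \<sigma>' \<subseteq> \<sigma>'" for \<sigma>'
    by (rule sets.Int[OF X(1) borel_rel_interior], rule le_infI2[OF rel_interior_subset])
  note piece = emeasure_crd_facet_piece[OF \<sigma> _ _ u XX]
  let ?R = "crd \<sigma> u ` (X - (\<Union>\<sigma>'\<in>?F. ?X \<sigma>'))"
  let ?U = "\<Union>\<sigma>'\<in>?F. crd \<sigma> u ` ?X \<sigma>'"
  have "X - (\<Union>\<sigma>'\<in>?F. ?X \<sigma>') \<subseteq> (\<Union>\<sigma>'\<in>?F. \<sigma>' - rel_interior \<sigma>')"
  proof
    fix x assume x: "x \<in> X - (\<Union>\<sigma>'\<in>?F. ?X \<sigma>')"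
    then have "x \<in> St \<Delta> u" using X(2) by blast
    then obtain \<sigma>' where s': "\<sigma>' facet_of \<Delta>" "u \<in> \<sigma>'" "x \<in> \<sigma>'" unfolding St_iff by blast
    then have "x \<notin> rel_interior \<sigma>'" using x by simp
    then show "x \<in> (\<Union>\<sigma>'\<in>?F. \<sigma>' - rel_interior \<sigma>')" using s' by (intro UN_I[of \<sigma>']) simp_all
  qed
  then have "?R \<subseteq> crd \<sigma> u ` (\<Union>\<sigma>'\<in>?F. \<sigma>' - rel_interior \<sigma>')" by (rule image_mono)
  then have "?R \<subseteq> (\<Union>\<sigma>'\<in>?F. crd \<sigma> u ` (\<sigma>' - rel_interior \<sigma>'))" unfolding image_UN .
  moreover have "negligible (\<Union>\<sigma>'\<in>?F. crd \<sigma> u ` (\<sigma>' - rel_interior \<sigma>'))"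
    by (intro negligible_Union finite_imageI fin ballI) (auto intro: negligible_crd_rel_boundary[OF \<sigma>])
  ultimately have "negligible ?R" by (rule negligible_subset[rotated])
  then have R: "?R \<in> null_sets lebesgue" by (simp add: negligible_iff_null_sets)
  have Us: "?U \<in> sets borel" by (intro sets.finite_UN fin piece(1)) auto
  have "X = (\<Union>\<sigma>'\<in>?F. ?X \<sigma>') \<union> (X - (\<Union>\<sigma>'\<in>?F. ?X \<sigma>'))" by blast
  then have split: "crd \<sigma> u ` X = ?U \<union> ?R" unfolding image_UN[symmetric] image_Un[symmetric] by (rule arg_cong)
  show "crd \<sigma> u ` X \<in> sets lebesgue" unfolding split using Us R by (intro sets.Un) auto
  have disj: "disjoint_family_on (\<lambda>\<sigma>'. crd \<sigma> u ` ?X \<sigma>') ?F"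
    unfolding disjoint_family_on_def
  proof (intro ballI impI)
    fix \<sigma>1 \<sigma>2 assume *: "\<sigma>1 \<in> ?F" "\<sigma>2 \<in> ?F" "\<sigma>1 \<noteq> \<sigma>2"
    have "?X \<sigma>1 \<inter> ?X \<sigma>2 = {}"
    proof (rule ccontr)
      assume "?X \<sigma>1 \<inter> ?X \<sigma>2 \<noteq> {}"
      then obtain x where x: "x \<in> rel_interior \<sigma>1" "x \<in> rel_interior \<sigma>2" by blast
      have "\<sigma>1 = \<sigma>2"
        by (rule facet_of_unique[OF _ _ x(1) subsetD[OF rel_interior_subset x(2)] convex_Delta]) (use * in auto)
      then show False using * by blast
    qed
    moreover have "crd \<sigma> u ` ?X \<sigma>1 \<inter> crd \<sigma> u ` ?X \<sigma>2 = crd \<sigma> u ` (?X \<sigma>1 \<inter> ?X \<sigma>2)"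
      using X(2) by (intro inj_on_image_Int[OF inj_on_crd_St[OF \<sigma>], symmetric]) auto
    ultimately show "crd \<sigma> u ` ?X \<sigma>1 \<inter> crd \<sigma> u ` ?X \<sigma>2 = {}" by simp
  qed
  have "emeasure lebesgue (crd \<sigma> u ` X) = emeasure lebesgue ?U"
    unfolding split using Us R by (intro emeasure_Un_null_set) auto
  also have "\<dots> = emeasure lborel ?U" using Us by simp
  also have "\<dots> = (\<Sum>\<sigma>'\<in>?F. emeasure lborel (crd \<sigma> u ` ?X \<sigma>'))"
    using fin piece(1) disj by (intro sum_emeasure[symmetric]) auto
  also have "\<dots> = (\<Sum>\<sigma>'\<in>?F. emeasure lborel ((\<lambda>x. base \<sigma>' + J \<sigma>' x) -` ?X \<sigma>'))"
    using piece(2) by (intro sum.cong) auto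
  also have "\<dots> = (\<Sum>\<sigma>' | \<sigma>' facet_of \<Delta>. emeasure lborel ((\<lambda>x. base \<sigma>' + J \<sigma>' x) -` ?X \<sigma>'))"
  proof (rule sum.mono_neutral_left[OF finite_facets_Delta])
    show "\<forall>\<sigma>'\<in>{\<sigma>'. \<sigma>' facet_of \<Delta>} - ?F. emeasure lborel ((\<lambda>x. base \<sigma>' + J \<sigma>' x) -` ?X \<sigma>') = 0"
    proof
      fix \<sigma>' assume s: "\<sigma>' \<in> {\<sigma>'. \<sigma>' facet_of \<Delta>} - ?F"
      have "?X \<sigma>' = {}"
      proof (rule ccontr)
        assume "?X \<sigma>' \<noteq> {}"
        then obtain x where x: "x \<in> X" "x \<in> rel_interior \<sigma>'" by blast
        then have "x \<in> St \<Delta> u" using X(2) by blast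
        then obtain \<sigma>2 where s2: "\<sigma>2 facet_of \<Delta>" "u \<in> \<sigma>2" "x \<in> \<sigma>2" unfolding St_iff by blast
        have "\<sigma>' = \<sigma>2" by (rule facet_of_unique[OF _ s2(1) x(2) s2(3) convex_Delta]) (use s in blast)
        then show False using s s2 by blast
      qed
      then show "emeasure lborel ((\<lambda>x. base \<sigma>' + J \<sigma>' x) -` ?X \<sigma>') = 0" by simp
    qed
  qed auto
  also have "\<dots> = emeasure \<mu> X" using X(1) by (simp add: emeasure_mu)
  finally show "emeasure lebesgue (crd \<sigma> u ` X) = emeasure \<mu> X" .
qed

end

section \<open>Cyclical monotonicity of optimal plans\<close>

text \<open>Serves to assemble a rearranged plan from the part left in place and one product measure
  for each index.\<close>

definition sum_measure :: "'i set \<Rightarrow> ('i \<Rightarrow> 'a::topological_space measure) \<Rightarrow> 'a measure" where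
  "sum_measure I M = measure_of UNIV (sets borel) (\<lambda>E. \<Sum>i\<in>I. emeasure (M i) E)"

lemma sets_sum_measure [simp, measurable_cong]: "sets (sum_measure I M) = sets borel"
  by (simp add: sum_measure_def sets.sigma_sets_eq[of borel, simplified])

lemma space_sum_measure [simp]: "space (sum_measure I M) = UNIV"
  by (simp add: sum_measure_def)

lemma emeasure_sum_measure:
  assumes M: "\<And>i. i \<in> I \<Longrightarrow> sets (M i) = sets borel" and E: "E \<in> sets borel"
  shows "emeasure (sum_measure I M) E = (\<Sum>i\<in>I. emeasure (M i) E)"
proof (rule emeasure_measure_of[OF sum_measure_def])
  show "countably_additive (sets (sum_measure I M)) (\<lambda>E. \<Sum>i\<in>I. emeasure (M i) E)"
  proof (rule countably_additiveI)
    fix F :: "nat \<Rightarrow> 'b set" assume F: "range F \<subseteq> sets (sum_measure I M)" "disjoint_family F"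
    have "(\<Sum>n. emeasure (M i) (F n)) = emeasure (M i) (\<Union> (range F))" if "i \<in> I" for i
      using F M[OF that] by (intro suminf_emeasure) auto
    then show "(\<Sum>n. \<Sum>i\<in>I. emeasure (M i) (F n)) = (\<Sum>i\<in>I. emeasure (M i) (\<Union> (range F)))"
      by (subst suminf_sum) auto
  qed
qed (use E in \<open>auto simp: positive_def\<close>)

lemma nn_integral_sum_measure:
  assumes M: "\<And>i. i \<in> I \<Longrightarrow> sets (M i) = sets borel" and f: "f \<in> borel_measurable borel"
  shows "(\<integral>\<^sup>+x. f x \<partial>sum_measure I M) = (\<Sum>i\<in>I. \<integral>\<^sup>+x. f x \<partial>M i)"
proof -
  have meas: "g \<in> borel_measurable (M i)" if "g \<in> borel_measurable borel" "i \<in> I" for g :: "'b \<Rightarrow> ennreal" and i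
    using that(1) by (subst measurable_cong_sets[OF M[OF that(2)] refl])
  have meas': "g \<in> borel_measurable (sum_measure I M)" if "g \<in> borel_measurable borel" for g :: "'b \<Rightarrow> ennreal"
    using that by (subst measurable_cong_sets[OF sets_sum_measure refl])
  show ?thesis
    using f
  proof (induction rule: borel_measurable_induct)
    case (cong f g)
    have "f = g" using cong(3) by (intro ext) simp
    then show ?case using cong(4) by simp
  next
    case (set E)
    have "(\<integral>\<^sup>+x. indicator E x \<partial>M i) = emeasure (M i) E" if "i \<in> I" for i
      using set M[OF that] by (intro nn_integral_indicator) simp
    moreover have "(\<integral>\<^sup>+x. indicator E x \<partial>sum_measure I M) = emeasure (sum_measure I M) E"
      using set by (intro nn_integral_indicator) simp
    ultimately show ?case using set by (simp add: emeasure_sum_measure[OF M])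
  next
    case (mult u c)
    have "(\<integral>\<^sup>+x. c * u x \<partial>M i) = c * (\<integral>\<^sup>+x. u x \<partial>M i)" if "i \<in> I" for i
      by (rule nn_integral_cmult[OF meas[OF mult(2) that]])
    moreover have "(\<integral>\<^sup>+x. c * u x \<partial>sum_measure I M) = c * (\<integral>\<^sup>+x. u x \<partial>sum_measure I M)"
      by (rule nn_integral_cmult[OF meas'[OF mult(2)]])
    ultimately show ?case using mult(4) by (simp add: sum_distrib_left)
  next
    case (add u v)
    have "(\<integral>\<^sup>+x. v x + u x \<partial>M i) = (\<integral>\<^sup>+x. v x \<partial>M i) + (\<integral>\<^sup>+x. u x \<partial>M i)" if "i \<in> I" for i
      using add that meas by (intro nn_integral_add) blast+
    moreover have "(\<integral>\<^sup>+x. v x + u x \<partial>sum_measure I M) = (\<integral>\<^sup>+x. v x \<partial>sum_measure I M) + (\<integral>\<^sup>+x. u x \<partial>sum_measure I M)"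
      using add meas' by (intro nn_integral_add) blast+
    ultimately show ?case using add by (simp add: sum.distrib)
  next
    case (seq U)
    have Um: "U n \<in> borel_measurable borel" for n using seq by blast
    have IH: "(\<integral>\<^sup>+x. U n x \<partial>sum_measure I M) = (\<Sum>i\<in>I. \<integral>\<^sup>+x. U n x \<partial>M i)" for n using seq by blast
    have inc: "incseq U" using seq by blast
    have "(\<integral>\<^sup>+x. (SUP n. U n x) \<partial>sum_measure I M) = (SUP n. \<integral>\<^sup>+x. U n x \<partial>sum_measure I M)"
      by (rule nn_integral_monotone_convergence_SUP[OF inc meas'[OF Um]])
    also have "\<dots> = (SUP n. \<Sum>i\<in>I. \<integral>\<^sup>+x. U n x \<partial>M i)" by (simp only: IH)
    also have "\<dots> = (\<Sum>i\<in>I. SUP n. \<integral>\<^sup>+x. U n x \<partial>M i)"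
    proof (rule ennreal_SUP_sum)
      fix i show "incseq (\<lambda>n. \<integral>\<^sup>+x. U n x \<partial>M i)"
        using inc by (intro monoI nn_integral_mono) (simp add: incseq_def le_fun_def)
    qed
    also have "\<dots> = (\<Sum>i\<in>I. \<integral>\<^sup>+x. (SUP n. U n x) \<partial>M i)"
      by (intro sum.cong refl nn_integral_monotone_convergence_SUP[OF inc meas[OF Um], symmetric])
    finally show ?case by (simp only: SUP_apply)
  qed
qed

lemma finite_measure_sum_measure:
  assumes "\<And>i. i \<in> I \<Longrightarrow> sets (M i) = sets borel" "\<And>i. i \<in> I \<Longrightarrow> finite_measure (M i)" "finite I"
  shows "finite_measure (sum_measure I M)"
proof
  have "emeasure (M i) UNIV \<noteq> top" if "i \<in> I" for i
    using finite_measure.emeasure_finite[OF assms(2)[OF that], of UNIV] by simp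
  then show "emeasure (sum_measure I M) (space (sum_measure I M)) \<noteq> \<infinity>"
    using assms by (simp add: emeasure_sum_measure less_top)
qed

text \<open>Adding the bound C makes the integrand nonnegative and reduces the claim to
  \<open>nn_integral_sum_measure\<close>; the contribution of the constant is additive as
  well.\<close>

lemma integral_sum_measure:
  fixes f :: "'a::topological_space \<Rightarrow> real"
  assumes M: "\<And>i. i \<in> I \<Longrightarrow> sets (M i) = sets borel" "\<And>i. i \<in> I \<Longrightarrow> finite_measure (M i)" "finite I"
    and f: "f \<in> borel_measurable borel" and bound: "\<And>x. \<bar>f x\<bar> \<le> C"
  shows "(\<integral>x. f x \<partial>sum_measure I M) = (\<Sum>i\<in>I. \<integral>x. f x \<partial>M i)"
proof -
  let ?g = "\<lambda>x. f x + C"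
  have g0: "0 \<le> ?g x" "?g x \<le> 2 * C" for x using bound[of x] by auto
  have int: "integrable P ?g" "integrable P f" if "sets P = sets borel" "finite_measure P" for P
  proof -
    have m: "f \<in> borel_measurable P" using f by (subst measurable_cong_sets[OF that(1) refl])
    show "integrable P f" using bound that m by (intro finite_measure.integrable_const_bound[where B = C]) auto
    then show "integrable P ?g" using that(2) by (intro Bochner_Integration.integrable_add finite_measure.integrable_const)
  qed
  have eq: "(\<integral>x. f x \<partial>P) = (\<integral>x. ?g x \<partial>P) - C * measure P UNIV" if "sets P = sets borel" "finite_measure P" for P
  proof -
    have "space P = UNIV" using sets_eq_imp_space_eq[OF that(1)] by simp
    then show ?thesis using int[OF that] that(2)
      by (subst Bochner_Integration.integral_add) (auto simp: finite_measure.integrable_const)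
  qed
  have fin: "finite_measure (sum_measure I M)" by (rule finite_measure_sum_measure[OF M])
  have fing: "(\<integral>\<^sup>+x. ?g x \<partial>M i) < top" if "i \<in> I" for i
  proof -
    have "(\<integral>\<^sup>+x. ?g x \<partial>M i) \<le> (\<integral>\<^sup>+x. ennreal (2 * C) \<partial>M i)"
      using g0(2) by (intro nn_integral_mono ennreal_leI)
    also have "\<dots> < top"
      using finite_measure.emeasure_finite[OF M(2)[OF that], of "space (M i)"]
      by (simp add: ennreal_mult_less_top less_top)
    finally show ?thesis .
  qed
  have "(\<integral>\<^sup>+x. ?g x \<partial>sum_measure I M) = (\<Sum>i\<in>I. \<integral>\<^sup>+x. ?g x \<partial>M i)"
    by (intro nn_integral_sum_measure M(1) measurable_compose[OF _ measurable_ennreal]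
        borel_measurable_add borel_measurable_const f)
  then have "enn2real (\<integral>\<^sup>+x. ?g x \<partial>sum_measure I M) = (\<Sum>i\<in>I. enn2real (\<integral>\<^sup>+x. ?g x \<partial>M i))"
    using enn2real_sum[of I "\<lambda>i. \<integral>\<^sup>+x. ?g x \<partial>M i", OF fing] by (simp only: o_def)
  moreover have nn: "(\<integral>x. ?g x \<partial>P) = enn2real (\<integral>\<^sup>+x. ?g x \<partial>P)" if "sets P = sets borel" for P
  proof (rule integral_eq_nn_integral)
    have "f \<in> borel_measurable P" using f by (subst measurable_cong_sets[OF that refl])
    then show "?g \<in> borel_measurable P" by (intro borel_measurable_add borel_measurable_const)
  qed (simp add: g0)
  ultimately have g: "(\<integral>x. ?g x \<partial>sum_measure I M) = (\<Sum>i\<in>I. \<integral>x. ?g x \<partial>M i)"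
    by (simp only: nn[OF sets_sum_measure] nn[OF M(1)] cong: sum.cong)
  have finU: "emeasure (M i) UNIV < top" if "i \<in> I" for i
    using finite_measure.emeasure_finite[OF M(2)[OF that], of UNIV] by (simp add: less_top)
  have "emeasure (sum_measure I M) UNIV = (\<Sum>i\<in>I. emeasure (M i) UNIV)"
    by (intro emeasure_sum_measure M(1) space_in_borel)
  then have m: "measure (sum_measure I M) UNIV = (\<Sum>i\<in>I. measure (M i) UNIV)"
    unfolding measure_def using enn2real_sum[of I "\<lambda>i. emeasure (M i) UNIV", OF finU] by (simp only: o_def)
  have "(\<Sum>i\<in>I. \<integral>x. f x \<partial>M i) = (\<Sum>i\<in>I. (\<integral>x. ?g x \<partial>M i) - C * measure (M i) UNIV)"
    by (intro sum.cong refl eq M)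
  then show ?thesis
    unfolding eq[OF sets_sum_measure fin] g m by (simp only: sum_subtractf sum_distrib_left)
qed

text \<open>Arbitrary permutations of finite index sets stand in for cycles, which is equivalent
  because a permutation decomposes into cycles; the points \<open>z i\<close> may repeat.\<close>

definition cyclically_monotone :: "('a::real_inner \<times> 'a) set \<Rightarrow> bool" where
  "cyclically_monotone S \<longleftrightarrow>
     (\<forall>(I::nat set) s z. finite I \<longrightarrow> bij_betw s I I \<longrightarrow> (\<forall>i\<in>I. z i \<in> S) \<longrightarrow>
        (\<Sum>i\<in>I. fst (z (s i)) \<bullet> snd (z i)) \<le> (\<Sum>i\<in>I. fst (z i) \<bullet> snd (z i)))"

lemma cyclically_monotone_subset: "cyclically_monotone S \<Longrightarrow> T \<subseteq> S \<Longrightarrow> cyclically_monotone T"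
  unfolding cyclically_monotone_def by blast

lemma cyclically_monotoneD:
  assumes "cyclically_monotone S" "\<And>i. i \<le> k \<Longrightarrow> f i \<in> S"
  shows "(\<Sum>i<k. (fst (f (Suc i)) - fst (f i)) \<bullet> snd (f i)) + (fst (f 0) - fst (f k)) \<bullet> snd (f k) \<le> 0"
proof -
  \<comment> \<open>The cyclic shift of 0, ..., k; its wrap from k to 0 produces the closing
    term.\<close>
  define s where "s i = (if i = k then 0 else Suc i)" for i
  have "bij_betw s {..k} {..k}"
    unfolding bij_betw_def
  proof
    show inj: "inj_on s {..k}" by (auto simp: inj_on_def s_def)
    show "s ` {..k} = {..k}"
      by (rule endo_inj_surj[OF _ _ inj]) (auto simp: s_def)
  qed
  then have "(\<Sum>i\<le>k. fst (f (s i)) \<bullet> snd (f i)) \<le> (\<Sum>i\<le>k. fst (f i) \<bullet> snd (f i))"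
    using assms unfolding cyclically_monotone_def by simp
  then have "(\<Sum>i\<le>k. (fst (f (s i)) - fst (f i)) \<bullet> snd (f i)) \<le> 0"
    by (simp add: inner_diff_left sum_subtractf)
  then show ?thesis by (simp add: s_def lessThan_Suc_atMost[symmetric])
qed

text \<open>Rockafellar's construction: the potential is a supremum over chains in \<open>S\<close>.\<close>

lemma cyclically_monotone_potential:
  fixes S :: "('a::real_inner \<times> 'a) set"
  assumes cyc: "cyclically_monotone S" and ne: "z0 \<in> S" and R: "\<And>z. z \<in> S \<Longrightarrow> norm (snd z) \<le> R"
  obtains \<Phi> where "\<And>x y z. (x, y) \<in> S \<Longrightarrow> \<Phi> x + y \<bullet> (z - x) \<le> \<Phi> z"
    "\<And>z. \<bar>\<Phi> z\<bar> \<le> R * norm (z - fst z0)"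
proof -
  define Ch where "Ch = {(k :: nat, f :: nat \<Rightarrow> 'a \<times> 'a). (\<forall>i\<le>k. f i \<in> S) \<and> f 0 = z0}"
  define val where "val = (\<lambda>(k :: nat, f :: nat \<Rightarrow> 'a \<times> 'a) z. (\<Sum>i<k. (fst (f (Suc i)) - fst (f i)) \<bullet> snd (f i)) + (z - fst (f k)) \<bullet> snd (f k))"
  define \<Phi> where "\<Phi> z = (SUP c\<in>Ch. val c z)" for z
  have inner_le: "\<bar>(z - fst z0) \<bullet> snd w\<bar> \<le> R * norm (z - fst z0)" if "w \<in> S" for z w
    using Cauchy_Schwarz_ineq2[of "z - fst z0" "snd w"] mult_right_mono[OF R[OF that] norm_ge_zero[of "z - fst z0"]]
    by (simp add: mult.commute)
  have bound: "val c z \<le> R * norm (z - fst z0)" if c: "c \<in> Ch" for c z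
  proof -
    obtain k f where kf: "c = (k, f)" "\<And>i. i \<le> k \<Longrightarrow> f i \<in> S" "f 0 = z0" using c by (auto simp: Ch_def)
    \<comment> \<open>Closing the chain at \<open>z0\<close> splits its value into a cyclic sum,
      which is at most 0, and one pairing that R controls.\<close>
    have "val c z = (\<Sum>i<k. (fst (f (Suc i)) - fst (f i)) \<bullet> snd (f i)) + (fst (f 0) - fst (f k)) \<bullet> snd (f k)
        + (z - fst z0) \<bullet> snd (f k)"
      by (simp add: val_def kf inner_diff_left)
    moreover have "(\<Sum>i<k. (fst (f (Suc i)) - fst (f i)) \<bullet> snd (f i)) + (fst (f 0) - fst (f k)) \<bullet> snd (f k) \<le> 0"
      by (rule cyclically_monotoneD[OF cyc kf(2)])
    ultimately show ?thesis using inner_le[OF kf(2)[of k], of z] by auto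
  qed
  have c0: "(0, \<lambda>_. z0) \<in> Ch" using ne by (simp add: Ch_def)
  have bdd: "bdd_above ((\<lambda>c. val c z) ` Ch)" for z using bound by (intro bdd_aboveI2) blast
  show thesis
  proof (rule that[of \<Phi>])
    fix x y z assume xy: "(x, y) \<in> S"
    have "\<Phi> x \<le> \<Phi> z - y \<bullet> (z - x)"
      unfolding \<Phi>_def[of x]
    proof (rule cSUP_least)
      show "Ch \<noteq> {}" using c0 by blast
      fix c assume c: "c \<in> Ch"
      obtain k f where kf: "c = (k, f)" "\<And>i. i \<le> k \<Longrightarrow> f i \<in> S" "f 0 = z0" using c by (auto simp: Ch_def)
      have "(Suc k, f(Suc k := (x, y))) \<in> Ch" using kf xy by (auto simp: Ch_def le_Suc_eq)
      then have "val (Suc k, f(Suc k := (x, y))) z \<le> \<Phi> z" unfolding \<Phi>_def by (rule cSUP_upper[OF _ bdd])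
      moreover have "val (Suc k, f(Suc k := (x, y))) z = val c x + y \<bullet> (z - x)"
        by (simp add: val_def kf inner_commute)
      ultimately show "val c x \<le> \<Phi> z - y \<bullet> (z - x)" by simp
    qed
    then show "\<Phi> x + y \<bullet> (z - x) \<le> \<Phi> z" by simp
  next
    fix z
    have "\<Phi> z \<le> R * norm (z - fst z0)"
      unfolding \<Phi>_def using c0 bound by (intro cSUP_least) auto
    moreover have "(z - fst z0) \<bullet> snd z0 \<le> \<Phi> z"
      unfolding \<Phi>_def using cSUP_upper[OF c0 bdd] by (simp add: val_def)
    ultimately show "\<bar>\<Phi> z\<bar> \<le> R * norm (z - fst z0)" using inner_le[OF ne, of z] by linarith
  qed
qed

lemma AE_outside_null_sets:
  assumes "A1 \<in> null_sets M" "A2 \<in> null_sets M" "A3 \<in> null_sets M" "A4 \<in> null_sets M"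
    and "\<And>z. z \<in> space M \<Longrightarrow> z \<notin> A1 \<Longrightarrow> z \<notin> A2 \<Longrightarrow> z \<notin> A3 \<Longrightarrow> z \<notin> A4 \<Longrightarrow> P z"
  shows "AE z in M. P z"
  by (rule AE_I'[of "A1 \<union> A2 \<union> (A3 \<union> A4)"]) (use assms in \<open>auto intro!: null_sets.Un\<close>)

section \<open>Supports of measures and rearrangement of plans\<close>

definition measure_support :: "'a::topological_space measure \<Rightarrow> 'a set" where
  "measure_support M = {x. \<forall>U. open U \<longrightarrow> x \<in> U \<longrightarrow> 0 < emeasure M U}"

text \<open>The complement is a union of open null sets, and by the Lindelof property countably many
  of them suffice.\<close>

lemma emeasure_outside_support:
  fixes M :: "'a::second_countable_topology measure"
  assumes sets: "sets M = sets borel"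
  shows "open (- measure_support M)" "emeasure M (- measure_support M) = 0"
proof -
  let ?F = "{U. open U \<and> emeasure M U = 0}"
  have eq: "- measure_support M = \<Union> ?F"
    by (auto simp: measure_support_def zero_less_iff_neq_zero)
  then show "open (- measure_support M)" by auto
  obtain G where G: "G \<subseteq> ?F" "countable G" "\<Union> G = \<Union> ?F"
    using Lindelof[of ?F] by blast
  have "\<Union> G \<in> null_sets M"
    using G(1,2) sets by (intro null_sets_UN'[of G "\<lambda>x. x", simplified]) (auto simp: null_sets_def)
  then show "emeasure M (- measure_support M) = 0" using eq G(3) by auto
qed

text \<open>
  If the support violated cyclical monotonicity, rearranging small pieces of mass near the
  violating points would produce a better plan with the same marginals.
\<close>

lemma cyclically_monotone_support:
  fixes \<gamma> :: "('a::euclidean_space \<times> 'a) measure"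
  assumes sets: "sets \<gamma> = sets borel" and fin: "finite_measure \<gamma>"
    and AB: "A \<in> sets borel" "B \<in> sets borel" "bounded A" "bounded B"
    and conc: "emeasure \<gamma> (- (A \<times> B)) = 0"
    and opt: "\<And>\<gamma>'. sets \<gamma>' = sets borel \<Longrightarrow> distr \<gamma>' borel fst = distr \<gamma> borel fst \<Longrightarrow>
        distr \<gamma>' borel snd = distr \<gamma> borel snd \<Longrightarrow>
        (\<integral>z. indicator (A \<times> B) z * (fst z \<bullet> snd z) \<partial>\<gamma>') \<le> (\<integral>z. indicator (A \<times> B) z * (fst z \<bullet> snd z) \<partial>\<gamma>)"
  shows "cyclically_monotone (measure_support \<gamma>)"
  unfolding cyclically_monotone_def
proof (intro allI impI, rule ccontr)
  define c :: "'a \<times> 'a \<Rightarrow> real" where "c = (\<lambda>z. indicator (A \<times> B) z * (fst z \<bullet> snd z))"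
  fix I :: "nat set" and s z
  assume I: "finite I" and s: "bij_betw s I I" and z: "\<forall>i\<in>I. z i \<in> measure_support \<gamma>"
    and viol: "\<not> (\<Sum>i\<in>I. fst (z (s i)) \<bullet> snd (z i)) \<le> (\<Sum>i\<in>I. fst (z i) \<bullet> snd (z i))"
  define \<delta> where "\<delta> = (\<Sum>i\<in>I. fst (z (s i)) \<bullet> snd (z i) - fst (z i) \<bullet> snd (z i))"
  have \<delta>: "\<delta> > 0" using viol by (simp add: \<delta>_def sum_subtractf)
  have ne: "I \<noteq> {}" using viol by auto
  have sI: "s i \<in> I" if "i \<in> I" for i using s that by (auto simp: bij_betw_def)
  define M where "M = (\<Sum>i\<in>I. norm (fst (z i)) + norm (snd (z i)))"
  \<comment> \<open>Each index loses at most \<eta> in the old cost and \<eta> in the new one, so at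
    most \<open>2 * card I * \<eta> = \<delta> / 2\<close> of the gain \<delta> is lost.\<close>
  define \<eta> where "\<eta> = \<delta> / (4 * card I)"
  \<comment> \<open>The two error terms of a pairing are at most r (M + 1), where r \<le> 1 is used,
    and M r; so the requirement is r (2 M + 1) \<le> \<eta>.\<close>
  define r where "r = min 1 (\<eta> / (2 * M + 2))"
  have card0: "real (card I) > 0" using I ne by (simp add: card_gt_0_iff)
  have M0: "M \<ge> 0" unfolding M_def by (intro sum_nonneg) simp
  have \<eta>: "\<eta> > 0" using \<delta> card0 by (simp add: \<eta>_def)
  have r: "r > 0" "r \<le> 1" "r * (2 * M + 1) \<le> \<eta>"
  proof -
    show "r > 0" "r \<le> 1" using \<eta> M0 by (auto simp: r_def)
    have "r * (2 * M + 1) \<le> \<eta> / (2 * M + 2) * (2 * M + 1)" using M0 by (intro mult_right_mono) (auto simp: r_def)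
    also have "\<dots> \<le> \<eta>" using M0 \<eta> by (simp add: field_simps)
    finally show "r * (2 * M + 1) \<le> \<eta>" .
  qed
  have Mle: "norm (fst (z i)) \<le> M" "norm (snd (z i)) \<le> M" if "i \<in> I" for i
    using member_le_sum[OF that, of "\<lambda>i. norm (fst (z i)) + norm (snd (z i))"] I
      norm_ge_zero[of "fst (z i)"] norm_ge_zero[of "snd (z i)"]
    unfolding M_def by (auto intro: order_trans[rotated])
  have near: "\<bar>x \<bullet> y - fst (z j) \<bullet> snd (z i)\<bar> \<le> \<eta>"
    if "i \<in> I" "j \<in> I" "x \<in> ball (fst (z j)) r" "y \<in> ball (snd (z i)) r" for i j x y
  proof -
    let ?x = "fst (z j)" and ?y = "snd (z i)"
    have dx: "norm (x - ?x) \<le> r" and dy: "norm (y - ?y) \<le> r"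
      using that by (auto simp: dist_norm norm_minus_commute)
    have ny: "norm y \<le> M + 1"
      using norm_triangle_ineq[of "y - ?y" ?y] dy r(2) Mle(2)[OF that(1)] by simp
    have "\<bar>(x - ?x) \<bullet> y\<bar> \<le> r * (M + 1)"
      using Cauchy_Schwarz_ineq2[of "x - ?x" y] mult_mono[OF dx ny] r M0 by simp
    moreover have "\<bar>?x \<bullet> (y - ?y)\<bar> \<le> M * r"
      using Cauchy_Schwarz_ineq2[of ?x "y - ?y"] mult_mono[OF Mle(1)[OF that(2)] dy] r M0 by simp
    moreover have "x \<bullet> y - ?x \<bullet> ?y = (x - ?x) \<bullet> y + ?x \<bullet> (y - ?y)"
      by (simp add: inner_diff_left inner_diff_right)
    ultimately have "\<bar>x \<bullet> y - ?x \<bullet> ?y\<bar> \<le> r * (2 * M + 1)" by (simp add: algebra_simps)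
    then show ?thesis using r(3) by simp
  qed
  define W where "W i = ball (fst (z i)) r \<times> ball (snd (z i)) r" for i
  define a where "a i = measure \<gamma> (W i)" for i
  have Wopen: "open (W i)" for i unfolding W_def by (intro open_Times open_ball)
  then have Wb [measurable]: "W i \<in> sets borel" for i by simp
  have Wg: "W i \<in> sets \<gamma>" for i using Wb sets by simp
  have space: "space \<gamma> = UNIV" using sets_eq_imp_space_eq[OF sets] by simp
  have meas: "f \<in> measurable \<gamma> N" if "f \<in> measurable borel N" for f :: "'a \<times> 'a \<Rightarrow> 'x" and N
    using that by (subst measurable_cong_sets[OF sets refl])
  interpret fm: finite_measure \<gamma> by (rule fin)
  have emW: "emeasure \<gamma> (W i) = ennreal (a i)" for i unfolding a_def by (rule fm.emeasure_eq_measure)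
  have a0: "a i > 0" if "i \<in> I" for i
  proof -
    have "z i \<in> W i" using r(1) by (simp add: W_def mem_Times_iff)
    then have "emeasure \<gamma> (W i) > 0" using z that Wopen unfolding measure_support_def by blast
    then show ?thesis unfolding emW by simp
  qed
  \<comment> \<open>The mass moved per index. The densities removed at a point add up to at most the
    sum of all \<open>e / a i\<close>, which this choice makes 1, so the remaining weight
    \<open>w\<close> is nonnegative even where the sets \<open>W i\<close> overlap.\<close>
  define e where "e = 1 / (\<Sum>i\<in>I. 1 / a i)"
  have suma: "(\<Sum>i\<in>I. 1 / a i) > 0" using a0 I ne by (intro sum_pos) auto
  then have e: "e > 0" "(\<Sum>i\<in>I. e / a i) = 1"
  proof -
    show "e > 0" using suma by (simp add: e_def)
    have "(\<Sum>i\<in>I. e / a i) = e * (\<Sum>i\<in>I. 1 / a i)" by (simp add: sum_distrib_left)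
    then show "(\<Sum>i\<in>I. e / a i) = 1" using suma by (simp add: e_def)
  qed
  define d where "d i = (\<lambda>x. indicator (W i) x / a i :: real)" for i
  have dm [measurable]: "d i \<in> borel_measurable borel" for i unfolding d_def by measurable
  have d0: "d i x \<ge> 0" for i x by (simp add: d_def a_def)
  \<comment> \<open>For i in I this is the probability measure obtained by conditioning \<gamma> on
    \<open>W i\<close>.\<close>
  define k where "k i = density \<gamma> (\<lambda>x. ennreal (d i x))" for i
  have sk: "sets (k i) = sets borel" for i by (simp add: k_def sets)
  define w where "w = (\<lambda>x. 1 - (\<Sum>i\<in>I. e * d i x))"
  have wm [measurable]: "w \<in> borel_measurable borel" unfolding w_def by measurable
  have w0: "w x \<ge> 0" for x
  proof -
    have "(\<Sum>i\<in>I. e * d i x) \<le> (\<Sum>i\<in>I. e / a i)"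
      using e(1) a0 by (intro sum_mono) (auto simp: d_def indicator_def less_imp_le)
    then show ?thesis using e(2) by (simp add: w_def)
  qed
  have emk: "emeasure (k i) P = (\<integral>\<^sup>+x. ennreal (d i x) * indicator P x \<partial>\<gamma>)" if "P \<in> sets borel" for i P
    unfolding k_def using that sets by (intro emeasure_density meas) (auto intro: measurable_compose[OF dm])
  have kU: "emeasure (k i) UNIV = 1" if "i \<in> I" for i
  proof -
    have "emeasure (k i) UNIV = (\<integral>\<^sup>+x. ennreal (1 / a i) * indicator (W i) x \<partial>\<gamma>)"
      unfolding emk[OF space_in_borel] by (intro nn_integral_cong) (simp add: d_def indicator_def)
    also have "\<dots> = ennreal (1 / a i) * ennreal (a i)" using Wg by (simp add: nn_integral_cmult_indicator emW)
    also have "\<dots> = 1" using a0[OF that] by (simp add: ennreal_mult'[symmetric])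
    finally show ?thesis .
  qed
  have split: "(\<integral>\<^sup>+x. ennreal (w x) * indicator P x \<partial>\<gamma>) + (\<Sum>i\<in>I. ennreal e * emeasure (k i) P) = emeasure \<gamma> P"
    if P: "P \<in> sets borel" for P
  proof -
    have m1: "(\<lambda>x. ennreal (w x) * indicator P x) \<in> borel_measurable \<gamma>"
      by (intro meas borel_measurable_times_ennreal measurable_compose[OF wm measurable_ennreal] borel_measurable_indicator P)
    have m2: "(\<lambda>x. ennreal (d i x) * indicator P x) \<in> borel_measurable \<gamma>" for i
      by (intro meas borel_measurable_times_ennreal measurable_compose[OF dm measurable_ennreal] borel_measurable_indicator P)
    have "(\<Sum>i\<in>I. ennreal e * emeasure (k i) P) = (\<integral>\<^sup>+x. (\<Sum>i\<in>I. ennreal e * (ennreal (d i x) * indicator P x)) \<partial>\<gamma>)"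
      unfolding emk[OF P] using m2 by (subst nn_integral_sum) (auto simp: nn_integral_cmult)
    then have "(\<integral>\<^sup>+x. ennreal (w x) * indicator P x \<partial>\<gamma>) + (\<Sum>i\<in>I. ennreal e * emeasure (k i) P)
        = (\<integral>\<^sup>+x. ennreal (w x) * indicator P x + (\<Sum>i\<in>I. ennreal e * (ennreal (d i x) * indicator P x)) \<partial>\<gamma>)"
      using m1 m2 by (subst nn_integral_add) auto
    also have "\<dots> = (\<integral>\<^sup>+x. indicator P x \<partial>\<gamma>)"
    proof (intro nn_integral_cong)
      fix x
      have "ennreal (w x) + (\<Sum>i\<in>I. ennreal e * ennreal (d i x)) = ennreal (w x + (\<Sum>i\<in>I. e * d i x))"
        using w0 e(1) d0 by (simp add: ennreal_mult'[symmetric] sum_ennreal ennreal_plus[symmetric] sum_nonneg del: ennreal_plus)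
      then have "ennreal (w x) + (\<Sum>i\<in>I. ennreal e * ennreal (d i x)) = 1" by (simp add: w_def)
      then show "ennreal (w x) * indicator P x + (\<Sum>i\<in>I. ennreal e * (ennreal (d i x) * indicator P x)) = indicator P x"
        by (auto simp: indicator_def)
    qed
    also have "\<dots> = emeasure \<gamma> P" using P sets by simp
    finally show ?thesis .
  qed
  define \<alpha> where "\<alpha> i = distr (k i) borel fst" for i
  define \<beta> where "\<beta> i = distr (k i) borel snd" for i
  have fst_m: "fst \<in> measurable (k i) borel" and snd_m: "snd \<in> measurable (k i) borel" for i
    by (subst measurable_cong_sets[OF sk refl]; intro borel_measurable_continuous_onI continuous_intros)+
  have spk: "space (k i) = UNIV" for i using space by (simp add: k_def)
  have em\<alpha>: "emeasure (\<alpha> i) X = emeasure (k i) (X \<times> UNIV)" if "X \<in> sets borel" for i X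
    unfolding \<alpha>_def using that fst_m by (subst emeasure_distr) (auto simp: spk vimage_fst)
  have em\<beta>: "emeasure (\<beta> i) X = emeasure (k i) (UNIV \<times> X)" if "X \<in> sets borel" for i X
    unfolding \<beta>_def using that snd_m by (subst emeasure_distr) (auto simp: spk vimage_snd)
  have finab: "finite_measure (\<alpha> i)" "finite_measure (\<beta> i)" "finite_measure (k i)" if "i \<in> I" for i
    using em\<alpha>[of UNIV i] em\<beta>[of UNIV i] kU[OF that] by (auto intro!: finite_measureI simp: \<alpha>_def \<beta>_def spk)
  have sab: "sets (\<alpha> j \<Otimes>\<^sub>M \<beta> i) = sets borel" for i j
    using borel_prod[where 'a='a and 'b='a] by (metis \<alpha>_def \<beta>_def sets_distr sets_pair_measure_cong)
  have emab: "emeasure (\<alpha> j \<Otimes>\<^sub>M \<beta> i) (X \<times> Y) = emeasure (\<alpha> j) X * emeasure (\<beta> i) Y"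
    if "i \<in> I" "X \<in> sets borel" "Y \<in> sets borel" for i j X Y
  proof -
    interpret finite_measure "\<beta> i" by (rule finab(2)[OF that(1)])
    show ?thesis using that by (intro emeasure_pair_measure_Times) (auto simp: \<alpha>_def \<beta>_def)
  qed
  have ab1: "emeasure (\<alpha> i) UNIV = 1" "emeasure (\<beta> i) UNIV = 1" if "i \<in> I" for i
    using em\<alpha>[of UNIV i] em\<beta>[of UNIV i] kU[OF that] by auto
  \<comment> \<open>The mass e taken from each \<open>k i\<close> is returned as an independent
    coupling of the first marginal of \<open>k (s i)\<close> with the second marginal of
    \<open>k i\<close>; \<open>None\<close> indexes the part left in place.\<close>
  define F where "F = (\<lambda>q. case q of None \<Rightarrow> density \<gamma> (\<lambda>x. ennreal (w x))
      | Some i \<Rightarrow> density (\<alpha> (s i) \<Otimes>\<^sub>M \<beta> i) (\<lambda>_. ennreal e))"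
  define Q where "Q = insert None (Some ` I)"
  have sumQ: "(\<Sum>q\<in>Q. f q) = f None + (\<Sum>i\<in>I. f (Some i))" for f :: "nat option \<Rightarrow> 'y::comm_monoid_add"
    using I by (simp add: Q_def sum.reindex)
  have sF: "sets (F q) = sets borel" for q
    using sab by (cases q) (auto simp: F_def sets)
  have emF: "emeasure (F (Some i)) (X \<times> Y) = ennreal e * (emeasure (\<alpha> (s i)) X * emeasure (\<beta> i) Y)"
    if "i \<in> I" "X \<in> sets borel" "Y \<in> sets borel" for i X Y
    using that sab emab[OF that] unfolding F_def
    by (simp add: emeasure_density_const borel_Times)
  have emF0: "emeasure (F None) P = (\<integral>\<^sup>+x. ennreal (w x) * indicator P x \<partial>\<gamma>)" if "P \<in> sets borel" for P
    unfolding F_def option.case using that sets by (intro emeasure_density meas) auto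
  have finF: "finite_measure (F q)" if "q \<in> Q" for q
  proof (cases q)
    case None
    have "emeasure (F None) UNIV \<le> emeasure \<gamma> UNIV"
      using split[OF space_in_borel] emF0[OF space_in_borel] by (metis le_iff_add)
    then have "emeasure (F None) UNIV < top" using fm.emeasure_finite[of UNIV] by (metis infinity_ennreal_def less_top order_le_less_trans)
    then show ?thesis using None sets_eq_imp_space_eq[OF sF[of None]] by (intro finite_measureI) (simp add: less_top)
  next
    case (Some i)
    then have i: "i \<in> I" using that by (auto simp: Q_def)
    have "emeasure (F (Some i)) UNIV = ennreal e"
      using emF[OF i space_in_borel space_in_borel] ab1[OF i] ab1[OF sI[OF i]] by simp
    then show ?thesis using Some sets_eq_imp_space_eq[OF sF[of q]] by (intro finite_measureI) simp
  qed
  define \<gamma>' where "\<gamma>' = sum_measure Q F"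
  have finQ: "finite Q" using I by (simp add: Q_def)
  have s\<gamma>': "sets \<gamma>' = sets borel" by (simp add: \<gamma>'_def)
  have sp\<gamma>': "space \<gamma>' = UNIV" by (simp add: \<gamma>'_def)
  have em\<gamma>': "emeasure \<gamma>' P = emeasure (F None) P + (\<Sum>i\<in>I. emeasure (F (Some i)) P)" if "P \<in> sets borel" for P
    unfolding \<gamma>'_def using sumQ[of "\<lambda>q. emeasure (F q) P"] emeasure_sum_measure[of Q F P] sF that by simp
  have fst_m': "fst \<in> measurable \<gamma>' borel" "snd \<in> measurable \<gamma>' borel"
    by (subst measurable_cong_sets[OF s\<gamma>' refl]; intro borel_measurable_continuous_onI continuous_intros)+
  have fst_mg: "fst \<in> measurable \<gamma> borel" "snd \<in> measurable \<gamma> borel"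
    by (intro meas borel_measurable_continuous_onI continuous_intros)+
  have marg1: "distr \<gamma>' borel fst = distr \<gamma> borel fst"
  proof (rule measure_eqI)
    fix X assume "X \<in> sets (distr \<gamma>' borel fst)"
    then have X: "X \<in> sets borel" by simp
    then have XU: "X \<times> UNIV \<in> sets borel" by (intro borel_Times) auto
    have "emeasure (distr \<gamma>' borel fst) X = emeasure \<gamma>' (X \<times> UNIV)"
      using X fst_m' by (subst emeasure_distr) (auto simp: sp\<gamma>' vimage_fst)
    also have "\<dots> = emeasure (F None) (X \<times> UNIV) + (\<Sum>i\<in>I. ennreal e * emeasure (\<alpha> (s i)) X)"
      unfolding em\<gamma>'[OF XU] using emF[OF _ X space_in_borel] ab1(2) by simp
    \<comment> \<open>All pieces carry the same mass e, so permuting their first marginals by s does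
      not change the sum.\<close>
    also have "(\<Sum>i\<in>I. ennreal e * emeasure (\<alpha> (s i)) X) = (\<Sum>i\<in>I. ennreal e * emeasure (\<alpha> i) X)"
      by (rule sum.reindex_bij_betw[OF s])
    also have "emeasure (F None) (X \<times> UNIV) + \<dots> = emeasure \<gamma> (X \<times> UNIV)"
      unfolding em\<alpha>[OF X] emF0[OF XU] by (rule split[OF XU])
    also have "\<dots> = emeasure (distr \<gamma> borel fst) X"
      using X fst_mg by (subst emeasure_distr) (auto simp: space vimage_fst)
    finally show "emeasure (distr \<gamma>' borel fst) X = emeasure (distr \<gamma> borel fst) X" .
  qed simp
  have marg2: "distr \<gamma>' borel snd = distr \<gamma> borel snd"
  proof (rule measure_eqI)
    fix X assume "X \<in> sets (distr \<gamma>' borel snd)"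
    then have X: "X \<in> sets borel" by simp
    then have XU: "UNIV \<times> X \<in> sets borel" by (intro borel_Times) auto
    have "emeasure (distr \<gamma>' borel snd) X = emeasure \<gamma>' (UNIV \<times> X)"
      using X fst_m' by (subst emeasure_distr) (auto simp: sp\<gamma>' vimage_snd)
    also have "\<dots> = emeasure (F None) (UNIV \<times> X) + (\<Sum>i\<in>I. ennreal e * emeasure (\<beta> i) X)"
      unfolding em\<gamma>'[OF XU] using emF[OF _ space_in_borel X] ab1(1) sI by simp
    also have "\<dots> = emeasure \<gamma> (UNIV \<times> X)"
      unfolding em\<beta>[OF X] emF0[OF XU] by (rule split[OF XU])
    also have "\<dots> = emeasure (distr \<gamma> borel snd) X"
      using X fst_mg by (subst emeasure_distr) (auto simp: space vimage_snd)
    finally show "emeasure (distr \<gamma>' borel snd) X = emeasure (distr \<gamma> borel snd) X" .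
  qed simp
  obtain RA RB where RAB: "\<And>x. x \<in> A \<Longrightarrow> norm x \<le> RA" "\<And>y. y \<in> B \<Longrightarrow> norm y \<le> RB" "RA > 0" "RB > 0"
    using AB(3,4) by (metis bounded_pos)
  have cbound: "\<bar>c x\<bar> \<le> RA * RB" for x
  proof (cases "x \<in> A \<times> B")
    case True
    then have "\<bar>fst x \<bullet> snd x\<bar> \<le> norm (fst x) * norm (snd x)" by (simp add: Cauchy_Schwarz_ineq2)
    also have "\<dots> \<le> RA * RB" using True RAB by (intro mult_mono) auto
    finally show ?thesis using True by (simp add: c_def)
  qed (use RAB in \<open>simp add: c_def\<close>)
  have ABb: "A \<times> B \<in> sets borel" using AB by (intro borel_Times)
  have cm: "c \<in> borel_measurable borel"
    unfolding c_def using ABb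
    by (intro borel_measurable_times borel_measurable_indicator borel_measurable_continuous_onI continuous_intros)
  have cint: "integrable P c" if "sets P = sets borel" "finite_measure P" for P
  proof -
    have "c \<in> borel_measurable P" using cm by (subst measurable_cong_sets[OF that(1) refl])
    then show ?thesis using cbound that(2) by (intro finite_measure.integrable_const_bound[where B = "RA * RB"]) auto
  qed
  have conc_k: "emeasure (k i) (- (W i \<inter> A \<times> B)) = 0" if "i \<in> I" for i
  proof -
    have P: "- (W i \<inter> A \<times> B) \<in> sets borel" using ABb Wb by auto
    have "AE x in \<gamma>. x \<in> A \<times> B"
      using conc ABb sets by (intro AE_I'[of "- (A \<times> B)"]) (auto simp: null_sets_def)
    then have "AE x in \<gamma>. ennreal (d i x) * indicator (- (W i \<inter> A \<times> B)) x = 0"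
      by eventually_elim (auto simp: d_def indicator_def)
    then show ?thesis unfolding emk[OF P] using P
      by (subst nn_integral_0_iff_AE) (auto intro!: meas)
  qed
  have conc_\<alpha>: "emeasure (\<alpha> i) (- (ball (fst (z i)) r \<inter> A)) = 0" if "i \<in> I" for i
  proof -
    have X: "- (ball (fst (z i)) r \<inter> A) \<in> sets borel" using AB(1) by auto
    have "emeasure (k i) ((- (ball (fst (z i)) r \<inter> A)) \<times> UNIV) \<le> emeasure (k i) (- (W i \<inter> A \<times> B))"
      using ABb Wb sk by (intro emeasure_mono) (auto simp: W_def)
    then show ?thesis using conc_k[OF that] em\<alpha>[OF X] by simp
  qed
  have conc_\<beta>: "emeasure (\<beta> i) (- (ball (snd (z i)) r \<inter> B)) = 0" if "i \<in> I" for i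
  proof -
    have X: "- (ball (snd (z i)) r \<inter> B) \<in> sets borel" using AB(2) by auto
    have "emeasure (k i) (UNIV \<times> (- (ball (snd (z i)) r \<inter> B))) \<le> emeasure (k i) (- (W i \<inter> A \<times> B))"
      using ABb Wb sk by (intro emeasure_mono) (auto simp: W_def)
    then show ?thesis using conc_k[OF that] em\<beta>[OF X] by simp
  qed
  have int_k: "(\<integral>x. c x \<partial>k i) \<le> fst (z i) \<bullet> snd (z i) + \<eta>" if i: "i \<in> I" for i
  proof -
    interpret fk: finite_measure "k i" by (rule finab(3)[OF i])
    have "AE x in k i. x \<in> W i \<inter> A \<times> B"
      using conc_k[OF i] ABb Wb sk by (intro AE_I'[of "- (W i \<inter> A \<times> B)"]) (auto simp: null_sets_def)
    then have "AE x in k i. c x \<le> fst (z i) \<bullet> snd (z i) + \<eta>"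
    proof eventually_elim
      case (elim x)
      then show ?case using near[OF i i, of "fst x" "snd x"] by (auto simp: W_def c_def)
    qed
    then have "(\<integral>x. c x \<partial>k i) \<le> (\<integral>x. fst (z i) \<bullet> snd (z i) + \<eta> \<partial>k i)"
      by (intro integral_mono_AE cint sk finab(3) i fk.integrable_const)
    also have "\<dots> = fst (z i) \<bullet> snd (z i) + \<eta>"
      using kU[OF i] by (simp add: spk measure_def)
    finally show ?thesis .
  qed
  have int_ab: "(\<integral>x. c x \<partial>(\<alpha> (s i) \<Otimes>\<^sub>M \<beta> i)) \<ge> fst (z (s i)) \<bullet> snd (z i) - \<eta>" if i: "i \<in> I" for i
  proof -
    let ?P = "\<alpha> (s i) \<Otimes>\<^sub>M \<beta> i"
    let ?X = "ball (fst (z (s i))) r \<inter> A" and ?Y = "ball (snd (z i)) r \<inter> B"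
    have P1: "emeasure ?P UNIV = 1"
      using emab[OF i space_in_borel space_in_borel] ab1[OF i] ab1[OF sI[OF i]] by simp
    have spP: "space ?P = UNIV" using sets_eq_imp_space_eq[OF sab] by simp
    interpret fP: finite_measure ?P using P1 spP by (intro finite_measureI) simp
    have b: "- ?X \<in> sets borel" "- ?Y \<in> sets borel" using AB by auto
    have "emeasure ?P ((- ?X) \<times> UNIV) = 0" "emeasure ?P (UNIV \<times> (- ?Y)) = 0"
      using emab[OF i b(1) space_in_borel] emab[OF i space_in_borel b(2)] conc_\<alpha>[OF sI[OF i]] conc_\<beta>[OF i] by simp_all
    then have null: "(- ?X) \<times> UNIV \<in> null_sets ?P" "UNIV \<times> (- ?Y) \<in> null_sets ?P"
      using b sab by (auto simp: null_sets_def intro!: borel_Times)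
    have "AE x in ?P. x \<in> ?X \<times> ?Y"
      by (rule AE_I'[OF null_sets.Un[OF null]]) auto
    then have "AE x in ?P. fst (z (s i)) \<bullet> snd (z i) - \<eta> \<le> c x"
    proof eventually_elim
      case (elim x)
      then show ?case using near[OF i sI[OF i], of "fst x" "snd x"] by (auto simp: c_def)
    qed
    then have "(\<integral>x. fst (z (s i)) \<bullet> snd (z i) - \<eta> \<partial>?P) \<le> (\<integral>x. c x \<partial>?P)"
      by (intro integral_mono_AE cint sab fP.integrable_const) (rule fP.finite_measure_axioms)
    then show ?thesis using P1 spP by (simp add: measure_def)
  qed
  have ck: "(\<integral>x. c x \<partial>k i) = (\<integral>x. d i x * c x \<partial>\<gamma>)" for i
    unfolding k_def using d0 cm by (subst integral_density) (auto intro!: meas)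
  have dint: "integrable \<gamma> (\<lambda>x. d i x * c x)" if "i \<in> I" for i
    using cint[OF sk finab(3)[OF that]] d0 cm unfolding k_def
    by (subst (asm) integrable_density) (auto intro!: meas)
  have "(\<integral>x. c x \<partial>F None) = (\<integral>x. w x * c x \<partial>\<gamma>)"
    unfolding F_def option.case using w0 cm by (subst integral_density) (auto intro!: meas)
  also have "\<dots> = (\<integral>x. c x - (\<Sum>i\<in>I. e * (d i x * c x)) \<partial>\<gamma>)"
    by (intro Bochner_Integration.integral_cong refl) (simp add: w_def left_diff_distrib sum_distrib_right mult.assoc)
  also have "\<dots> = (\<integral>x. c x \<partial>\<gamma>) - (\<Sum>i\<in>I. e * (\<integral>x. c x \<partial>k i))"
    using dint cint[OF sets fin] by (subst Bochner_Integration.integral_diff) (auto simp: ck)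
  finally have F0: "(\<integral>x. c x \<partial>F None) = (\<integral>x. c x \<partial>\<gamma>) - (\<Sum>i\<in>I. e * (\<integral>x. c x \<partial>k i))" .
  have F1: "(\<integral>x. c x \<partial>F (Some i)) = e * (\<integral>x. c x \<partial>(\<alpha> (s i) \<Otimes>\<^sub>M \<beta> i))" for i
  proof -
    have "c \<in> borel_measurable (\<alpha> (s i) \<Otimes>\<^sub>M \<beta> i)" using cm by (subst measurable_cong_sets[OF sab refl])
    then show ?thesis unfolding F_def option.case using e(1) by (subst integral_density) auto
  qed
  have "(\<integral>x. c x \<partial>\<gamma>') = (\<integral>x. c x \<partial>F None) + (\<Sum>i\<in>I. \<integral>x. c x \<partial>F (Some i))"
    unfolding \<gamma>'_def using integral_sum_measure[of Q F, OF sF finF finQ cm cbound]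
    by (simp add: sumQ[of "\<lambda>q. \<integral>x. c x \<partial>F q"])
  also have "\<dots> = (\<integral>x. c x \<partial>\<gamma>) + e * (\<Sum>i\<in>I. (\<integral>x. c x \<partial>(\<alpha> (s i) \<Otimes>\<^sub>M \<beta> i)) - (\<integral>x. c x \<partial>k i))"
    unfolding F0 F1 by (simp add: sum_distrib_left[symmetric] sum_subtractf right_diff_distrib)
  also have "\<dots> \<ge> (\<integral>x. c x \<partial>\<gamma>) + e * (\<Sum>i\<in>I. (fst (z (s i)) \<bullet> snd (z i) - fst (z i) \<bullet> snd (z i)) - 2 * \<eta>)"
    using e(1) int_k int_ab by (intro add_left_mono mult_left_mono sum_mono) fastforce+
  also have "(\<Sum>i\<in>I. (fst (z (s i)) \<bullet> snd (z i) - fst (z i) \<bullet> snd (z i)) - 2 * \<eta>) = \<delta> / 2"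
    using card0 by (simp add: sum_subtractf \<delta>_def[symmetric] \<eta>_def) (simp add: \<delta>_def sum_subtractf field_simps)
  finally have "(\<integral>x. c x \<partial>\<gamma>) + e * (\<delta> / 2) \<le> (\<integral>x. c x \<partial>\<gamma>')" .
  moreover have "(\<integral>x. c x \<partial>\<gamma>') \<le> (\<integral>x. c x \<partial>\<gamma>)"
    using opt[OF s\<gamma>' marg1 marg2] by (simp add: c_def)
  moreover have "e * (\<delta> / 2) > 0" using e(1) \<delta> by simp
  ultimately show False by simp
qed

section \<open>The contact set and the Monge-Ampere measure\<close>

text \<open>One step of the Hahn-Banach argument: convexity and nonnegativity on the hyperplane keep
  every quotient from the negative side below every quotient from the positive side, and s is the
  supremum of the former. This turns a subgradient along a facet into one on the whole
  space.\<close>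

lemma convex_minorant_extends:
  fixes g :: "'a::real_inner \<Rightarrow> real"
  assumes g: "convex_on UNIV g" and u: "u \<noteq> 0" and nonneg: "\<And>x. u \<bullet> x = 0 \<Longrightarrow> 0 \<le> g x"
  obtains s where "\<And>x. s * (u \<bullet> x) \<le> g x"
proof -
  have *: "g y / (u \<bullet> y) \<le> g x / (u \<bullet> x)" if xy: "u \<bullet> y < 0" "u \<bullet> x > 0" for x y
  proof -
    \<comment> \<open>The weight for which the combination of x and y falls on the
      hyperplane.\<close>
    define q where "q = (u \<bullet> x) / (u \<bullet> x - u \<bullet> y)"
    have q: "0 \<le> q" "q \<le> 1" using xy by (auto simp: q_def divide_le_eq)
    have den: "u \<bullet> x - u \<bullet> y > 0" using xy by simp
    have "u \<bullet> ((1 - q) *\<^sub>R x + q *\<^sub>R y) = u \<bullet> x - q * (u \<bullet> x - u \<bullet> y)"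
      by (simp add: inner_add_right algebra_simps)
    then have "u \<bullet> ((1 - q) *\<^sub>R x + q *\<^sub>R y) = 0" using den by (simp add: q_def)
    then have "0 \<le> g ((1 - q) *\<^sub>R x + q *\<^sub>R y)" by (rule nonneg)
    also have "\<dots> \<le> (1 - q) * g x + q * g y" using q by (intro convex_onD[OF g]) auto
    finally have "0 \<le> (u \<bullet> x - u \<bullet> y) * ((1 - q) * g x + q * g y)" using den by simp
    also have "\<dots> = ((u \<bullet> x - u \<bullet> y) - q * (u \<bullet> x - u \<bullet> y)) * g x + (q * (u \<bullet> x - u \<bullet> y)) * g y"
      by (simp add: algebra_simps)
    also have "q * (u \<bullet> x - u \<bullet> y) = u \<bullet> x" using den by (simp add: q_def)
    finally have "0 \<le> (u \<bullet> x) * g y - (u \<bullet> y) * g x" by simp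
    then show ?thesis using xy by (simp add: field_simps)
  qed
  define s where "s = (SUP y\<in>{y. u \<bullet> y < 0}. g y / (u \<bullet> y))"
  have uu: "u \<bullet> u > 0" using u by simp
  then have ne: "{y. u \<bullet> y < 0} \<noteq> {}" by (intro ex_in_conv[THEN iffD1] exI[of _ "- u"]) simp
  have bdd: "bdd_above ((\<lambda>y. g y / (u \<bullet> y)) ` {y. u \<bullet> y < 0})"
    using *[OF _ uu] by (intro bdd_aboveI2) auto
  show thesis
  proof (rule that[of s])
    fix x
    consider "u \<bullet> x = 0" | "u \<bullet> x > 0" | "u \<bullet> x < 0" by linarith
    then show "s * (u \<bullet> x) \<le> g x"
    proof cases
      case 2
      have "s \<le> g x / (u \<bullet> x)" unfolding s_def using * 2 by (intro cSUP_least[OF ne]) auto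
      then show ?thesis using 2 by (simp add: pos_le_divide_eq)
    next
      case 3
      then have "g x / (u \<bullet> x) \<le> s" unfolding s_def by (intro cSUP_upper bdd) simp
      then show ?thesis using 3 by (simp add: neg_divide_le_eq)
    qed (use nonneg in simp)
  qed
qed

text \<open>The epigraph is separated from the open vertical ray below the graph at x; the slope of
  the separating hyperplane is the subgradient once the hyperplane is known not to be
  vertical.\<close>

lemma convex_subgradient_exists:
  fixes f :: "'a::euclidean_space \<Rightarrow> real"
  assumes f: "convex_on UNIV f"
  obtains p where "\<And>y. f x + p \<bullet> (y - x) \<le> f y"
proof -
  let ?S = "epigraph UNIV f" and ?T = "{x} \<times> {..<f x}"
  have "convex ?S" using f by (simp add: convex_epigraph)
  moreover have "convex ?T" by (intro convex_Times) auto
  moreover have "(x, f x) \<in> ?S" "(x, f x - 1) \<in> ?T" "?S \<inter> ?T = {}" by (auto simp: epigraph_def)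
  ultimately obtain a c where ac: "a \<noteq> 0" "\<forall>z\<in>?S. a \<bullet> z \<le> c" "\<forall>z\<in>?T. c \<le> a \<bullet> z"
    using separating_hyperplane_sets[of ?S ?T] by (metis empty_iff)
  obtain p q where a: "a = (p, q)" by (cases a)
  have S: "p \<bullet> y + q * t \<le> c" if "f y \<le> t" for y t using ac(2) that by (auto simp: a epigraph_def)
  have T: "c \<le> p \<bullet> x + q * t" if "t < f x" for t using ac(3) that by (auto simp: a)
  have q0: "q \<le> 0"
    using S[of x "f x"] T[of "f x - 1"] by (simp add: algebra_simps)
  \<comment> \<open>Since f is finite everywhere, a vertical hyperplane would bound the functional p
    on the whole space.\<close>
  have "q \<noteq> 0"
  proof
    assume q: "q = 0"
    have "p \<bullet> (x + p) \<le> p \<bullet> x" using S[of "x + p" "f (x + p)"] T[of "f x - 1"] q by simp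
    then have "p \<bullet> p \<le> 0" by (simp add: inner_add_right)
    then have "p = 0" using inner_ge_zero[of p] by (metis antisym inner_eq_zero_iff)
    then show False using ac(1) a q by (simp add: zero_prod_def)
  qed
  with q0 have q: "q < 0" by simp
  have c: "c \<le> p \<bullet> x + q * f x"
  proof (rule field_le_epsilon)
    fix e :: real assume "e > 0"
    then have "c \<le> p \<bullet> x + q * (f x - e / (- q))" using q by (intro T) (simp add: divide_pos_neg)
    then show "c \<le> p \<bullet> x + q * f x + e" using q by (simp add: algebra_simps)
  qed
  show thesis
  proof (rule that[of "(1 / - q) *\<^sub>R p"])
    fix y
    have "p \<bullet> y + q * f y \<le> p \<bullet> x + q * f x" using S[of y "f y"] c by simp
    then have "p \<bullet> (y - x) \<le> (- q) * (f y - f x)" by (simp add: inner_diff_right algebra_simps)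
    then have "p \<bullet> (y - x) / (- q) \<le> f y - f x" 
      by (subst pos_divide_le_eq) (use q in \<open>simp_all add: mult.commute\<close>)
    then show "f x + ((1 / - q) *\<^sub>R p) \<bullet> (y - x) \<le> f y" by simp
  qed
qed

context tropical_reflexive
begin

lemma P_class_bound:
  assumes "\<Psi> \<in> P_class \<Delta>"
  obtains C where "\<And>n. \<bar>\<Psi> n - (SUP m\<in>L. m \<bullet> n)\<bar> \<le> C"
  using assms by (auto simp: P_class_def bdd_above_def)

lemma P_class_convex: "\<Psi> \<in> P_class \<Delta> \<Longrightarrow> convex_on UNIV \<Psi>"
  by (simp add: P_class_def)

lemma P_class_continuous: "\<Psi> \<in> P_class \<Delta> \<Longrightarrow> continuous_on UNIV \<Psi>"
  using convex_on_continuous[OF open_UNIV P_class_convex] .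

text \<open>At t \<open>N \<sigma>\<close> the value of \<Psi> exceeds t by at most a constant, so
  an affine minorant has slope at most 1 in the direction \<open>N \<sigma>\<close>.\<close>

lemma global_subgradient_in_Delta:
  assumes \<Psi>: "\<Psi> \<in> P_class \<Delta>" and m: "\<And>y. \<Psi> n + m \<bullet> (y - n) \<le> \<Psi> y"
  shows "m \<in> \<Delta>"
  unfolding Delta_facet_ineqs
proof (intro allI impI)
  fix \<sigma> assume \<sigma>: "\<sigma> facet_of \<Delta>"
  obtain C where C: "\<And>n. \<bar>\<Psi> n - (SUP m\<in>L. m \<bullet> n)\<bar> \<le> C" using P_class_bound[OF \<Psi>] by blast
  have le: "t * (m \<bullet> N \<sigma>) \<le> t + (C + m \<bullet> n - \<Psi> n)" if t: "t > 0" for t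
  proof -
    have "(SUP m\<in>L. m \<bullet> (t *\<^sub>R N \<sigma>)) \<le> t"
    proof (rule cSUP_least)
      show "L \<noteq> {}" using zero_in_L by blast
      fix m assume "m \<in> L"
      then have "m \<bullet> N \<sigma> \<le> 1" using facet_Delta(3)[OF \<sigma>] by blast
      then show "m \<bullet> (t *\<^sub>R N \<sigma>) \<le> t" using t by simp
    qed
    then have "\<Psi> (t *\<^sub>R N \<sigma>) \<le> t + C" using C[of "t *\<^sub>R N \<sigma>"] by linarith
    then show ?thesis using m[of "t *\<^sub>R N \<sigma>"] by (simp add: inner_diff_right)
  qed
  show "m \<bullet> N \<sigma> \<le> 1"
  proof (rule ccontr)
    assume "\<not> m \<bullet> N \<sigma> \<le> 1"
    then have pos: "m \<bullet> N \<sigma> - 1 > 0" by simp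
    define D where "D = \<bar>C + m \<bullet> n - \<Psi> n\<bar> + 1"
    have "D > 0" by (simp add: D_def)
    then have "(D / (m \<bullet> N \<sigma> - 1)) * (m \<bullet> N \<sigma> - 1) \<le> C + m \<bullet> n - \<Psi> n"
      using le[of "D / (m \<bullet> N \<sigma> - 1)"] pos by (simp add: right_diff_distrib)
    then have "D \<le> C + m \<bullet> n - \<Psi> n" using pos by simp
    then show False by (simp add: D_def)
  qed
qed

lemma B_nonempty: "B \<noteq> {}"
proof -
  have "K \<noteq> UNIV" using bounded_K by (metis not_bounded_UNIV)
  moreover have "K \<noteq> {}" using zero_interior_K interior_subset by blast
  ultimately show ?thesis using frontier_not_empty by blast
qed

definition \<Phi> :: "(real ^ 'n \<Rightarrow> real) \<Rightarrow> real ^ 'n \<Rightarrow> real" where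
  "\<Phi> \<Psi> m = (SUP n\<in>B. m \<bullet> n - \<Psi> n)"

definition contact :: "(real ^ 'n \<Rightarrow> real) \<Rightarrow> ((real ^ 'n) \<times> (real ^ 'n)) set" where
  "contact \<Psi> = {(m, n). m \<in> A \<and> n \<in> B \<and> \<Phi> \<Psi> m + \<Psi> n = m \<bullet> n}"

text \<open>The condition on n fixes \<tau>, as relative interiors of distinct facets are disjoint;
  the condition on m then selects at most one point from each line in direction
  \<open>mt \<tau>\<close>.\<close>

definition stable_contact :: "(real ^ 'n \<Rightarrow> real) \<Rightarrow> ((real ^ 'n) \<times> (real ^ 'n)) set" where
  "stable_contact \<Psi> = {(m, n) \<in> contact \<Psi>. \<exists>\<tau>. \<tau> facet_of K \<and> n \<in> rel_interior \<tau> \<and> m \<in> St \<Delta> (mt \<tau>)}"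

context
  fixes \<Psi> :: "real ^ 'n \<Rightarrow> real" assumes cont: "continuous_on UNIV \<Psi>"
begin

lemma Phi_bdd: "bdd_above ((\<lambda>n. m \<bullet> n - \<Psi> n) ` B)"
  by (intro compact_imp_bounded[THEN bounded_imp_bdd_above] compact_continuous_image compact_B
      continuous_intros continuous_on_subset[OF cont]) auto

lemma Phi_ge: "n \<in> B \<Longrightarrow> m \<bullet> n \<le> \<Phi> \<Psi> m + \<Psi> n"
  using cSUP_upper[OF _ Phi_bdd, of n m] by (simp add: \<Phi>_def algebra_simps)

lemma Phi_le: "(\<And>n. n \<in> B \<Longrightarrow> m \<bullet> n - \<Psi> n \<le> c) \<Longrightarrow> \<Phi> \<Psi> m \<le> c"
  unfolding \<Phi>_def by (intro cSUP_least B_nonempty)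

text \<open>A supremum of affine functions with slopes in the bounded set B is Lipschitz.\<close>

lemma continuous_Phi: "continuous_on UNIV (\<Phi> \<Psi>)"
proof -
  obtain R where R: "R > 0" "\<And>n. n \<in> B \<Longrightarrow> norm n \<le> R"
    using compact_imp_bounded[OF compact_B] by (metis bounded_pos)
  have le: "\<Phi> \<Psi> m \<le> \<Phi> \<Psi> m' + R * norm (m - m')" for m m'
  proof (rule Phi_le)
    fix n assume n: "n \<in> B"
    have "(m - m') \<bullet> n \<le> norm (m - m') * norm n" by (rule norm_cauchy_schwarz)
    also have "\<dots> \<le> norm (m - m') * R" using R(2)[OF n] by (intro mult_left_mono) auto
    finally show "m \<bullet> n - \<Psi> n \<le> \<Phi> \<Psi> m' + R * norm (m - m')"
      using Phi_ge[OF n, of m'] by (simp add: inner_diff_left mult.commute)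
  qed
  have "R-lipschitz_on UNIV (\<Phi> \<Psi>)"
  proof (rule lipschitz_onI)
    fix m m'
    show "dist (\<Phi> \<Psi> m) (\<Phi> \<Psi> m') \<le> R * dist m m'"
      using le[of m m'] le[of m' m] by (auto simp: dist_norm norm_minus_commute abs_le_iff)
  qed (use R in simp)
  then show ?thesis by (rule lipschitz_on_continuous_on)
qed

lemma contactI:
  assumes "m \<in> A" "n \<in> B" "\<And>n'. n' \<in> B \<Longrightarrow> \<Psi> n + m \<bullet> (n' - n) \<le> \<Psi> n'"
  shows "(m, n) \<in> contact \<Psi>"
proof -
  have "\<Phi> \<Psi> m \<le> m \<bullet> n - \<Psi> n"
    using assms(3) by (intro Phi_le) (force simp: inner_diff_right)
  then show ?thesis using Phi_ge[OF assms(2), of m] assms by (simp add: contact_def)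
qed

lemma contactD: "(m, n) \<in> contact \<Psi> \<Longrightarrow> n' \<in> B \<Longrightarrow> \<Psi> n + m \<bullet> (n' - n) \<le> \<Psi> n'"
  using Phi_ge[of n' m] by (auto simp: contact_def inner_diff_right)

lemma contact_monotone:
  assumes "(m, n) \<in> contact \<Psi>" "(m', n') \<in> contact \<Psi>"
  shows "0 \<le> (m - m') \<bullet> (n - n')"
proof -
  have nB: "n \<in> B" "n' \<in> B" using assms by (auto simp: contact_def)
  show ?thesis using contactD[OF assms(1) nB(2)] contactD[OF assms(2) nB(1)]
    by (simp add: inner_diff_left inner_diff_right)
qed

lemma compact_contact: "compact (contact \<Psi>)"
proof -
  have "contact \<Psi> = (A \<times> B) \<inter> {z. \<Phi> \<Psi> (fst z) + \<Psi> (snd z) - fst z \<bullet> snd z = 0}"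
    by (auto simp: contact_def)
  moreover have "continuous_on UNIV (\<lambda>z. \<Phi> \<Psi> (fst z) + \<Psi> (snd z) - fst z \<bullet> snd z)"
    by (intro continuous_intros continuous_on_compose2[OF continuous_Phi] continuous_on_compose2[OF cont]) auto
  then have "closed {z. \<Phi> \<Psi> (fst z) + \<Psi> (snd z) - fst z \<bullet> snd z = 0}"
    by (rule closed_Collect_eq[OF _ continuous_on_const])
  then have "compact ((A \<times> B) \<inter> {z. \<Phi> \<Psi> (fst z) + \<Psi> (snd z) - fst z \<bullet> snd z = 0})"
    by (rule compact_Int_closed[OF compact_Times[OF compact_A compact_B]])
  ultimately show ?thesis by simp
qed

lemma stable_contactD:
  assumes "(m, n) \<in> stable_contact \<Psi>" "\<tau> facet_of K" "n \<in> rel_interior \<tau>"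
  shows "m \<in> St \<Delta> (mt \<tau>)" "(m, n) \<in> contact \<Psi>"
proof -
  obtain \<tau>' where t: "\<tau>' facet_of K" "n \<in> rel_interior \<tau>'" "m \<in> St \<Delta> (mt \<tau>')"
    using assms(1) by (auto simp: stable_contact_def)
  have "\<tau> = \<tau>'"
    by (rule facet_of_unique[OF assms(2) t(1) assms(3) subsetD[OF rel_interior_subset t(2)] convex_K])
  then show "m \<in> St \<Delta> (mt \<tau>)" using t by simp
  show "(m, n) \<in> contact \<Psi>" using assms(1) by (auto simp: stable_contact_def)
qed

end

section \<open>Facet subgradients and contact points\<close>

lemma subgradient_lifts_to_contact:
  assumes \<Psi>: "\<Psi> \<in> P_class \<Delta>" and m: "\<And>y. \<Psi> n + m \<bullet> (y - n) \<le> \<Psi> y"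
    and \<tau>: "\<tau> facet_of K" "n \<in> rel_interior \<tau>"
  obtains t where "(m + t *\<^sub>R mt \<tau>, n) \<in> stable_contact \<Psi>"
proof -
  let ?u = "mt \<tau>"
  have n\<tau>: "n \<in> \<tau>" using \<tau>(2) rel_interior_subset by blast
  have nB: "n \<in> B" using B_eq_facets \<tau>(1) n\<tau> by blast
  obtain t where t: "t \<ge> 0" "m + t *\<^sub>R ?u \<in> St \<Delta> ?u"
    by (rule ray_exits_in_St[OF facet_K(1,2)[OF \<tau>(1)] global_subgradient_in_Delta[OF \<Psi> m]])
  have "(m + t *\<^sub>R ?u, n) \<in> contact \<Psi>"
  proof (rule contactI[OF P_class_continuous[OF \<Psi>] _ nB])
    show "m + t *\<^sub>R ?u \<in> A" using t(2) St_subset_A by blast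
    fix n' assume "n' \<in> B"
    then have "n' \<in> K" using B_subset_K by blast
    \<comment> \<open>n maximises the pairing with \<open>mt \<tau>\<close> over \<open>K\<close>,
      so adding a nonnegative multiple of \<open>mt \<tau>\<close> to the slope only lowers the
      affine minorant on B.\<close>
    then have "?u \<bullet> n' \<le> ?u \<bullet> n" using K_ineq[OF _ facet_K(1)[OF \<tau>(1)]] facet_K_inner[OF \<tau>(1) n\<tau>] by simp
    then have "t * (?u \<bullet> (n' - n)) \<le> 0" using t(1) by (simp add: inner_diff_right mult_nonneg_nonpos)
    then show "\<Psi> n + (m + t *\<^sub>R ?u) \<bullet> (n' - n) \<le> \<Psi> n'" using m[of n'] by (simp add: inner_add_left)
  qed
  then have "(m + t *\<^sub>R ?u, n) \<in> stable_contact \<Psi>" using t(2) \<tau> by (auto simp: stable_contact_def)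
  then show thesis by (rule that)
qed

lemma stable_contact_exists:
  assumes \<Psi>: "\<Psi> \<in> P_class \<Delta>" and \<tau>: "\<tau> facet_of K" "n \<in> rel_interior \<tau>"
  obtains m where "(m, n) \<in> stable_contact \<Psi>"
proof -
  obtain p where p: "\<And>y. \<Psi> n + p \<bullet> (y - n) \<le> \<Psi> y"
    by (rule convex_subgradient_exists[OF P_class_convex[OF \<Psi>], of n]) blast
  obtain t where "(p + t *\<^sub>R mt \<tau>, n) \<in> stable_contact \<Psi>"
    by (rule subgradient_lifts_to_contact[OF \<Psi> p \<tau>])
  then show thesis by (rule that)
qed

text \<open>The vectors \<open>b \<sigma> i\<close> together with \<open>mt \<tau>\<close> span the
  space, and the pairing with \<open>mt \<tau>\<close> is constant on the facet.\<close>

lemma inj_on_beta: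
  assumes \<tau>: "\<tau> facet_of K" and \<sigma>: "\<sigma> facet_of \<Delta>" "mt \<tau> \<in> \<sigma>"
  shows "inj_on (beta (b \<sigma>)) \<tau>"
proof (rule inj_onI)
  fix n n' assume n: "n \<in> \<tau>" "n' \<in> \<tau>" "beta (b \<sigma>) n = beta (b \<sigma>) n'"
  have "x \<bullet> (n - n') = 0" for x
  proof -
    have "x = J \<sigma> (crd \<sigma> (mt \<tau>) x) + (x \<bullet> N \<sigma>) *\<^sub>R mt \<tau>" using J_crd[OF \<sigma>(1) facet_inner[OF \<sigma>]] by simp
    moreover have "J \<sigma> p \<bullet> (n - n') = 0" for p using n(3) by (simp add: inner_diff_right inner_basis_map)
    moreover have "mt \<tau> \<bullet> (n - n') = 0" using facet_K_inner[OF \<tau>] n by (simp add: inner_diff_right)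
    ultimately show ?thesis by (metis add.right_neutral inner_add_left inner_scaleR_left mult_zero_right)
  qed
  then have "(n - n') \<bullet> (n - n') = 0" by blast
  then show "n = n'" by simp
qed

lemma facet_subgradient_iff:
  assumes \<tau>: "\<tau> facet_of K" and \<sigma>: "\<sigma> facet_of \<Delta>" "mt \<tau> \<in> \<sigma>" and n: "n \<in> rel_interior \<tau>"
  shows "p \<in> subgradient (beta (b \<sigma>) ` rel_interior \<tau>) (\<Psi> \<circ> inv_into (rel_interior \<tau>) (beta (b \<sigma>))) (beta (b \<sigma>) n)
    \<longleftrightarrow> (\<forall>n'\<in>rel_interior \<tau>. \<Psi> n + J \<sigma> p \<bullet> (n' - n) \<le> \<Psi> n')"
proof -
  have "inj_on (beta (b \<sigma>)) (rel_interior \<tau>)" by (rule inj_on_subset[OF inj_on_beta[OF \<tau> \<sigma>] rel_interior_subset])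
  then have "inv_into (rel_interior \<tau>) (beta (b \<sigma>)) (beta (b \<sigma>) n') = n'" if "n' \<in> rel_interior \<tau>" for n'
    using that by simp
  moreover have "J \<sigma> p \<bullet> (n' - n) = p \<bullet> (beta (b \<sigma>) n' - beta (b \<sigma>) n)" for n'
    by (simp add: inner_diff_right inner_basis_map)
  ultimately show ?thesis using n by (simp add: subgradient_def)
qed

text \<open>A short step from n stays in \<open>rel_interior \<tau>\<close>, and convexity along the
  segment carries the inequality from the short step to the full one.\<close>

lemma facet_subgradient_nonneg:
  assumes \<Psi>: "convex_on UNIV \<Psi>" and \<tau>: "\<tau> facet_of K" "n \<in> rel_interior \<tau>"
    and p: "\<And>n'. n' \<in> rel_interior \<tau> \<Longrightarrow> \<Psi> n + q \<bullet> (n' - n) \<le> \<Psi> n'"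
    and x: "mt \<tau> \<bullet> x = 0"
  shows "\<Psi> n + q \<bullet> x \<le> \<Psi> (n + x)"
proof -
  have n\<tau>: "n \<in> \<tau>" using \<tau>(2) rel_interior_subset by blast
  have aff: "affine hull \<tau> = {y. mt \<tau> \<bullet> y = h (mt \<tau>)}"
  proof (rule facet_affine_hull_eq_hyperplane[OF _ \<tau>(1)])
    show "interior K \<noteq> {}" using zero_interior_K by blast
    show "mt \<tau> \<noteq> 0" by (rule facet_K(2)[OF \<tau>(1)])
    show "\<tau> \<subseteq> {y. mt \<tau> \<bullet> y = h (mt \<tau>)}" using facet_K_inner[OF \<tau>(1)] by blast
  qed
  obtain T where T: "open T" "rel_interior \<tau> = affine hull \<tau> \<inter> T"
    using openin_rel_interior[of \<tau>] by (auto simp: openin_open)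
  then have "n \<in> T" using \<tau>(2) by blast
  then obtain e where e: "e > 0" "ball n e \<subseteq> T" using T(1) open_contains_ball by blast
  \<comment> \<open>The factor 2 keeps the step strictly inside the ball; the summand 1 keeps the
    denominator positive when x = 0.\<close>
  define t where "t = min 1 (e / (2 * (norm x + 1)))"
  have t: "t > 0" "t \<le> 1" using e(1) by (auto simp: t_def divide_pos_pos add_nonneg_pos)
  have "norm (t *\<^sub>R x) < e"
  proof -
    have "t * norm x \<le> e / (2 * (norm x + 1)) * (norm x + 1)"
      using e(1) by (intro mult_mono) (auto simp: t_def)
    also have "\<dots> = e / 2"
    proof -
      have "2 * norm x + 2 \<noteq> 0" using norm_ge_zero[of x] by linarith
      then show ?thesis by (simp add: field_simps)
    qed
    finally show ?thesis using t(1) e(1) by simp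
  qed
  then have "n + t *\<^sub>R x \<in> T" using e(2) by (intro subsetD[OF e(2)]) (simp add: dist_norm)
  moreover have "n + t *\<^sub>R x \<in> affine hull \<tau>" unfolding aff using x facet_K_inner[OF \<tau>(1) n\<tau>] by (simp add: inner_add_right)
  ultimately have "n + t *\<^sub>R x \<in> rel_interior \<tau>" using T(2) by blast
  then have "\<Psi> n + t * (q \<bullet> x) \<le> \<Psi> (n + t *\<^sub>R x)" using p by fastforce
  also have "\<Psi> (n + t *\<^sub>R x) = \<Psi> ((1 - t) *\<^sub>R n + t *\<^sub>R (n + x))" by (simp add: algebra_simps)
  also have "\<dots> \<le> (1 - t) * \<Psi> n + t * \<Psi> (n + x)" using t by (intro convex_onD[OF \<Psi>]) auto
  finally have "t * (\<Psi> n + q \<bullet> x) \<le> t * \<Psi> (n + x)" by (simp add: algebra_simps)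
  then show ?thesis using t(1) by simp
qed

lemma subgradient_image_eq:
  assumes \<Psi>: "\<Psi> \<in> P_class \<Delta>" and \<tau>: "\<tau> facet_of K" and \<sigma>: "\<sigma> facet_of \<Delta>" "mt \<tau> \<in> \<sigma>"
    and E: "E \<subseteq> rel_interior \<tau>"
  shows "(\<Union>x \<in> beta (b \<sigma>) ` E. subgradient (beta (b \<sigma>) ` rel_interior \<tau>)
             (\<Psi> \<circ> inv_into (rel_interior \<tau>) (beta (b \<sigma>))) x)
    = crd \<sigma> (mt \<tau>) ` {m. \<exists>n\<in>E. (m, n) \<in> stable_contact \<Psi>}"
proof (intro equalityI subsetI)
  let ?u = "mt \<tau>"
  note uN = facet_inner[OF \<sigma>]
  fix p assume "p \<in> (\<Union>x \<in> beta (b \<sigma>) ` E. subgradient (beta (b \<sigma>) ` rel_interior \<tau>)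
             (\<Psi> \<circ> inv_into (rel_interior \<tau>) (beta (b \<sigma>))) x)"
  then obtain n where n: "n \<in> E" "p \<in> subgradient (beta (b \<sigma>) ` rel_interior \<tau>)
             (\<Psi> \<circ> inv_into (rel_interior \<tau>) (beta (b \<sigma>))) (beta (b \<sigma>) n)" by blast
  have nr: "n \<in> rel_interior \<tau>" using n(1) E by blast
  have p: "\<Psi> n + J \<sigma> p \<bullet> (n' - n) \<le> \<Psi> n'" if "n' \<in> rel_interior \<tau>" for n'
    using n(2) that unfolding facet_subgradient_iff[OF \<tau> \<sigma> nr] by blast
  \<comment> \<open>The excess of \<Psi> over the facet subgradient. It is nonnegative on the
    hyperplane orthogonal to \<open>mt \<tau>\<close>, so some multiple s of
    \<open>mt \<tau>\<close> corrects the slope to a global subgradient.\<close>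
  define g where "g x = \<Psi> (n + x) - \<Psi> n - J \<sigma> p \<bullet> x" for x
  have "convex_on UNIV g"
  proof (rule convex_onI)
    fix t :: real and x y assume t: "0 < t" "t < 1"
    have "\<Psi> (n + ((1 - t) *\<^sub>R x + t *\<^sub>R y)) = \<Psi> ((1 - t) *\<^sub>R (n + x) + t *\<^sub>R (n + y))"
      by (simp add: algebra_simps)
    also have "\<dots> \<le> (1 - t) * \<Psi> (n + x) + t * \<Psi> (n + y)"
      using t by (intro convex_onD[OF P_class_convex[OF \<Psi>]]) auto
    finally show "g ((1 - t) *\<^sub>R x + t *\<^sub>R y) \<le> (1 - t) * g x + t * g y"
      by (simp add: g_def inner_add_right algebra_simps)
  qed auto
  moreover have "0 \<le> g x" if "?u \<bullet> x = 0" for x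
    using facet_subgradient_nonneg[OF P_class_convex[OF \<Psi>] \<tau> nr p that] by (simp add: g_def)
  ultimately obtain s where s: "\<And>x. s * (?u \<bullet> x) \<le> g x"
    using convex_minorant_extends[of g ?u] facet_K(2)[OF \<tau>] by blast
  have "\<Psi> n + (J \<sigma> p + s *\<^sub>R ?u) \<bullet> (y - n) \<le> \<Psi> y" for y
    using s[of "y - n"] by (simp add: g_def inner_add_left)
  then obtain t where t: "(J \<sigma> p + s *\<^sub>R ?u + t *\<^sub>R ?u, n) \<in> stable_contact \<Psi>"
    using subgradient_lifts_to_contact[OF \<Psi> _ \<tau> nr] by blast
  have "p = crd \<sigma> ?u (J \<sigma> p + s *\<^sub>R ?u + t *\<^sub>R ?u)"
    by (rule crd_eqI[OF \<sigma>(1) uN, of _ _ "s + t", symmetric]) (simp add: scaleR_add_left)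
  then show "p \<in> crd \<sigma> ?u ` {m. \<exists>n\<in>E. (m, n) \<in> stable_contact \<Psi>}" using t n(1) by blast
next
  let ?u = "mt \<tau>"
  note uN = facet_inner[OF \<sigma>]
  fix p assume "p \<in> crd \<sigma> ?u ` {m. \<exists>n\<in>E. (m, n) \<in> stable_contact \<Psi>}"
  then obtain m n where mn: "p = crd \<sigma> ?u m" "n \<in> E" "(m, n) \<in> stable_contact \<Psi>" by blast
  have nr: "n \<in> rel_interior \<tau>" using mn(2) E by blast
  have G: "(m, n) \<in> contact \<Psi>" using mn(3) by (simp add: stable_contact_def)
  have "p \<in> subgradient (beta (b \<sigma>) ` rel_interior \<tau>) (\<Psi> \<circ> inv_into (rel_interior \<tau>) (beta (b \<sigma>))) (beta (b \<sigma>) n)"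
    unfolding facet_subgradient_iff[OF \<tau> \<sigma> nr]
  proof
    fix n' assume n': "n' \<in> rel_interior \<tau>"
    have in\<tau>: "n \<in> \<tau>" "n' \<in> \<tau>" using nr n' rel_interior_subset by blast+
    then have "?u \<bullet> (n' - n) = 0" using facet_K_inner[OF \<tau>] by (simp add: inner_diff_right)
    then have "J \<sigma> p \<bullet> (n' - n) = m \<bullet> (n' - n)"
      unfolding mn(1) J_crd[OF \<sigma>(1) uN] inner_diff_left inner_scaleR_left by simp
    moreover have "n' \<in> B" using B_eq_facets \<tau> in\<tau> by blast
    ultimately show "\<Psi> n + J \<sigma> p \<bullet> (n' - n) \<le> \<Psi> n'"
      using contactD[OF P_class_continuous[OF \<Psi>] G] by simp
  qed
  then show "p \<in> (\<Union>x \<in> beta (b \<sigma>) ` E. subgradient (beta (b \<sigma>) ` rel_interior \<tau>)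
             (\<Psi> \<circ> inv_into (rel_interior \<tau>) (beta (b \<sigma>))) x)" using mn(2) by blast
qed

section \<open>The transport map\<close>

text \<open>Weak inequalities make this an intersection of projections of compact sets, hence
  closed; rational thresholds leave only countably many such sets. Contact partners that differ only
  in the direction of \<open>N \<sigma>\<close> go undetected, since every
  \<open>b \<sigma> i\<close> is orthogonal to it.\<close>

definition spread :: "(real ^ 'n \<Rightarrow> real) \<Rightarrow> (real ^ 'n) set \<Rightarrow> 'd \<Rightarrow> rat \<times> rat \<Rightarrow> (real ^ 'n) set" where
  "spread \<Psi> \<sigma> i = (\<lambda>(q, r). \<sigma> \<inter> fst ` (contact \<Psi> \<inter> {z. b \<sigma> i \<bullet> snd z \<le> of_rat q})
      \<inter> fst ` (contact \<Psi> \<inter> {z. of_rat r \<le> b \<sigma> i \<bullet> snd z}))"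

definition ambiguous :: "(real ^ 'n \<Rightarrow> real) \<Rightarrow> (real ^ 'n) set" where
  "ambiguous \<Psi> = (\<Union>\<sigma>\<in>{\<sigma>. \<sigma> facet_of \<Delta>}. \<Union>i. \<Union>qr\<in>{(q, r). q < r}. spread \<Psi> \<sigma> i qr)"

text \<open>Full measure is not automatic; \<open>MA_eq_transport\<close> obtains it for solutions
  by comparing total masses.\<close>

definition transport_domain :: "(real ^ 'n \<Rightarrow> real) \<Rightarrow> (real ^ 'n) set" where
  "transport_domain \<Psi> = fst ` stable_contact \<Psi> - ambiguous \<Psi>"

text \<open>The value 0 off the domain is a placeholder; preimages are intersected with
  \<open>transport_domain\<close> as long as its complement may carry mass.\<close>

definition transport_map :: "(real ^ 'n \<Rightarrow> real) \<Rightarrow> real ^ 'n \<Rightarrow> real ^ 'n" where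
  "transport_map \<Psi> m = (if m \<in> transport_domain \<Psi> then (THE n. (m, n) \<in> stable_contact \<Psi>) else 0)"

lemma facet_of_Delta_closed: "\<sigma> facet_of \<Delta> \<Longrightarrow> closed \<sigma>"
  using face_of_imp_closed[OF convex_Delta closed_Delta facet_of_imp_face_of] .

context
  fixes \<Psi> :: "real ^ 'n \<Rightarrow> real" assumes cont: "continuous_on UNIV \<Psi>"
begin

lemma closed_spread:
  assumes "\<sigma> facet_of \<Delta>"
  shows "closed (spread \<Psi> \<sigma> i qr)"
proof -
  obtain q r where qr: "qr = (q, r)" by (cases qr)
  have c: "closed {z :: (real ^ 'n) \<times> (real ^ 'n). b \<sigma> i \<bullet> snd z \<le> of_rat q}"
    "closed {z :: (real ^ 'n) \<times> (real ^ 'n). of_rat r \<le> b \<sigma> i \<bullet> snd z}"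
    by (intro closed_Collect_le continuous_intros)+
  have proj: "closed (fst ` (contact \<Psi> \<inter> C))" if "closed C" for C
    by (intro compact_imp_closed compact_continuous_image compact_Int_closed[OF compact_contact[OF cont] that]
        continuous_intros)
  show ?thesis
    unfolding spread_def qr prod.case
    by (intro closed_Int facet_of_Delta_closed[OF assms] proj[OF c(1)] proj[OF c(2)])
qed

text \<open>By monotonicity of the contact set, such a set is disjoint from its translates along \<open>b \<sigma> i\<close>.\<close>

lemma spread_null:
  assumes \<sigma>: "\<sigma> facet_of \<Delta>" and qr: "q < r"
  shows "emeasure \<mu> (spread \<Psi> \<sigma> i (q, r)) = 0"
proof (rule mu_null_if_translates_disjoint[OF \<sigma> closed_spread[OF \<sigma>]])
  show "spread \<Psi> \<sigma> i (q, r) \<subseteq> \<sigma>" by (auto simp: spread_def)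
  fix m and t :: real assume m: "m \<in> spread \<Psi> \<sigma> i (q, r)" and t: "t > 0"
  show "m + t *\<^sub>R b \<sigma> i \<notin> spread \<Psi> \<sigma> i (q, r)"
  proof
    assume m': "m + t *\<^sub>R b \<sigma> i \<in> spread \<Psi> \<sigma> i (q, r)"
    obtain n where n: "(m + t *\<^sub>R b \<sigma> i, n) \<in> contact \<Psi>" "b \<sigma> i \<bullet> n \<le> of_rat q"
      using m' by (auto simp: spread_def)
    obtain n' where n': "(m, n') \<in> contact \<Psi>" "of_rat r \<le> b \<sigma> i \<bullet> n'" using m by (auto simp: spread_def)
    have "0 \<le> t * (b \<sigma> i \<bullet> (n - n'))" using contact_monotone[OF cont n(1) n'(1)] by simp
    then have "b \<sigma> i \<bullet> n' \<le> b \<sigma> i \<bullet> n" using t by (simp add: zero_le_mult_iff inner_diff_right)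
    then have "(of_rat r :: real) \<le> of_rat q" using n(2) n'(2) by linarith
    then show False using qr by (simp add: of_rat_less_eq)
  qed
qed

lemma ambiguous_borel: "ambiguous \<Psi> \<in> sets borel"
  unfolding ambiguous_def
  by (intro sets.countable_UN'' sets.finite_UN finite_facets_Delta borel_closed closed_spread countableI_type) auto

lemma ambiguous_null: "emeasure \<mu> (ambiguous \<Psi>) = 0"
proof -
  have "spread \<Psi> \<sigma> i qr \<in> null_sets \<mu>" if "\<sigma> facet_of \<Delta>" "qr \<in> {(q, r). q < r}" for \<sigma> i qr
    using spread_null[OF that(1)] closed_spread[OF that(1)] that(2) by (auto simp: null_sets_def)
  then have "ambiguous \<Psi> \<in> null_sets \<mu>"
    unfolding ambiguous_def
    by (intro null_sets_UN' countable_finite finite_facets_Delta countableI_type) auto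
  then show ?thesis by (simp add: null_sets_def)
qed

text \<open>If two partners differed in a \<open>b \<sigma> i\<close>-coordinate, two rationals in
  between would place m in some \<open>spread\<close>. So their difference is orthogonal to all
  \<open>b \<sigma> i\<close>, which span the hyperplane orthogonal to
  \<open>N \<sigma>\<close>.\<close>

lemma contact_fibre:
  assumes m: "m \<notin> ambiguous \<Psi>" and n: "(m, n) \<in> contact \<Psi>" "(m, n') \<in> contact \<Psi>"
    and \<sigma>: "\<sigma> facet_of \<Delta>" "m \<in> \<sigma>"
  obtains s where "n = n' + s *\<^sub>R N \<sigma>"
proof -
  have le: "b \<sigma> i \<bullet> n' \<le> b \<sigma> i \<bullet> n" if "(m, n) \<in> contact \<Psi>" "(m, n') \<in> contact \<Psi>" for i n n'
  proof (rule ccontr)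
    assume "\<not> ?thesis"
    then obtain q where q: "b \<sigma> i \<bullet> n < of_rat q" "of_rat q < b \<sigma> i \<bullet> n'" using of_rat_dense by (meson not_le)
    then obtain r where r: "(of_rat q :: real) < of_rat r" "of_rat r < b \<sigma> i \<bullet> n'" using of_rat_dense by blast
    have "m \<in> spread \<Psi> \<sigma> i (q, r)"
    proof -
      have "m \<in> fst ` (contact \<Psi> \<inter> {z. b \<sigma> i \<bullet> snd z \<le> of_rat q})"
        by (rule image_eqI[of _ _ "(m, n)"]) (use that q in auto)
      moreover have "m \<in> fst ` (contact \<Psi> \<inter> {z. of_rat r \<le> b \<sigma> i \<bullet> snd z})"
        by (rule image_eqI[of _ _ "(m, n')"]) (use that r in auto)
      ultimately show ?thesis using \<sigma>(2) by (simp add: spread_def)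
    qed
    moreover have "q < r" using r(1) by (simp add: of_rat_less)
    ultimately have "m \<in> ambiguous \<Psi>" using \<sigma>(1) unfolding ambiguous_def by blast
    then show False using m by blast
  qed
  have "b \<sigma> i \<bullet> (n - n') = 0" for i using le[OF n, of i] le[OF n(2,1), of i] by (simp add: inner_diff_right)
  then have J0: "J \<sigma> p \<bullet> (n - n') = 0" for p by (simp add: basis_map_def inner_sum_left)
  obtain u where u: "u \<in> \<sigma>" using facet_Delta(4)[OF \<sigma>(1)] by blast
  note uN = facet_inner[OF \<sigma>(1) u]
  have "x \<bullet> ((n - n') - (u \<bullet> (n - n')) *\<^sub>R N \<sigma>) = 0" for x
  proof -
    have x: "x = J \<sigma> (crd \<sigma> u x) + (x \<bullet> N \<sigma>) *\<^sub>R u" using J_crd[OF \<sigma>(1) uN] by simp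
    have "x \<bullet> (n - n') = J \<sigma> (crd \<sigma> u x) \<bullet> (n - n') + (x \<bullet> N \<sigma>) * (u \<bullet> (n - n'))"
      using arg_cong[OF x, of "\<lambda>x. x \<bullet> (n - n')"] by (simp only: inner_add_left inner_scaleR_left)
    then have "x \<bullet> (n - n') = (x \<bullet> N \<sigma>) * (u \<bullet> (n - n'))" using J0 by simp
    moreover have "x \<bullet> ((n - n') - (u \<bullet> (n - n')) *\<^sub>R N \<sigma>) = x \<bullet> (n - n') - (u \<bullet> (n - n')) * (x \<bullet> N \<sigma>)"
      by (simp only: inner_diff_right[of x "n - n'"] inner_scaleR_right)
    ultimately show ?thesis by simp
  qed
  then have "(n - n') - (u \<bullet> (n - n')) *\<^sub>R N \<sigma> = 0" using inner_eq_zero_iff by blast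
  then show thesis using that[of "u \<bullet> (n - n')"] by (simp add: algebra_simps)
qed

lemma stable_contact_unique:
  assumes m: "m \<notin> ambiguous \<Psi>" and n: "(m, n) \<in> stable_contact \<Psi>" "(m, n') \<in> stable_contact \<Psi>"
  shows "n = n'"
proof -
  have *: "\<exists>s \<sigma>. s \<ge> 0 \<and> n' = n + (- s) *\<^sub>R N \<sigma> \<and> \<sigma> facet_of \<Delta> \<and> m \<in> \<sigma>"
    if nn: "(m, n) \<in> stable_contact \<Psi>" "(m, n') \<in> stable_contact \<Psi>" for n n'
  proof -
    obtain \<tau> where \<tau>: "\<tau> facet_of K" "n \<in> rel_interior \<tau>" "m \<in> St \<Delta> (mt \<tau>)"
      using nn(1) by (auto simp: stable_contact_def)
    obtain \<sigma> where \<sigma>: "\<sigma> facet_of \<Delta>" "mt \<tau> \<in> \<sigma>" "m \<in> \<sigma>" using \<tau>(3) unfolding St_iff by blast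
    have con: "(m, n) \<in> contact \<Psi>" "(m, n') \<in> contact \<Psi>" using nn by (auto simp: stable_contact_def)
    obtain s where s: "n = n' + s *\<^sub>R N \<sigma>" by (rule contact_fibre[OF m con \<sigma>(1,3)])
    have n\<tau>: "n \<in> \<tau>" using \<tau>(2) rel_interior_subset by blast
    have "n' \<in> K" using con(2) B_subset_K by (auto simp: contact_def)
    then have "mt \<tau> \<bullet> n' \<le> mt \<tau> \<bullet> n" using K_ineq[OF _ facet_K(1)[OF \<tau>(1)]] facet_K_inner[OF \<tau>(1) n\<tau>] by simp
    then have "s \<ge> 0" unfolding s using facet_inner[OF \<sigma>(1,2)] by (simp add: inner_add_right)
    then show ?thesis using s \<sigma> by (intro exI[of _ s] exI[of _ \<sigma>]) simp
  qed
  obtain s \<sigma> where s: "s \<ge> 0" "n' = n + (- s) *\<^sub>R N \<sigma>" "\<sigma> facet_of \<Delta>" "m \<in> \<sigma>" using *[OF n] by blast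
  obtain s' \<sigma>' where s': "s' \<ge> 0" "n = n' + (- s') *\<^sub>R N \<sigma>'" "\<sigma>' facet_of \<Delta>" "m \<in> \<sigma>'" using *[OF n(2,1)] by blast
  \<comment> \<open>The facets \<sigma> and \<sigma>' may differ, but m pairs to 1 with both
    normals. So m \<bullet> n' = m \<bullet> n - s and m \<bullet> n = m \<bullet> n' - s' with s
    and s' nonnegative, which forces s = 0.\<close>
  have "m \<bullet> n' = m \<bullet> n - s * (m \<bullet> N \<sigma>)" unfolding s(2) inner_add_right inner_scaleR_right by simp
  moreover have "m \<bullet> n = m \<bullet> n' - s' * (m \<bullet> N \<sigma>')"
    using arg_cong[OF s'(2), of "\<lambda>x. m \<bullet> x"] unfolding inner_add_right inner_scaleR_right by simp
  ultimately have "m \<bullet> n' = m \<bullet> n - s" "m \<bullet> n = m \<bullet> n' - s'"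
    using facet_inner[OF s(3,4)] facet_inner[OF s'(3,4)] by simp_all
  then have "s = 0" using s(1) s'(1) by linarith
  then show ?thesis using s(2) by simp
qed

lemma transport_map_in:
  assumes "m \<in> transport_domain \<Psi>"
  shows "(m, transport_map \<Psi> m) \<in> stable_contact \<Psi>"
proof -
  obtain n where n: "(m, n) \<in> stable_contact \<Psi>" and m: "m \<notin> ambiguous \<Psi>"
    using assms by (auto simp: transport_domain_def)
  have "(THE n. (m, n) \<in> stable_contact \<Psi>) = n"
    using n stable_contact_unique[OF m] by (intro the_equality) auto
  then show ?thesis using n assms by (simp add: transport_map_def)
qed

lemma transport_map_eqI:
  assumes "(m, n) \<in> stable_contact \<Psi>" "m \<notin> ambiguous \<Psi>"
  shows "m \<in> transport_domain \<Psi>" "transport_map \<Psi> m = n"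
proof -
  show d: "m \<in> transport_domain \<Psi>" using assms by (force simp: transport_domain_def)
  show "transport_map \<Psi> m = n" by (rule stable_contact_unique[OF assms(2) transport_map_in[OF d] assms(1)])
qed

section \<open>Measurability of the transport map\<close>

lemma rel_interior_sigma_compact:
  fixes S :: "(real ^ 'n) set"
  obtains C :: "nat \<Rightarrow> (real ^ 'n) set" where "\<And>k. compact (C k)" "rel_interior S = (\<Union>k. C k)"
proof -
  obtain T where T: "open T" "rel_interior S = affine hull S \<inter> T"
    using openin_rel_interior[of S] by (auto simp: openin_open)
  obtain C :: "nat \<Rightarrow> (real ^ 'n) set" where C: "\<And>k. compact (C k)" "\<Union> (range C) = T"
    using open_Union_compact_subsets[OF T(1)] by metis
  show thesis
  proof (rule that[of "\<lambda>k. affine hull S \<inter> C k"])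
    show "compact (affine hull S \<inter> C k)" for k by (intro closed_Int_compact closed_affine_hull C)
    show "rel_interior S = (\<Union>k. affine hull S \<inter> C k)" using T(2) C(2) by blast
  qed
qed

text \<open>Projections of Borel sets need not be Borel. Here each relative interior is a countable
  union of compact sets, so the projection is one too.\<close>

lemma stable_contact_proj_borel:
  assumes F: "closed F"
  shows "fst ` (stable_contact \<Psi> \<inter> (UNIV \<times> F)) \<in> sets borel"
proof -
  have "fst ` (contact \<Psi> \<inter> (St \<Delta> (mt \<tau>) \<times> (rel_interior \<tau> \<inter> F))) \<in> sets borel" for \<tau>
  proof -
    obtain C :: "nat \<Rightarrow> (real ^ 'n) set" where C: "\<And>k. compact (C k)" "rel_interior \<tau> = (\<Union>k. C k)"
      by (rule rel_interior_sigma_compact[of \<tau>]) blast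
    have "contact \<Psi> \<inter> (St \<Delta> (mt \<tau>) \<times> (rel_interior \<tau> \<inter> F)) = (\<Union>k. contact \<Psi> \<inter> (St \<Delta> (mt \<tau>) \<times> (C k \<inter> F)))"
      unfolding C(2) by blast
    then have eq: "fst ` (contact \<Psi> \<inter> (St \<Delta> (mt \<tau>) \<times> (rel_interior \<tau> \<inter> F)))
        = (\<Union>k. fst ` (contact \<Psi> \<inter> (St \<Delta> (mt \<tau>) \<times> (C k \<inter> F))))"
      by (simp only: image_UN)
    have "compact (fst ` (contact \<Psi> \<inter> (St \<Delta> (mt \<tau>) \<times> (C k \<inter> F))))" for k
      by (intro compact_continuous_image compact_Int_closed compact_contact[OF cont] closed_Times
          closed_St closed_Int compact_imp_closed[OF C(1)] F continuous_intros)
    then show ?thesis unfolding eq by (intro sets.countable_UN image_subsetI borel_compact)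
  qed
  then have "(\<Union>\<tau>\<in>{\<tau>. \<tau> facet_of K}. fst ` (contact \<Psi> \<inter> (St \<Delta> (mt \<tau>) \<times> (rel_interior \<tau> \<inter> F)))) \<in> sets borel"
    by (intro sets.finite_UN finite_facets_K) auto
  moreover have "stable_contact \<Psi> \<inter> (UNIV \<times> F)
      = (\<Union>\<tau>\<in>{\<tau>. \<tau> facet_of K}. contact \<Psi> \<inter> (St \<Delta> (mt \<tau>) \<times> (rel_interior \<tau> \<inter> F)))"
    by (auto simp: stable_contact_def)
  ultimately show ?thesis by (simp only: image_UN)
qed

lemma transport_domain_borel: "transport_domain \<Psi> \<in> sets borel"
  unfolding transport_domain_def
  using stable_contact_proj_borel[OF closed_UNIV] ambiguous_borel by auto

text \<open>On the domain the partner is unique, so the preimage of a closed set is the projection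
  of the stable contact pairs over it; closed sets generate the Borel sets.\<close>

lemma transport_map_borel: "transport_map \<Psi> \<in> borel_measurable borel"
  unfolding borel_eq_closed
proof (rule measurable_measure_of)
  fix F :: "(real ^ 'n) set" assume "F \<in> {S. closed S}"
  then have F: "closed F" by simp
  have 1: "transport_map \<Psi> -` F \<inter> transport_domain \<Psi>
      = fst ` (stable_contact \<Psi> \<inter> (UNIV \<times> F)) \<inter> transport_domain \<Psi>"
  proof (intro equalityI subsetI)
    fix m assume "m \<in> transport_map \<Psi> -` F \<inter> transport_domain \<Psi>"
    then show "m \<in> fst ` (stable_contact \<Psi> \<inter> (UNIV \<times> F)) \<inter> transport_domain \<Psi>"
      using transport_map_in[of m] by (auto intro!: image_eqI[of m fst "(m, transport_map \<Psi> m)"])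
  next
    fix m assume m: "m \<in> fst ` (stable_contact \<Psi> \<inter> (UNIV \<times> F)) \<inter> transport_domain \<Psi>"
    then obtain n where "(m, n) \<in> stable_contact \<Psi>" "n \<in> F" by auto
    moreover have "m \<notin> ambiguous \<Psi>" using m by (auto simp: transport_domain_def)
    ultimately show "m \<in> transport_map \<Psi> -` F \<inter> transport_domain \<Psi>"
      using transport_map_eqI(2)[of m n] m by simp
  qed
  have 2: "transport_map \<Psi> -` F - transport_domain \<Psi> = (if 0 \<in> F then - transport_domain \<Psi> else {})"
    by (auto simp: transport_map_def split: if_splits)
  have "transport_map \<Psi> -` F = (transport_map \<Psi> -` F \<inter> transport_domain \<Psi>) \<union> (transport_map \<Psi> -` F - transport_domain \<Psi>)"
    by blast
  also have "\<dots> \<in> sets borel"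
    unfolding 1 2 using stable_contact_proj_borel[OF F] transport_domain_borel by auto
  finally show "transport_map \<Psi> -` F \<inter> space (sigma UNIV {S. closed S}) \<in> sets (sigma UNIV {S. closed S})"
    unfolding borel_eq_closed[symmetric] by simp
qed auto

text \<open>The two sets of points m differ only within \<open>ambiguous \<Psi>\<close> inside the
  star, and \<open>emeasure_crd_image\<close> shows that the image of this \<mu>-null part is
  Lebesgue null.\<close>

lemma emeasure_crd_stable_contact:
  assumes \<tau>: "\<tau> facet_of K" and \<sigma>: "\<sigma> facet_of \<Delta>" "mt \<tau> \<in> \<sigma>"
    and E: "E \<in> sets borel" "E \<subseteq> rel_interior \<tau>"
  shows "emeasure lebesgue (crd \<sigma> (mt \<tau>) ` {m. \<exists>n\<in>E. (m, n) \<in> stable_contact \<Psi>})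
    = emeasure \<mu> (transport_map \<Psi> -` E \<inter> transport_domain \<Psi>)"
proof -
  let ?S = "{m. \<exists>n\<in>E. (m, n) \<in> stable_contact \<Psi>}" and ?X = "transport_map \<Psi> -` E \<inter> transport_domain \<Psi>"
  let ?Z = "ambiguous \<Psi> \<inter> St \<Delta> (mt \<tau>)"
  have u: "mt \<tau> \<in> int_lattice" using facet_K(1)[OF \<tau>] by blast
  have Xb: "?X \<in> sets borel"
    using measurable_sets[OF transport_map_borel E(1)] transport_domain_borel by auto
  have SSt: "?S \<subseteq> St \<Delta> (mt \<tau>)"
  proof
    fix m assume "m \<in> ?S"
    then obtain n where "n \<in> E" "(m, n) \<in> stable_contact \<Psi>" by blast
    then show "m \<in> St \<Delta> (mt \<tau>)" using stable_contactD(1)[OF cont _ \<tau>] E(2) by blast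
  qed
  have XS: "?X \<subseteq> ?S" using transport_map_in by blast
  have SX: "?S \<subseteq> ?X \<union> ?Z"
  proof
    fix m assume m: "m \<in> ?S"
    then obtain n where n: "n \<in> E" "(m, n) \<in> stable_contact \<Psi>" by blast
    show "m \<in> ?X \<union> ?Z"
    proof (cases "m \<in> ambiguous \<Psi>")
      case True then show ?thesis using m SSt by blast
    next
      case False then show ?thesis using transport_map_eqI[OF n(2) False] n(1) by simp
    qed
  qed
  have Zb: "?Z \<in> sets borel" using ambiguous_borel closed_St by auto
  have "emeasure \<mu> ?Z \<le> emeasure \<mu> (ambiguous \<Psi>)" using ambiguous_borel by (intro emeasure_mono) auto
  then have "emeasure \<mu> ?Z = 0" using ambiguous_null by simp
  then have "emeasure lebesgue (crd \<sigma> (mt \<tau>) ` ?Z) = 0" "crd \<sigma> (mt \<tau>) ` ?Z \<in> sets lebesgue"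
    using emeasure_crd_image[OF \<sigma> u Zb] by auto
  then have Zn: "negligible (crd \<sigma> (mt \<tau>) ` ?Z)" by (simp add: negligible_iff_null_sets null_sets_def)
  have "crd \<sigma> (mt \<tau>) ` (?S - ?X) \<subseteq> crd \<sigma> (mt \<tau>) ` ?Z" using SX by (intro image_mono) blast
  then have "negligible (crd \<sigma> (mt \<tau>) ` (?S - ?X))" by (rule negligible_subset[OF Zn])
  then have R: "crd \<sigma> (mt \<tau>) ` (?S - ?X) \<in> null_sets lebesgue" by (simp add: negligible_iff_null_sets)
  have "?S = ?X \<union> (?S - ?X)" using XS by blast
  then have "crd \<sigma> (mt \<tau>) ` ?S = crd \<sigma> (mt \<tau>) ` ?X \<union> crd \<sigma> (mt \<tau>) ` (?S - ?X)"
    by (metis image_Un)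
  moreover note X = emeasure_crd_image[OF \<sigma> u Xb order_trans[OF XS SSt]]
  ultimately have "emeasure lebesgue (crd \<sigma> (mt \<tau>) ` ?S) = emeasure lebesgue (crd \<sigma> (mt \<tau>) ` ?X)"
    using emeasure_Un_null_set[OF X(1) R] by simp
  then show ?thesis using X(2) by simp
qed

end

text \<open>The new form no longer mentions \<sigma>: the subgradient image has the same measure for
  all facets \<sigma> through \<open>mt \<tau>\<close>, and at least one such facet exists because
  \<open>mt \<tau>\<close> lies on A.\<close>

lemma MA_eq_iff:
  assumes \<Psi>: "\<Psi> \<in> P_class \<Delta>"
  shows "MA_eq \<Delta> h b \<Psi> \<nu> \<longleftrightarrow> (\<forall>\<tau> E. \<tau> facet_of K \<longrightarrow> E \<in> sets borel \<longrightarrow> E \<subseteq> rel_interior \<tau> \<longrightarrow>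
    emeasure \<mu> (transport_map \<Psi> -` E \<inter> transport_domain \<Psi>) = emeasure \<nu> E)"
proof -
  note eq = subgradient_image_eq[OF \<Psi>] emeasure_crd_stable_contact[OF P_class_continuous[OF \<Psi>]]
  show ?thesis
  proof
    assume MA: "MA_eq \<Delta> h b \<Psi> \<nu>"
    show "\<forall>\<tau> E. \<tau> facet_of K \<longrightarrow> E \<in> sets borel \<longrightarrow> E \<subseteq> rel_interior \<tau> \<longrightarrow>
      emeasure \<mu> (transport_map \<Psi> -` E \<inter> transport_domain \<Psi>) = emeasure \<nu> E"
    proof (intro allI impI)
      fix \<tau> and E :: "(real ^ 'n) set" assume \<tau>: "\<tau> facet_of K" and E: "E \<in> sets borel" "E \<subseteq> rel_interior \<tau>"
      obtain \<sigma> where \<sigma>: "\<sigma> facet_of \<Delta>" "mt \<tau> \<in> \<sigma>" by (rule in_A_obtain_facet[OF mt_in_A[OF \<tau>]])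
      show "emeasure \<mu> (transport_map \<Psi> -` E \<inter> transport_domain \<Psi>) = emeasure \<nu> E"
        using MA[unfolded MA_eq_def, rule_format, OF \<tau> \<sigma> E] unfolding eq(1)[OF \<tau> \<sigma> E(2)] eq(2)[OF \<tau> \<sigma> E] .
    qed
  next
    assume R: "\<forall>\<tau> E. \<tau> facet_of K \<longrightarrow> E \<in> sets borel \<longrightarrow> E \<subseteq> rel_interior \<tau> \<longrightarrow>
      emeasure \<mu> (transport_map \<Psi> -` E \<inter> transport_domain \<Psi>) = emeasure \<nu> E"
    show "MA_eq \<Delta> h b \<Psi> \<nu>"
      unfolding MA_eq_def
    proof (intro allI impI)
      fix \<tau> \<sigma> and E :: "(real ^ 'n) set"
      assume \<tau>: "\<tau> facet_of K" and \<sigma>: "\<sigma> facet_of \<Delta>" "mt \<tau> \<in> \<sigma>" and E: "E \<in> sets borel" "E \<subseteq> rel_interior \<tau>"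
      show "emeasure lebesgue
          (\<Union>x \<in> beta (b \<sigma>) ` E. subgradient (beta (b \<sigma>) ` rel_interior \<tau>)
               (\<Psi> \<circ> inv_into (rel_interior \<tau>) (beta (b \<sigma>))) x) = emeasure \<nu> E"
        unfolding eq(1)[OF \<tau> \<sigma> E(2)] eq(2)[OF \<tau> \<sigma> E] using R \<tau> E by blast
    qed
  qed
qed

section \<open>The stable region, facet interiors and connectedness of \<open>A\<close>\<close>

lemma A_borel: "A \<in> sets borel" and B_borel: "B \<in> sets borel"
  by (simp_all add: frontier_closed)

lemma AB_borel: "A \<times> B \<in> sets borel"
  by (intro borel_Times A_borel B_borel)

lemma stable_region_closed:
  "closed (\<Union>m \<in> A \<inter> int_lattice. St \<Delta> m \<times> tau_face \<Delta> h m)"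
proof (rule closed_UN)
  have "A \<inter> int_lattice \<subseteq> L" using lattice_A_iff by blast
  then show "finite (A \<inter> int_lattice)" using finite_L finite_subset by blast
  have "closed (tau_face \<Delta> h m)" for m
  proof -
    have "tau_face \<Delta> h m = K \<inter> {n. m \<bullet> n = h m}" by (auto simp: tau_face_def)
    then show ?thesis using closed_Int[OF closed_K closed_hyperplane] by simp
  qed
  then show "\<forall>m\<in>A \<inter> int_lattice. closed (St \<Delta> m \<times> tau_face \<Delta> h m)"
    by (intro ballI closed_Times closed_St)
qed

text \<open>By \<open>tau_face_rel_interior\<close>, the only \<open>tau_face\<close> through a
  relative interior point of \<tau> is that of \<open>mt \<tau>\<close>.\<close>

lemma stable_contact_iff:
  assumes "(m, n) \<in> contact \<Psi>" "n \<in> facet_interiors K"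
  shows "(m, n) \<in> stable_contact \<Psi> \<longleftrightarrow> (m, n) \<in> (\<Union>m \<in> A \<inter> int_lattice. St \<Delta> m \<times> tau_face \<Delta> h m)"
proof
  assume "(m, n) \<in> stable_contact \<Psi>"
  then obtain \<tau> where \<tau>: "\<tau> facet_of K" "n \<in> rel_interior \<tau>" "m \<in> St \<Delta> (mt \<tau>)" by (auto simp: stable_contact_def)
  have "n \<in> tau_face \<Delta> h (mt \<tau>)" using tau_face_mt[OF \<tau>(1)] \<tau>(2) rel_interior_subset by blast
  moreover have "mt \<tau> \<in> A \<inter> int_lattice" using facet_K(1,2)[OF \<tau>(1)] lattice_A_iff by blast
  ultimately show "(m, n) \<in> (\<Union>m \<in> A \<inter> int_lattice. St \<Delta> m \<times> tau_face \<Delta> h m)" using \<tau>(3) by blast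
next
  assume "(m, n) \<in> (\<Union>m \<in> A \<inter> int_lattice. St \<Delta> m \<times> tau_face \<Delta> h m)"
  then obtain m' where m': "m' \<in> A \<inter> int_lattice" "m \<in> St \<Delta> m'" "n \<in> tau_face \<Delta> h m'" by blast
  obtain \<tau> where \<tau>: "\<tau> facet_of K" "n \<in> rel_interior \<tau>" using assms(2) by (auto simp: facet_interiors_def)
  have "m' = mt \<tau>" by (rule tau_face_rel_interior[OF \<tau> m'(1,3)])
  then show "(m, n) \<in> stable_contact \<Psi>" using assms(1) \<tau> m'(2) by (auto simp: stable_contact_def)
qed

lemma stable_contact_in_facet_interiors: "(m, n) \<in> stable_contact \<Psi> \<Longrightarrow> n \<in> facet_interiors K"
  by (auto simp: stable_contact_def facet_interiors_def)

lemma facet_interiors_eq: "facet_interiors K = (\<Union>\<tau>\<in>{\<tau>. \<tau> facet_of K}. rel_interior \<tau>)"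
  by (auto simp: facet_interiors_def)

lemma facet_interiors_borel: "facet_interiors K \<in> sets borel"
  unfolding facet_interiors_eq by (intro sets.finite_UN finite_facets_K borel_rel_interior)

lemma facet_interiors_subset_B: "facet_interiors K \<subseteq> B"
  unfolding facet_interiors_eq B_eq_facets using rel_interior_subset by blast

lemma disjoint_facet_interiors: "disjoint_family_on rel_interior {\<tau>. \<tau> facet_of K}"
  unfolding disjoint_family_on_def
proof (intro ballI impI)
  fix \<tau> \<tau>' assume t: "\<tau> \<in> {\<tau>. \<tau> facet_of K}" "\<tau>' \<in> {\<tau>. \<tau> facet_of K}" "\<tau> \<noteq> \<tau>'"
  show "rel_interior \<tau> \<inter> rel_interior \<tau>' = {}"
  proof (rule ccontr)
    assume "rel_interior \<tau> \<inter> rel_interior \<tau>' \<noteq> {}"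
    then obtain x where x: "x \<in> rel_interior \<tau>" "x \<in> rel_interior \<tau>'" by blast
    have "\<tau> = \<tau>'"
      by (rule facet_of_unique[OF _ _ x(1) subsetD[OF rel_interior_subset x(2)] convex_K]) (use t in auto)
    then show False using t(3) by blast
  qed
qed

lemma connected_A: "connected A"
proof -
  have ne: "interior \<Delta> \<noteq> {}" using zero_interior_Delta by blast
  have "aff_dim \<Delta> = int (CARD('n))" using aff_dim_nonempty_interior[OF ne] by simp
  \<comment> \<open>\<open>CARD('d)\<close> is positive, so \<Delta> has dimension at least 2; the
    boundary of a segment would be disconnected.\<close>
  then have "aff_dim \<Delta> \<noteq> 1" using card by simp
  then have "connected (rel_frontier \<Delta>)"
    by (intro connected_sphere_gen convex_Delta compact_imp_bounded compact_Delta)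
  then show ?thesis using ne by (simp add: rel_frontier_def frontier_def rel_interior_nonempty_interior)
qed

section \<open>Conjugates of bounded functions\<close>

lemma A_nonempty: "A \<noteq> {}"
proof -
  have "\<Delta> \<noteq> UNIV" using compact_imp_bounded[OF compact_Delta] by (metis not_bounded_UNIV)
  moreover have "\<Delta> \<noteq> {}" using zero_in_L by blast
  ultimately show ?thesis using frontier_not_empty by blast
qed

text \<open>A point of A on the ray through n will do. It replaces the lattice point 0, which
  belongs to \<open>L\<close> but not to A.\<close>

lemma A_meets_halfspace: obtains m where "m \<in> A" "0 \<le> m \<bullet> n"
proof (cases "n = 0")
  case True
  then show thesis using that A_nonempty by auto
next
  case False
  obtain C where C: "\<And>x. x \<in> \<Delta> \<Longrightarrow> norm x \<le> C" "C > 0"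
    using compact_imp_bounded[OF compact_Delta] by (metis bounded_pos)
  have "norm (((C + 1) / norm n) *\<^sub>R n) = C + 1" using False C(2) by simp
  then have "((C + 1) / norm n) *\<^sub>R n \<notin> \<Delta>" using C(1)[of "((C + 1) / norm n) *\<^sub>R n"] by linarith
  then obtain s where s: "0 < s" "s *\<^sub>R ((C + 1) / norm n) *\<^sub>R n \<in> A"
    using ray_meets_frontier[OF zero_interior_Delta closed_Delta] by metis
  have "0 \<le> (s *\<^sub>R ((C + 1) / norm n) *\<^sub>R n) \<bullet> n" using s(1) C(2) by simp
  then show thesis using that s(2) by blast
qed

lemma inner_le_SUP_L:
  assumes "m \<in> \<Delta>"
  shows "m \<bullet> n \<le> (SUP m\<in>L. m \<bullet> n)"
proof -
  have "bdd_above ((\<lambda>m. m \<bullet> n) ` L)" using finite_L by simp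
  then have "x \<bullet> n \<le> (SUP m\<in>L. m \<bullet> n)" if "x \<in> L" for x using that by (intro cSUP_upper)
  then have "L \<subseteq> {x. n \<bullet> x \<le> (SUP m\<in>L. m \<bullet> n)}" by (auto simp: inner_commute)
  then have "convex hull L \<subseteq> {x. n \<bullet> x \<le> (SUP m\<in>L. m \<bullet> n)}" by (rule hull_minimal) (rule convex_halfspace_le)
  then show ?thesis using assms Delta_eq_hull_L by (auto simp: inner_commute)
qed

context
  fixes f :: "real ^ 'n \<Rightarrow> real" and C assumes f: "\<And>m. m \<in> A \<Longrightarrow> \<bar>f m\<bar> \<le> C"
begin

lemma bdd_above_conjugate: "bdd_above ((\<lambda>m. m \<bullet> n - f m) ` A)"
proof (rule bdd_aboveI2)
  fix m assume m: "m \<in> A"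
  then show "m \<bullet> n - f m \<le> (SUP m\<in>L. m \<bullet> n) + C" using f[OF m] inner_le_SUP_L[of m n] A_subset_Delta by fastforce
qed

lemma conjugate_ge: "m \<in> A \<Longrightarrow> m \<bullet> n - f m \<le> (SUP m\<in>A. m \<bullet> n - f m)"
  by (intro cSUP_upper bdd_above_conjugate)

text \<open>Since f is bounded by C on A, only the suprema of m \<bullet> n over A and over
  \<open>L\<close> need comparison. All nonzero points of \<open>L\<close> lie on A, and the term of
  0 is dominated by a point of A with nonnegative pairing.\<close>

lemma conjugate_in_P_class: "(\<lambda>n. SUP m\<in>A. m \<bullet> n - f m) \<in> P_class \<Delta>"
  unfolding P_class_def
proof (intro CollectI conjI)
  let ?g = "\<lambda>n. SUP m\<in>A. m \<bullet> n - f m"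
  show "convex_on UNIV ?g"
  proof (rule convex_onI)
    fix t :: real and x y :: "real ^ 'n" assume t: "0 < t" "t < 1"
    show "?g ((1 - t) *\<^sub>R x + t *\<^sub>R y) \<le> (1 - t) * ?g x + t * ?g y"
    proof (rule cSUP_least[OF A_nonempty])
      fix m assume m: "m \<in> A"
      have "m \<bullet> ((1 - t) *\<^sub>R x + t *\<^sub>R y) - f m = (1 - t) * (m \<bullet> x - f m) + t * (m \<bullet> y - f m)"
        by (simp add: inner_add_right algebra_simps)
      also have "\<dots> \<le> (1 - t) * ?g x + t * ?g y"
        using conjugate_ge[OF m] t by (intro add_mono mult_left_mono) auto
      finally show "m \<bullet> ((1 - t) *\<^sub>R x + t *\<^sub>R y) - f m \<le> (1 - t) * ?g x + t * ?g y" .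
    qed
  qed auto
  have "\<bar>?g n - (SUP m\<in>L. m \<bullet> n)\<bar> \<le> C" for n
  proof -
    have "?g n \<le> (SUP m\<in>L. m \<bullet> n) + C"
    proof (rule cSUP_least[OF A_nonempty])
      fix m assume m: "m \<in> A"
      then show "m \<bullet> n - f m \<le> (SUP m\<in>L. m \<bullet> n) + C" using f[OF m] inner_le_SUP_L[of m n] A_subset_Delta by fastforce
    qed
    moreover have "(SUP m\<in>L. m \<bullet> n) \<le> ?g n + C"
    proof (rule cSUP_least)
      show "L \<noteq> {}" using zero_in_L by blast
      fix m assume m: "m \<in> L"
      show "m \<bullet> n \<le> ?g n + C"
      proof (cases "m = 0")
        case True
        obtain m' where m': "m' \<in> A" "0 \<le> m' \<bullet> n" by (rule A_meets_halfspace)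
        then show ?thesis using f[OF m'(1)] conjugate_ge[OF m'(1), of n] True by simp
      next
        case False
        then have "m \<in> A" using L_subset_A m by blast
        then show ?thesis using f conjugate_ge[of m n] by fastforce
      qed
    qed
    ultimately show ?thesis by linarith
  qed
  then show "bdd_above (range (\<lambda>n. \<bar>?g n - (SUP m\<in>L. m \<bullet> n)\<bar>))" by (intro bdd_aboveI2)
qed

text \<open>A subgradient n of f at m makes m a maximiser in the conjugate at n, while at n' the
  conjugate is at least the term of m.\<close>

lemma conjugate_contact:
  assumes "m \<in> A" "n \<in> B" and sub: "\<And>m'. f m + n \<bullet> (m' - m) \<le> f m'"
  shows "(m, n) \<in> contact (\<lambda>n. SUP m\<in>A. m \<bullet> n - f m)"
proof (rule contactI[OF P_class_continuous[OF conjugate_in_P_class] assms(1,2)])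
  fix n'
  have "(SUP m\<in>A. m \<bullet> n - f m) \<le> m \<bullet> n - f m"
  proof (rule cSUP_least[OF A_nonempty])
    fix m' show "m' \<bullet> n - f m' \<le> m \<bullet> n - f m"
      using sub[of m'] by (simp add: inner_diff_right inner_commute)
  qed
  then show "(SUP m\<in>A. m \<bullet> n - f m) + m \<bullet> (n' - n) \<le> (SUP m\<in>A. m \<bullet> n' - f m)"
    using conjugate_ge[OF assms(1), of n'] by (simp add: inner_diff_right)
qed

end

section \<open>Comparison of two potentials\<close>

lemma Phi_subgradient:
  assumes cont: "continuous_on UNIV \<Psi>" and c: "(m, n) \<in> contact \<Psi>"
  shows "\<Phi> \<Psi> m + n \<bullet> (m' - m) \<le> \<Phi> \<Psi> m'"
proof -
  have "n \<in> B" "\<Phi> \<Psi> m + \<Psi> n = m \<bullet> n" using c by (auto simp: contact_def)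
  then show ?thesis using Phi_ge[OF cont, of n m'] by (simp add: inner_diff_right inner_commute)
qed

text \<open>
  On a facet, \<open>\<Phi>\<close> and \<open>\<Phi>'\<close> have a common subgradient almost everywhere. Along an equidistant chain
  of \<open>k\<close> steps between two points (translated slightly to avoid the null set) the increments of
  \<open>\<Phi> - \<Phi>'\<close> are bounded by a telescoping sum of total size \<open>O(1/k)\<close>.
\<close>

lemma Phi_diff_constant_on_rel_interior:
  assumes cont: "continuous_on UNIV \<Psi>" "continuous_on UNIV \<Psi>'"
    and Q: "Q \<in> sets borel" "emeasure \<mu> Q = 0"
    and common: "\<And>m. m \<in> A \<Longrightarrow> m \<notin> Q \<Longrightarrow> \<exists>n. (m, n) \<in> contact \<Psi> \<and> (m, n) \<in> contact \<Psi>'"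
    and \<sigma>: "\<sigma> facet_of \<Delta>" and xy: "x \<in> rel_interior \<sigma>" "y \<in> rel_interior \<sigma>"
  shows "\<Phi> \<Psi> x - \<Phi> \<Psi>' x = \<Phi> \<Psi> y - \<Phi> \<Psi>' y"
proof -
  define c where "c p = base \<sigma> + J \<sigma> p" for p
  define u where "u m = \<Phi> \<Psi> m - \<Phi> \<Psi>' m" for m
  have rel\<sigma>: "rel_interior \<sigma> \<subseteq> \<sigma>" by (rule rel_interior_subset)
  obtain px where px: "x = c px" unfolding c_def by (rule facet_chart_surj[OF \<sigma> subsetD[OF rel\<sigma> xy(1)]])
  obtain py where py: "y = c py" unfolding c_def by (rule facet_chart_surj[OF \<sigma> subsetD[OF rel\<sigma> xy(2)]])
  have cc: "continuous_on UNIV c"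
    unfolding c_def using linear_basis_map by (intro continuous_intros linear_continuous_on) (simp add: linear_conv_bounded_linear)
  have aff: "affine hull \<sigma> = {m. N \<sigma> \<bullet> m = 1}"
  proof (rule facet_affine_hull_eq_hyperplane[OF _ \<sigma>])
    show "interior \<Delta> \<noteq> {}" using zero_interior_Delta by blast
    show "N \<sigma> \<noteq> 0" by (rule normal_nonzero[OF \<sigma>])
    show "\<sigma> \<subseteq> {m. N \<sigma> \<bullet> m = 1}" using facet_inner[OF \<sigma>] by (auto simp: inner_commute)
  qed
  have c_aff: "c p \<in> affine hull \<sigma>" for p
    unfolding aff using J_inner_normal[OF \<sigma>] facet_inner[OF \<sigma> base_in[OF \<sigma>]]
    by (simp add: c_def inner_add_right inner_commute)
  obtain T where T: "open T" "rel_interior \<sigma> = affine hull \<sigma> \<inter> T"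
    using openin_rel_interior[of \<sigma>] by (auto simp: openin_open)
  define U where "U = c -` rel_interior \<sigma>"
  have "U = c -` T" using c_aff T(2) by (auto simp: U_def)
  then have openU: "open U" using T(1) cc by (simp add: open_vimage)
  have conv: "convex U"
  proof (rule convexI)
    fix p q and s t :: real assume pq: "p \<in> U" "q \<in> U" and st: "0 \<le> s" "0 \<le> t" "s + t = 1"
    have "c (s *\<^sub>R p + t *\<^sub>R q) = (s + t) *\<^sub>R base \<sigma> + (s *\<^sub>R J \<sigma> p + t *\<^sub>R J \<sigma> q)"
      using st(3) by (simp add: c_def linear_add[OF linear_basis_map] linear_scale[OF linear_basis_map])
    also have "\<dots> = s *\<^sub>R c p + t *\<^sub>R c q"
      by (simp add: c_def scaleR_add_left scaleR_add_right)
    also have "\<dots> \<in> rel_interior \<sigma>"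
    proof (rule convexD[OF convex_rel_interior _ _ st])
      show "convex \<sigma>" by (rule face_of_imp_convex[OF facet_of_imp_face_of[OF \<sigma>]])
    qed (use pq in \<open>auto simp: U_def\<close>)
    finally show "s *\<^sub>R p + t *\<^sub>R q \<in> U" by (simp add: U_def)
  qed
  let ?Q = "c -` (Q \<inter> rel_interior \<sigma>)"
  have "(\<Sum>\<sigma> | \<sigma> facet_of \<Delta>. emeasure lborel ((\<lambda>x. base \<sigma> + J \<sigma> x) -` (Q \<inter> rel_interior \<sigma>))) = 0"
    using emeasure_mu[OF Q(1)] Q(2) by simp
  then have "\<forall>\<sigma>\<in>{\<sigma>. \<sigma> facet_of \<Delta>}. emeasure lborel ((\<lambda>x. base \<sigma> + J \<sigma> x) -` (Q \<inter> rel_interior \<sigma>)) = 0"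
    by (subst (asm) sum_eq_0_iff[OF finite_facets_Delta])
  then have "emeasure lborel ((\<lambda>x. base \<sigma> + J \<sigma> x) -` (Q \<inter> rel_interior \<sigma>)) = 0" using \<sigma> by blast
  moreover have "(\<lambda>x. base \<sigma> + J \<sigma> x) -` (Q \<inter> rel_interior \<sigma>) \<in> sets borel"
    by (intro borel_facet_chart sets.Int Q(1) borel_rel_interior)
  moreover have "(\<lambda>x. base \<sigma> + J \<sigma> x) -` (Q \<inter> rel_interior \<sigma>) = ?Q"
  proof -
    have "(\<lambda>x. base \<sigma> + J \<sigma> x) = c" by (intro ext) (simp add: c_def)
    then show ?thesis by (simp only:)
  qed
  ultimately have negQ: "negligible ?Q" by (simp add: negligible_iff_emeasure0)
  obtain R where R: "R > 0" "\<And>n. n \<in> B \<Longrightarrow> norm n \<le> R"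
    using compact_imp_bounded[OF compact_B] by (metis bounded_pos)
  obtain e where e: "e > 0" "ball px e \<subseteq> U" "ball py e \<subseteq> U"
  proof -
    have "px \<in> U" "py \<in> U" using xy px py by (auto simp: U_def)
    then obtain e1 e2 where "e1 > 0" "ball px e1 \<subseteq> U" "e2 > 0" "ball py e2 \<subseteq> U"
      using openU open_contains_ball by metis
    then show thesis by (intro that[of "min e1 e2"]) auto
  qed
  have chain: "\<exists>w. norm w < 1 / real (Suc j) \<and> \<bar>u (c (py + w)) - u (c (px + w))\<bar> \<le> 2 * R * norm (y - x) / real (Suc j)" for j
  proof -
    define k where "k = Suc j"
    have k: "real k > 0" by (simp add: k_def)
    define p where "p i = px + (real i / real k) *\<^sub>R (py - px)" for i :: nat
    \<comment> \<open>A ball is not covered by finitely many translates of a null set, so one small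
      shift w moves the whole chain off Q.\<close>
    have "negligible (\<Union>i\<in>{..k}. (+) (- p i) ` ?Q)"
      by (intro negligible_Union finite_imageI finite_atMost) (blast intro: negligible_translation[OF negQ])
    moreover have "0 < min e (1 / real k)" unfolding min_less_iff_conj using e(1) k by simp
    then have "\<not> negligible (ball (0 :: real ^ 'd) (min e (1 / real k)))"
      by (intro open_not_negligible open_ball) (simp only: ball_eq_empty not_le)
    ultimately have "\<not> ball (0 :: real ^ 'd) (min e (1 / real k)) \<subseteq> (\<Union>i\<in>{..k}. (+) (- p i) ` ?Q)"
      using negligible_subset by blast
    then obtain w where wb: "w \<in> ball 0 (min e (1 / real k))" and wQ: "w \<notin> (\<Union>i\<in>{..k}. (+) (- p i) ` ?Q)"
      by blast
    then have w: "norm w < e" "norm w < 1 / real k" by simp_all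
    have pw: "p i + w \<in> U" if "i \<le> k" for i
    proof -
      have q: "0 \<le> real i / real k" "real i / real k \<le> 1" using that k by auto
      have "p i + w = (1 - real i / real k) *\<^sub>R (px + w) + (real i / real k) *\<^sub>R (py + w)"
        by (simp add: p_def algebra_simps)
      moreover have "px + w \<in> U" "py + w \<in> U" using e(2,3) w(1) by (auto simp: dist_norm subset_eq)
      ultimately show ?thesis using convexD[OF conv, of "px + w" "py + w" "1 - real i / real k" "real i / real k"] q by simp
    qed
    define z where "z i = c (p i + w)" for i
    have zr: "z i \<in> rel_interior \<sigma>" if "i \<le> k" for i using pw[OF that] by (simp add: U_def z_def)
    have zQ: "z i \<notin> Q" if "i \<le> k" for i
    proof
      assume "z i \<in> Q"
      then have "p i + w \<in> ?Q" using zr[OF that] by (simp add: z_def)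
      then have "w \<in> (+) (- p i) ` ?Q" by (intro image_eqI[of _ _ "p i + w"]) auto
      then show False using wQ that by blast
    qed
    have "\<exists>n. (z i, n) \<in> contact \<Psi> \<and> (z i, n) \<in> contact \<Psi>'" if "i \<le> k" for i
      using common[OF _ zQ[OF that]] zr[OF that] rel\<sigma> facet_subset_A[OF \<sigma>] by blast
    then obtain n where n: "\<And>i. i \<le> k \<Longrightarrow> (z i, n i) \<in> contact \<Psi>" "\<And>i. i \<le> k \<Longrightarrow> (z i, n i) \<in> contact \<Psi>'"
      by metis
    let ?v = "(1 / real k) *\<^sub>R (y - x)"
    have step: "z (Suc i) - z i = ?v" for i
    proof -
      have "J \<sigma> (p (Suc i) + w) - J \<sigma> (p i + w) = J \<sigma> ((p (Suc i) + w) - (p i + w))"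
        by (rule linear_diff[OF linear_basis_map, symmetric])
      also have "(p (Suc i) + w) - (p i + w) = (1 / real k) *\<^sub>R (py - px)"
        by (simp add: p_def scaleR_diff_left[symmetric] diff_divide_distrib[symmetric])
      also have "J \<sigma> \<dots> = (1 / real k) *\<^sub>R (J \<sigma> py - J \<sigma> px)"
        by (simp add: linear_scale[OF linear_basis_map] linear_diff[OF linear_basis_map])
      finally show ?thesis by (simp add: z_def c_def px py)
    qed
    \<comment> \<open>\<open>n i\<close> and \<open>n (Suc i)\<close> are subgradients of both
      transforms, so both increments over this step lie between \<open>n i \<bullet> ?v\<close> and
      \<open>n (Suc i) \<bullet> ?v\<close>.\<close>
    have du: "\<bar>u (z (Suc i)) - u (z i)\<bar> \<le> (n (Suc i) - n i) \<bullet> ?v" if i: "i < k" for i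
    proof -
      have le: "i \<le> k" "Suc i \<le> k" using i by auto
      have rev_step: "z i - z (Suc i) = - ?v" using step[of i] by (simp add: algebra_simps)
      note s = Phi_subgradient[OF cont(1) n(1)[OF le(1)], of "z (Suc i)"]
        Phi_subgradient[OF cont(2) n(2)[OF le(1)], of "z (Suc i)"]
        Phi_subgradient[OF cont(1) n(1)[OF le(2)], of "z i"]
        Phi_subgradient[OF cont(2) n(2)[OF le(2)], of "z i"]
      show ?thesis using s unfolding step rev_step u_def inner_minus_right inner_diff_left by linarith
    qed
    have "u (z k) - u (z 0) = (\<Sum>i<k. u (z (Suc i)) - u (z i))"
      by (rule sum_lessThan_telescope[symmetric])
    also have "\<bar>\<dots>\<bar> \<le> (\<Sum>i<k. \<bar>u (z (Suc i)) - u (z i)\<bar>)" by (rule sum_abs)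
    also have "\<dots> \<le> (\<Sum>i<k. (n (Suc i) - n i) \<bullet> ?v)" using du by (intro sum_mono) auto
    also have "\<dots> = (n k - n 0) \<bullet> ?v"
      by (simp only: inner_sum_left[symmetric] sum_lessThan_telescope)
    also have "\<dots> \<le> norm (n k - n 0) * norm ?v" by (rule norm_cauchy_schwarz)
    also have "\<dots> \<le> (2 * R) * norm ?v"
    proof (intro mult_right_mono)
      have "n k \<in> B" "n 0 \<in> B" using n(1)[of k] n(1)[of 0] by (auto simp: contact_def)
      then show "norm (n k - n 0) \<le> 2 * R" using norm_triangle_ineq4[of "n k" "n 0"] R(2)[of "n k"] R(2)[of "n 0"] by linarith
    qed simp
    also have "\<dots> = 2 * R * norm (y - x) / real k" by simp
    finally have "\<bar>u (z k) - u (z 0)\<bar> \<le> 2 * R * norm (y - x) / real k" .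
    moreover have "z k = c (py + w)" "z 0 = c (px + w)" using k by (simp_all add: z_def p_def)
    ultimately show ?thesis using w(2) unfolding k_def by auto
  qed
  then obtain w where w: "\<And>j. norm (w j) < 1 / real (Suc j)"
    "\<And>j. \<bar>u (c (py + w j)) - u (c (px + w j))\<bar> \<le> 2 * R * norm (y - x) / real (Suc j)" by metis
  have inv: "(\<lambda>j. 1 / real (Suc j)) \<longlonglongrightarrow> 0" using LIMSEQ_inverse_real_of_nat by (simp add: inverse_eq_divide)
  have w0: "w \<longlonglongrightarrow> 0"
    by (rule Lim_null_comparison[OF always_eventually inv]) (intro allI less_imp_le w(1))
  have "continuous_on UNIV (\<lambda>p. u (c p))"
    unfolding u_def by (intro continuous_intros continuous_on_compose2[OF continuous_Phi[OF cont(1)] cc]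
        continuous_on_compose2[OF continuous_Phi[OF cont(2)] cc]) auto
  then have lim: "(\<lambda>j. u (c (q + w j))) \<longlonglongrightarrow> u (c q)" for q
  proof -
    have "(\<lambda>j. q + w j) \<longlonglongrightarrow> q + 0" by (intro tendsto_intros w0)
    then have "(\<lambda>j. q + w j) \<longlonglongrightarrow> q" by simp
    with \<open>continuous_on UNIV (\<lambda>p. u (c p))\<close> show ?thesis
      by (rule continuous_on_tendsto_compose) auto
  qed
  have "(\<lambda>j. u (c (py + w j)) - u (c (px + w j))) \<longlonglongrightarrow> u (c py) - u (c px)"
    by (intro tendsto_diff lim)
  moreover have "(\<lambda>j. u (c (py + w j)) - u (c (px + w j))) \<longlonglongrightarrow> 0"
  proof (rule Lim_null_comparison)
    show "\<forall>\<^sub>F j in sequentially. norm (u (c (py + w j)) - u (c (px + w j))) \<le> 2 * R * norm (y - x) * (1 / real (Suc j))"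
      using w(2) by simp
    show "(\<lambda>j. 2 * R * norm (y - x) * (1 / real (Suc j))) \<longlonglongrightarrow> 0"
      by (rule tendsto_mult_right_zero[OF inv])
  qed
  ultimately have "u (c py) - u (c px) = 0" by (rule LIMSEQ_unique)
  then show ?thesis using px py by (simp add: u_def)
qed

text \<open>Continuity extends constancy from each relative interior to the closed facet. The
  difference then takes finitely many values on A, and a continuous function of finite range on a
  connected set is constant.\<close>

lemma Phi_diff_constant:
  assumes cont: "continuous_on UNIV \<Psi>" "continuous_on UNIV \<Psi>'"
    and Q: "Q \<in> sets borel" "emeasure \<mu> Q = 0"
    and common: "\<And>m. m \<in> A \<Longrightarrow> m \<notin> Q \<Longrightarrow> \<exists>n. (m, n) \<in> contact \<Psi> \<and> (m, n) \<in> contact \<Psi>'"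
  obtains c where "\<And>m. m \<in> A \<Longrightarrow> \<Phi> \<Psi> m - \<Phi> \<Psi>' m = c"
proof -
  define u where "u m = \<Phi> \<Psi> m - \<Phi> \<Psi>' m" for m
  have uc: "continuous_on UNIV u"
    unfolding u_def by (intro continuous_intros continuous_Phi cont)
  have "\<exists>c. \<forall>m\<in>\<sigma>. u m = c" if \<sigma>: "\<sigma> facet_of \<Delta>" for \<sigma>
  proof -
    have conv: "convex \<sigma>" by (rule face_of_imp_convex[OF facet_of_imp_face_of[OF \<sigma>]])
    have "\<sigma> \<noteq> {}" using \<sigma> by (simp add: facet_of_def)
    then obtain x where x: "x \<in> rel_interior \<sigma>" using rel_interior_eq_empty[OF conv] by blast
    have "u y = u x" if "y \<in> rel_interior \<sigma>" for y
      unfolding u_def by (rule Phi_diff_constant_on_rel_interior[OF cont Q common \<sigma> that x])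
    moreover have "closure (rel_interior \<sigma>) = \<sigma>"
      using convex_closure_rel_interior[OF conv] facet_of_Delta_closed[OF \<sigma>] by simp
    ultimately have "u y = u x" if "y \<in> \<sigma>" for y
      using continuous_constant_on_closure[of "rel_interior \<sigma>" u "u x" y] that continuous_on_subset[OF uc] by simp
    then show ?thesis by blast
  qed
  then obtain k where k: "\<And>\<sigma> m. \<sigma> facet_of \<Delta> \<Longrightarrow> m \<in> \<sigma> \<Longrightarrow> u m = k \<sigma>" by metis
  have "u ` A \<subseteq> k ` {\<sigma>. \<sigma> facet_of \<Delta>}"
  proof
    fix t assume "t \<in> u ` A"
    then obtain m where m: "m \<in> A" "t = u m" by blast
    obtain \<sigma> where \<sigma>: "\<sigma> facet_of \<Delta>" "m \<in> \<sigma>" by (rule in_A_obtain_facet[OF m(1)])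
    then show "t \<in> k ` {\<sigma>. \<sigma> facet_of \<Delta>}" using k m(2) by blast
  qed
  then have "finite (u ` A)" using finite_facets_Delta finite_surj by blast
  then have "u constant_on A"
    using continuous_finite_range_constant[OF connected_A continuous_on_subset[OF uc]] by blast
  then obtain c where "\<And>m. m \<in> A \<Longrightarrow> u m = c" by (auto simp: constant_on_def)
  then show thesis using that by (simp add: u_def)
qed

text \<open>Over a facet interior both potentials have contact points; inserting the contact point
  of each into the inequality for the other gives \<Psi> - \<Psi>' = -c from both sides. Facet
  interiors are dense in B.\<close>

lemma potential_diff_constant_on_B:
  assumes \<Psi>: "\<Psi> \<in> P_class \<Delta>" "\<Psi>' \<in> P_class \<Delta>" and c: "\<And>m. m \<in> A \<Longrightarrow> \<Phi> \<Psi> m - \<Phi> \<Psi>' m = c"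
  shows "(\<lambda>n. \<Psi> n - \<Psi>' n) constant_on B"
proof -
  note cont = P_class_continuous[OF \<Psi>(1)] P_class_continuous[OF \<Psi>(2)]
  have rel: "\<Psi> n - \<Psi>' n = - c" if \<tau>: "\<tau> facet_of K" "n \<in> rel_interior \<tau>" for \<tau> n
  proof -
    obtain m where "(m, n) \<in> stable_contact \<Psi>" by (rule stable_contact_exists[OF \<Psi>(1) \<tau>])
    then have m: "m \<in> A" "n \<in> B" "\<Phi> \<Psi> m + \<Psi> n = m \<bullet> n" by (auto simp: stable_contact_def contact_def)
    obtain m' where "(m', n) \<in> stable_contact \<Psi>'" by (rule stable_contact_exists[OF \<Psi>(2) \<tau>])
    then have m': "m' \<in> A" "\<Phi> \<Psi>' m' + \<Psi>' n = m' \<bullet> n" by (auto simp: stable_contact_def contact_def)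
    show ?thesis
      using Phi_ge[OF cont(1) m(2), of m'] Phi_ge[OF cont(2) m(2), of m] m(3) m'(2) c[OF m(1)] c[OF m'(1)] by linarith
  qed
  have "\<Psi> n - \<Psi>' n = - c" if n: "n \<in> B" for n
  proof -
    obtain \<tau> where \<tau>: "\<tau> facet_of K" "n \<in> \<tau>" using n B_eq_facets by blast
    have conv: "convex \<tau>" by (rule face_of_imp_convex[OF facet_of_imp_face_of[OF \<tau>(1)]])
    have "closed \<tau>" using face_of_imp_closed[OF convex_K closed_K facet_of_imp_face_of[OF \<tau>(1)]] .
    then have cl: "closure (rel_interior \<tau>) = \<tau>" using convex_closure_rel_interior[OF conv] by simp
    have "continuous_on (closure (rel_interior \<tau>)) (\<lambda>n. \<Psi> n - \<Psi>' n)"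
      by (intro continuous_on_diff continuous_on_subset[OF cont(1)] continuous_on_subset[OF cont(2)]) auto
    then show ?thesis
      using continuous_constant_on_closure[of "rel_interior \<tau>" "\<lambda>n. \<Psi> n - \<Psi>' n" "- c" n] rel[OF \<tau>(1)] \<tau>(2) cl by simp
  qed
  then show ?thesis by (auto simp: constant_on_def)
qed

end

section \<open>Optimal transport\<close>

locale tropical_transport = tropical_reflexive \<Delta> h b
  for \<Delta> :: "(real ^ 'n) set" and h :: "real ^ 'n \<Rightarrow> int"
    and b :: "(real ^ 'n) set \<Rightarrow> 'd::finite \<Rightarrow> real ^ 'n" +
  fixes \<nu> :: "(real ^ 'n) measure"
  assumes sets_nu: "sets \<nu> = sets borel"
    and nu_outside: "emeasure \<nu> (- facet_interiors K) = 0"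
    and nu_mass: "emeasure \<nu> (facet_interiors K) = emeasure \<mu> A"
begin

lemma mu_UNIV: "emeasure \<mu> UNIV = emeasure \<mu> A"
proof -
  have "emeasure \<mu> (A \<union> - A) = emeasure \<mu> A"
    using emeasure_mu_outside A_borel by (intro emeasure_Un_null_set) (auto simp: null_sets_def)
  then show ?thesis by simp
qed

lemma nu_UNIV: "emeasure \<nu> UNIV = emeasure \<mu> UNIV"
proof -
  have "emeasure \<nu> (facet_interiors K \<union> - facet_interiors K) = emeasure \<nu> (facet_interiors K)"
    using nu_outside facet_interiors_borel sets_nu by (intro emeasure_Un_null_set) (auto simp: null_sets_def)
  then show ?thesis using nu_mass mu_UNIV by simp
qed

lemma space_nu: "space \<nu> = UNIV"
  using sets_eq_imp_space_eq[OF sets_nu] by simp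

lemma finite_measure_nu: "finite_measure \<nu>"
  using nu_UNIV finite_measure.emeasure_finite[OF finite_measure_mu, of UNIV] space_nu
  by (intro finite_measureI) simp

text \<open>Leads from sets inside one facet interior, the only ones tested by the equation, to all
  Borel sets.\<close>

lemma emeasure_facet_decomposition:
  assumes M: "sets M = sets borel" "emeasure M (- facet_interiors K) = 0" and E: "E \<in> sets borel"
  shows "emeasure M E = (\<Sum>\<tau> | \<tau> facet_of K. emeasure M (E \<inter> rel_interior \<tau>))"
proof -
  let ?F = "facet_interiors K"
  have "emeasure M (E - ?F) \<le> emeasure M (- ?F)"
    using M(1) facet_interiors_borel by (intro emeasure_mono) auto
  then have N: "E - ?F \<in> null_sets M" using M E facet_interiors_borel by (auto simp: null_sets_def)
  have "emeasure M E = emeasure M (E \<inter> ?F \<union> (E - ?F))" by (rule arg_cong[of _ _ "emeasure M"]) blast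
  also have "\<dots> = emeasure M (E \<inter> ?F)"
    using N M(1) E facet_interiors_borel by (intro emeasure_Un_null_set) auto
  also have "E \<inter> ?F = (\<Union>\<tau>\<in>{\<tau>. \<tau> facet_of K}. E \<inter> rel_interior \<tau>)" unfolding facet_interiors_eq by blast
  also have "emeasure M \<dots> = (\<Sum>\<tau> | \<tau> facet_of K. emeasure M (E \<inter> rel_interior \<tau>))"
  proof (rule sum_emeasure[symmetric, OF _ _ finite_facets_K])
    show "disjoint_family_on (\<lambda>\<tau>. E \<inter> rel_interior \<tau>) {\<tau>. \<tau> facet_of K}"
      using disjoint_facet_interiors unfolding disjoint_family_on_def by blast
    show "(\<lambda>\<tau>. E \<inter> rel_interior \<tau>) ` {\<tau>. \<tau> facet_of K} \<subseteq> sets M"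
      using sets.Int[OF E borel_rel_interior] M(1) by auto
  qed
  finally show ?thesis .
qed

text \<open>Summed over the facets, the equation gives the image of \<mu> restricted to the domain
  the total mass of \<nu>, which is that of \<mu>; as \<mu> is finite, the complement of the domain
  is null.\<close>

lemma MA_eq_transport:
  assumes \<Psi>: "\<Psi> \<in> P_class \<Delta>" and MA: "MA_eq \<Delta> h b \<Psi> \<nu>"
  shows "emeasure \<mu> (- transport_domain \<Psi>) = 0" "distr \<mu> borel (transport_map \<Psi>) = \<nu>"
proof -
  let ?T = "transport_map \<Psi>" and ?D = "transport_domain \<Psi>"
  note cont = P_class_continuous[OF \<Psi>]
  have Tm: "?T \<in> borel_measurable \<mu>"
    using transport_map_borel[OF cont] by (subst measurable_cong_sets[OF sets_mu_M refl])
  have Db: "?D \<in> sets \<mu>" using transport_domain_borel[OF cont] by simp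
  have Tb: "?T -` E \<in> sets \<mu>" if "E \<in> sets borel" for E
    using measurable_sets[OF Tm that] by simp
  let ?M = "distr (density \<mu> (indicator ?D)) borel ?T"
  have M: "emeasure ?M E = emeasure \<mu> (?T -` E \<inter> ?D)" if "E \<in> sets borel" for E
  proof -
    have "emeasure ?M E = emeasure (density \<mu> (indicator ?D)) (?T -` E)"
      using Tm that by (subst emeasure_distr) auto
    also have "\<dots> = emeasure \<mu> (?D \<inter> ?T -` E)"
      by (rule emeasure_restricted[OF Db Tb[OF that]])
    finally show ?thesis by (simp add: Int_commute)
  qed
  have "?T -` (- facet_interiors K) \<inter> ?D = {}"
    using transport_map_in[OF cont] stable_contact_in_facet_interiors by blast
  then have M0: "emeasure ?M (- facet_interiors K) = 0" using M[of "- facet_interiors K"] facet_interiors_borel by simp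
  have eq: "emeasure \<mu> (?T -` E \<inter> ?D) = emeasure \<nu> E" if E: "E \<in> sets borel" for E
  proof -
    have Er: "E \<inter> rel_interior \<tau> \<in> sets borel" for \<tau> by (rule sets.Int[OF E borel_rel_interior])
    have "emeasure ?M (E \<inter> rel_interior \<tau>) = emeasure \<nu> (E \<inter> rel_interior \<tau>)" if "\<tau> facet_of K" for \<tau>
      unfolding M[OF Er] using MA[unfolded MA_eq_iff[OF \<Psi>]] that Er by blast
    then have "emeasure ?M E = emeasure \<nu> E"
      unfolding emeasure_facet_decomposition[OF sets_distr M0 E] emeasure_facet_decomposition[OF sets_nu nu_outside E]
      by (intro sum.cong) auto
    then show ?thesis using M[OF E] by simp
  qed
  interpret fm: finite_measure \<mu> by (rule finite_measure_mu)
  have "emeasure \<mu> ?D = emeasure \<mu> UNIV" using eq[OF space_in_borel] nu_UNIV by simp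
  then have "emeasure \<mu> (UNIV - ?D) = 0"
    using Db by (subst emeasure_Diff) (auto simp: fm.emeasure_finite)
  then show D0: "emeasure \<mu> (- ?D) = 0" by (simp add: Compl_eq_Diff_UNIV)
  show "distr \<mu> borel ?T = \<nu>"
  proof (rule measure_eqI)
    fix E assume "E \<in> sets (distr \<mu> borel ?T)"
    then have E: "E \<in> sets borel" by simp
    have "emeasure \<mu> (?T -` E - ?D) \<le> emeasure \<mu> (- ?D)" using Db by (intro emeasure_mono) auto
    then have N: "?T -` E - ?D \<in> null_sets \<mu>" using D0 Tb[OF E] Db by (auto simp: null_sets_def)
    have "emeasure (distr \<mu> borel ?T) E = emeasure \<mu> (?T -` E)" using Tm E by (subst emeasure_distr) auto
    also have "\<dots> = emeasure \<mu> (?T -` E \<inter> ?D \<union> (?T -` E - ?D))" by (rule arg_cong[of _ _ "emeasure \<mu>"]) blast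
    also have "\<dots> = emeasure \<mu> (?T -` E \<inter> ?D)" using N Tb[OF E] Db by (intro emeasure_Un_null_set) auto
    finally show "emeasure (distr \<mu> borel ?T) E = emeasure \<nu> E" using eq[OF E] by simp
  qed (simp add: sets_nu)
qed

text \<open>Concentration on A \<times> B follows from the marginals, which vanish off A and off the
  facet interiors.\<close>

lemma transport_planI:
  assumes \<gamma>: "sets \<gamma> = sets borel" "distr \<gamma> borel fst = \<mu>" "distr \<gamma> borel snd = \<nu>"
  shows "transport_plan \<Delta> h \<mu> \<nu> \<gamma>"
proof -
  have m: "fst \<in> measurable \<gamma> borel" "snd \<in> measurable \<gamma> borel"
    by (subst measurable_cong_sets[OF \<gamma>(1) refl]; intro borel_measurable_continuous_onI continuous_intros)+
  have sp: "space \<gamma> = UNIV" using sets_eq_imp_space_eq[OF \<gamma>(1)] by simp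
  have "emeasure \<gamma> ((- A) \<times> UNIV) = emeasure (distr \<gamma> borel fst) (- A)"
    using m A_borel by (subst emeasure_distr) (auto simp: sp vimage_fst)
  then have 1: "emeasure \<gamma> ((- A) \<times> UNIV) = 0" using \<gamma>(2) emeasure_mu_outside by simp
  have "emeasure \<gamma> (UNIV \<times> (- facet_interiors K)) = emeasure (distr \<gamma> borel snd) (- facet_interiors K)"
    using m facet_interiors_borel by (subst emeasure_distr) (auto simp: sp vimage_snd)
  then have 2: "emeasure \<gamma> (UNIV \<times> (- facet_interiors K)) = 0" using \<gamma>(3) nu_outside by simp
  have b: "(- A) \<times> UNIV \<in> sets borel" "UNIV \<times> (- facet_interiors K) \<in> sets borel"
    using A_borel facet_interiors_borel by (auto intro!: borel_Times)
  then have "(- A) \<times> UNIV \<union> UNIV \<times> (- facet_interiors K) \<in> null_sets \<gamma>"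
    using 1 2 \<gamma>(1) by (intro null_sets.Un) (auto simp: null_sets_def)
  then have "- (A \<times> B) \<in> null_sets \<gamma>"
  proof (rule null_sets_subset)
    show "- (A \<times> B) \<in> sets \<gamma>" using AB_borel \<gamma>(1) by auto
    show "- (A \<times> B) \<subseteq> (- A) \<times> UNIV \<union> UNIV \<times> (- facet_interiors K)" using facet_interiors_subset_B by auto
  qed
  then show ?thesis using \<gamma> by (simp add: transport_plan_def null_sets_def)
qed

lemma plan_facts:
  assumes "transport_plan \<Delta> h \<mu> \<nu> \<gamma>"
  shows "sets \<gamma> = sets borel" "space \<gamma> = UNIV" "finite_measure \<gamma>"
    "fst \<in> measurable \<gamma> borel" "snd \<in> measurable \<gamma> borel"
    "\<And>X. X \<in> sets borel \<Longrightarrow> emeasure \<gamma> (X \<times> UNIV) = emeasure \<mu> X"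
    "\<And>X. X \<in> sets borel \<Longrightarrow> emeasure \<gamma> (UNIV \<times> X) = emeasure \<nu> X"
    "AE z in \<gamma>. z \<in> A \<times> B"
proof -
  have \<gamma>: "sets \<gamma> = sets borel" "distr \<gamma> borel fst = \<mu>" "distr \<gamma> borel snd = \<nu>" "emeasure \<gamma> (- (A \<times> B)) = 0"
    using assms by (auto simp: transport_plan_def)
  show sp: "space \<gamma> = UNIV" using sets_eq_imp_space_eq[OF \<gamma>(1)] by simp
  show m: "fst \<in> measurable \<gamma> borel" "snd \<in> measurable \<gamma> borel"
    by (subst measurable_cong_sets[OF \<gamma>(1) refl]; intro borel_measurable_continuous_onI continuous_intros)+
  show fX: "emeasure \<gamma> (X \<times> UNIV) = emeasure \<mu> X" if "X \<in> sets borel" for X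
    using emeasure_distr[OF m(1) that] by (simp add: \<gamma>(2) sp vimage_fst)
  show "emeasure \<gamma> (UNIV \<times> X) = emeasure \<nu> X" if "X \<in> sets borel" for X
    using emeasure_distr[OF m(2) that] by (simp add: \<gamma>(3) sp vimage_snd)
  show "sets \<gamma> = sets borel" by (rule \<gamma>(1))
  show "finite_measure \<gamma>"
    using fX[OF space_in_borel] finite_measure.emeasure_finite[OF finite_measure_mu, of UNIV] sp
    by (intro finite_measureI) simp
  show "AE z in \<gamma>. z \<in> A \<times> B"
    using \<gamma>(1,4) AB_borel by (intro AE_I'[of "- (A \<times> B)"]) (auto simp: null_sets_def)
qed

section \<open>Kantorovich duality\<close>

definition dual_value :: "(real ^ 'n \<Rightarrow> real) \<Rightarrow> real" where
  "dual_value \<Psi> = (\<integral>m. indicator A m * \<Phi> \<Psi> m \<partial>\<mu>) + (\<integral>n. indicator B n * \<Psi> n \<partial>\<nu>)"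

lemma bounded_indicator_integrable:
  fixes f :: "'a::euclidean_space \<Rightarrow> real"
  assumes "continuous_on UNIV f" "compact C" "sets M = sets borel" "finite_measure M"
  shows "(\<lambda>x. indicator C x * f x) \<in> borel_measurable borel" "integrable M (\<lambda>x. indicator C x * f x)"
proof -
  show m: "(\<lambda>x. indicator C x * f x) \<in> borel_measurable borel"
    using borel_compact[OF assms(2)] borel_measurable_continuous_onI[OF assms(1)]
    by (intro borel_measurable_times borel_measurable_indicator)
  then have m': "(\<lambda>x. indicator C x * f x) \<in> borel_measurable M"
    by (subst measurable_cong_sets[OF assms(3) refl])
  have "compact (f ` C)" using assms by (intro compact_continuous_image continuous_on_subset[OF assms(1)]) auto
  then obtain R where R: "\<And>x. x \<in> C \<Longrightarrow> norm (f x) \<le> R" "R > 0"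
    using compact_imp_bounded by (metis bounded_pos imageI)
  have "norm (indicator C x * f x) \<le> R" for x
    using R(1)[of x] R(2) by (auto simp: indicator_def)
  then show "integrable M (\<lambda>x. indicator C x * f x)"
    by (intro finite_measure.integrable_const_bound[OF assms(4), where B = R] m') auto
qed

text \<open>The marginal conditions lift the two integrals of \<open>dual_value\<close> to the plan,
  and the indicators can be exchanged because the plan sits on A \<times> B.\<close>

lemma duality_gap:
  assumes \<gamma>: "transport_plan \<Delta> h \<mu> \<nu> \<gamma>" and cont: "continuous_on UNIV \<Psi>"
  shows "transport_cost \<Delta> h \<gamma> + dual_value \<Psi> =
      (\<integral>z. indicator (A \<times> B) z * (\<Phi> \<Psi> (fst z) + \<Psi> (snd z) - fst z \<bullet> snd z) \<partial>\<gamma>)"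
    "integrable \<gamma> (\<lambda>z. indicator (A \<times> B) z * (\<Phi> \<Psi> (fst z) + \<Psi> (snd z) - fst z \<bullet> snd z))"
proof -
  note pf = plan_facts[OF \<gamma>]
  note int = bounded_indicator_integrable(2)[OF _ compact_Times[OF compact_A compact_B] pf(1,3)]
  have dist: "distr \<gamma> borel fst = \<mu>" "distr \<gamma> borel snd = \<nu>" using \<gamma> by (auto simp: transport_plan_def)
  have c: "continuous_on UNIV (\<lambda>z. \<Phi> \<Psi> (fst z))" "continuous_on UNIV (\<lambda>z. \<Psi> (snd z))"
    "continuous_on UNIV (\<lambda>z :: (real^'n) \<times> (real^'n). fst z \<bullet> snd z)"
    by (intro continuous_intros continuous_on_compose2[OF continuous_Phi[OF cont]] continuous_on_compose2[OF cont]; auto)+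
  note i1 = int[OF c(1)] and i2 = int[OF c(2)] and i3 = int[OF c(3)]
  have split: "indicator (A \<times> B) z * (\<Phi> \<Psi> (fst z) + \<Psi> (snd z) - fst z \<bullet> snd z)
      = indicator (A \<times> B) z * \<Phi> \<Psi> (fst z) + indicator (A \<times> B) z * \<Psi> (snd z) - indicator (A \<times> B) z * (fst z \<bullet> snd z)" for z
    by (simp add: algebra_simps)
  show "integrable \<gamma> (\<lambda>z. indicator (A \<times> B) z * (\<Phi> \<Psi> (fst z) + \<Psi> (snd z) - fst z \<bullet> snd z))"
    unfolding split by (intro Bochner_Integration.integrable_diff Bochner_Integration.integrable_add i1 i2 i3)
  have "(\<integral>z. indicator (A \<times> B) z * (\<Phi> \<Psi> (fst z) + \<Psi> (snd z) - fst z \<bullet> snd z) \<partial>\<gamma>)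
      = (\<integral>z. indicator (A \<times> B) z * \<Phi> \<Psi> (fst z) \<partial>\<gamma>) + (\<integral>z. indicator (A \<times> B) z * \<Psi> (snd z) \<partial>\<gamma>)
        - (\<integral>z. indicator (A \<times> B) z * (fst z \<bullet> snd z) \<partial>\<gamma>)"
    unfolding split using i1 i2 i3 by simp
  also have "(\<integral>z. indicator (A \<times> B) z * \<Phi> \<Psi> (fst z) \<partial>\<gamma>) = (\<integral>m. indicator A m * \<Phi> \<Psi> m \<partial>\<mu>)"
  proof -
    note m = bounded_indicator_integrable(1)[OF continuous_Phi[OF cont] compact_A sets_mu_M finite_measure_mu]
    have "(\<integral>m. indicator A m * \<Phi> \<Psi> m \<partial>\<mu>) = (\<integral>z. indicator A (fst z) * \<Phi> \<Psi> (fst z) \<partial>\<gamma>)"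
      unfolding dist(1)[symmetric] by (rule integral_distr[OF pf(4) m])
    also have "\<dots> = (\<integral>z. indicator (A \<times> B) z * \<Phi> \<Psi> (fst z) \<partial>\<gamma>)"
    proof (rule integral_cong_AE)
      show "(\<lambda>z. indicator A (fst z) * \<Phi> \<Psi> (fst z)) \<in> borel_measurable \<gamma>"
        using measurable_compose[OF pf(4) m] .
      show "AE z in \<gamma>. indicator A (fst z) * \<Phi> \<Psi> (fst z) = indicator (A \<times> B) z * \<Phi> \<Psi> (fst z)"
        using pf(8) by eventually_elim auto
    qed (use i1 in auto)
    finally show ?thesis by simp
  qed
  also have "(\<integral>z. indicator (A \<times> B) z * \<Psi> (snd z) \<partial>\<gamma>) = (\<integral>n. indicator B n * \<Psi> n \<partial>\<nu>)"
  proof -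
    note m = bounded_indicator_integrable(1)[OF cont compact_B sets_nu finite_measure_nu]
    have "(\<integral>n. indicator B n * \<Psi> n \<partial>\<nu>) = (\<integral>z. indicator B (snd z) * \<Psi> (snd z) \<partial>\<gamma>)"
      unfolding dist(2)[symmetric] by (rule integral_distr[OF pf(5) m])
    also have "\<dots> = (\<integral>z. indicator (A \<times> B) z * \<Psi> (snd z) \<partial>\<gamma>)"
    proof (rule integral_cong_AE)
      show "(\<lambda>z. indicator B (snd z) * \<Psi> (snd z)) \<in> borel_measurable \<gamma>"
        using measurable_compose[OF pf(5) m] .
      show "AE z in \<gamma>. indicator B (snd z) * \<Psi> (snd z) = indicator (A \<times> B) z * \<Psi> (snd z)"
        using pf(8) by eventually_elim auto
    qed (use i2 in auto)
    finally show ?thesis by simp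
  qed
  finally show "transport_cost \<Delta> h \<gamma> + dual_value \<Psi> =
      (\<integral>z. indicator (A \<times> B) z * (\<Phi> \<Psi> (fst z) + \<Psi> (snd z) - fst z \<bullet> snd z) \<partial>\<gamma>)"
    by (simp add: transport_cost_def set_lebesgue_integral_def dual_value_def)
qed

text \<open>The integrand of the gap is nonnegative and vanishes on A \<times> B exactly at the
  contact pairs.\<close>

lemma weak_duality:
  assumes \<gamma>: "transport_plan \<Delta> h \<mu> \<nu> \<gamma>" and cont: "continuous_on UNIV \<Psi>"
  shows "- dual_value \<Psi> \<le> transport_cost \<Delta> h \<gamma>"
    "transport_cost \<Delta> h \<gamma> = - dual_value \<Psi> \<longleftrightarrow> emeasure \<gamma> (- contact \<Psi>) = 0"
proof -
  note pf = plan_facts[OF \<gamma>] and gap = duality_gap[OF assms]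
  let ?f = "\<lambda>z. indicator (A \<times> B) z * (\<Phi> \<Psi> (fst z) + \<Psi> (snd z) - fst z \<bullet> snd z)"
  have f0: "0 \<le> ?f z" for z
    using Phi_ge[OF cont, of "snd z" "fst z"] by (auto simp: indicator_def)
  then have "0 \<le> (\<integral>z. ?f z \<partial>\<gamma>)" by (intro integral_nonneg_AE) auto
  then show "- dual_value \<Psi> \<le> transport_cost \<Delta> h \<gamma>" unfolding gap(1)[symmetric] by simp
  have cb: "- contact \<Psi> \<in> sets \<gamma>"
    unfolding pf(1) by (rule borel_comp[OF borel_compact[OF compact_contact[OF cont]]])
  have "transport_cost \<Delta> h \<gamma> = - dual_value \<Psi> \<longleftrightarrow> (\<integral>z. ?f z \<partial>\<gamma>) = 0"
    unfolding gap(1)[symmetric] by auto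
  also have "\<dots> \<longleftrightarrow> (AE z in \<gamma>. ?f z = 0)"
    using f0 by (intro integral_nonneg_eq_0_iff_AE gap(2)) auto
  also have "\<dots> \<longleftrightarrow> (AE z in \<gamma>. z \<in> contact \<Psi>)"
  proof
    assume "AE z in \<gamma>. ?f z = 0"
    then show "AE z in \<gamma>. z \<in> contact \<Psi>" using pf(8)
      by eventually_elim (auto simp: contact_def)
  next
    assume "AE z in \<gamma>. z \<in> contact \<Psi>"
    then show "AE z in \<gamma>. ?f z = 0" by eventually_elim (auto simp: contact_def)
  qed
  also have "\<dots> \<longleftrightarrow> emeasure \<gamma> (- contact \<Psi>) = 0"
    using cb by (subst AE_iff_measurable[OF _ refl]) (auto simp: pf(2) Compl_eq)
  finally show "transport_cost \<Delta> h \<gamma> = - dual_value \<Psi> \<longleftrightarrow> emeasure \<gamma> (- contact \<Psi>) = 0" .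
qed

section \<open>Plans, potentials and the equation\<close>

definition graph_plan :: "(real ^ 'n \<Rightarrow> real) \<Rightarrow> ((real ^ 'n) \<times> (real ^ 'n)) measure" where
  "graph_plan \<Psi> = distr \<mu> borel (\<lambda>m. (m, transport_map \<Psi> m))"

text \<open>The part of the graph outside \<open>stable_contact \<Psi>\<close> lies over the
  complement of the transport domain, which is null.\<close>

lemma graph_plan:
  assumes \<Psi>: "\<Psi> \<in> P_class \<Delta>" and MA: "MA_eq \<Delta> h b \<Psi> \<nu>"
  shows "transport_plan \<Delta> h \<mu> \<nu> (graph_plan \<Psi>)"
    "\<And>X. X \<in> sets borel \<Longrightarrow> emeasure (graph_plan \<Psi>) X = emeasure \<mu> {m. (m, transport_map \<Psi> m) \<in> X}"
    "\<And>X. X \<in> sets borel \<Longrightarrow> X \<inter> stable_contact \<Psi> = {} \<Longrightarrow> emeasure (graph_plan \<Psi>) X = 0"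
    "emeasure (graph_plan \<Psi>) (- contact \<Psi>) = 0"
proof -
  let ?T = "transport_map \<Psi>"
  note cont = P_class_continuous[OF \<Psi>] and tr = MA_eq_transport[OF \<Psi> MA]
  have "(\<lambda>m. (m, ?T m)) \<in> borel_measurable borel"
    using transport_map_borel[OF cont] by (intro borel_measurable_Pair) auto
  then have gm: "(\<lambda>m. (m, ?T m)) \<in> borel_measurable \<mu>" by (subst measurable_cong_sets[OF sets_mu_M refl])
  have fs: "fst \<in> borel_measurable borel" "snd \<in> borel_measurable borel"
    by (intro borel_measurable_continuous_onI continuous_intros)+
  show em: "emeasure (graph_plan \<Psi>) X = emeasure \<mu> {m. (m, ?T m) \<in> X}" if "X \<in> sets borel" for X
    unfolding graph_plan_def using gm that by (subst emeasure_distr) (auto simp: vimage_def)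
  show "transport_plan \<Delta> h \<mu> \<nu> (graph_plan \<Psi>)"
  proof (rule transport_planI)
    show "sets (graph_plan \<Psi>) = sets borel" by (simp add: graph_plan_def)
    have "distr (graph_plan \<Psi>) borel fst = distr \<mu> borel (\<lambda>m. m)"
      unfolding graph_plan_def using fs(1) gm by (subst distr_distr) (auto simp: comp_def)
    also have "\<dots> = \<mu>" by (rule distr_id2) simp
    finally show "distr (graph_plan \<Psi>) borel fst = \<mu>" .
    have "distr (graph_plan \<Psi>) borel snd = distr \<mu> borel ?T"
      unfolding graph_plan_def using fs(2) gm by (subst distr_distr) (auto simp: comp_def)
    then show "distr (graph_plan \<Psi>) borel snd = \<nu>" using tr(2) by simp
  qed
  show null: "emeasure (graph_plan \<Psi>) X = 0" if X: "X \<in> sets borel" "X \<inter> stable_contact \<Psi> = {}" for X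
  proof -
    have "{m. (m, ?T m) \<in> X} \<subseteq> - transport_domain \<Psi>" using X(2) transport_map_in[OF cont] by blast
    then have "emeasure \<mu> {m. (m, ?T m) \<in> X} \<le> emeasure \<mu> (- transport_domain \<Psi>)"
      using transport_domain_borel[OF cont] by (intro emeasure_mono) auto
    then show ?thesis using em[OF X(1)] tr(1) by simp
  qed
  show "emeasure (graph_plan \<Psi>) (- contact \<Psi>) = 0"
    using borel_compact[OF compact_contact[OF cont]] by (intro null) (auto simp: stable_contact_def)
qed

lemma stable_if_MA_eq:
  assumes \<Psi>: "\<Psi> \<in> P_class \<Delta>" and MA: "MA_eq \<Delta> h b \<Psi> \<nu>"
  shows "stable \<Delta> h b \<nu>"
  unfolding stable_def optimal_plan_def
proof (intro exI conjI allI impI)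
  note cont = P_class_continuous[OF \<Psi>] and gp = graph_plan[OF assms]
  show "transport_plan \<Delta> h \<mu> \<nu> (graph_plan \<Psi>)" by (rule gp(1))
  show "transport_cost \<Delta> h (graph_plan \<Psi>) \<le> transport_cost \<Delta> h \<gamma>'" if "transport_plan \<Delta> h \<mu> \<nu> \<gamma>'" for \<gamma>'
    using weak_duality(1)[OF that cont] weak_duality(2)[OF gp(1) cont] gp(4) by simp
  show "emeasure (graph_plan \<Psi>) (- (\<Union>m \<in> A \<inter> int_lattice. St \<Delta> m \<times> tau_face \<Delta> h m)) = 0"
  proof (rule gp(3))
    show "- (\<Union>m \<in> A \<inter> int_lattice. St \<Delta> m \<times> tau_face \<Delta> h m) \<in> sets borel"
      using borel_closed[OF stable_region_closed] by (rule borel_comp)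
    have "stable_contact \<Psi> \<subseteq> (\<Union>m \<in> A \<inter> int_lattice. St \<Delta> m \<times> tau_face \<Delta> h m)"
    proof
      fix z assume z: "z \<in> stable_contact \<Psi>"
      obtain m n where mn: "z = (m, n)" by (cases z)
      have "(m, n) \<in> contact \<Psi>" using z mn by (auto simp: stable_contact_def)
      then show "z \<in> (\<Union>m \<in> A \<inter> int_lattice. St \<Delta> m \<times> tau_face \<Delta> h m)"
        using stable_contact_iff stable_contact_in_facet_interiors z unfolding mn by blast
    qed
    then show "- (\<Union>m \<in> A \<inter> int_lattice. St \<Delta> m \<times> tau_face \<Delta> h m) \<inter> stable_contact \<Psi> = {}" by blast
  qed
qed

text \<open>Rockafellar's potential f lives on the M side, with subgradients in B along the support;
  its conjugate over A is the required \<Psi>. Boundedness of B bounds f on A, which is what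
  membership of the conjugate in \<open>P_class \<Delta>\<close> needs.\<close>

lemma optimal_plan_potential:
  assumes "optimal_plan \<Delta> h \<mu> \<nu> \<gamma>"
  obtains \<Psi> where "\<Psi> \<in> P_class \<Delta>" "emeasure \<gamma> (- contact \<Psi>) = 0"
proof -
  have \<gamma>: "transport_plan \<Delta> h \<mu> \<nu> \<gamma>" and opt: "\<And>\<gamma>'. transport_plan \<Delta> h \<mu> \<nu> \<gamma>' \<Longrightarrow> transport_cost \<Delta> h \<gamma> \<le> transport_cost \<Delta> h \<gamma>'"
    using assms by (auto simp: optimal_plan_def)
  note pf = plan_facts[OF \<gamma>]
  have dist: "distr \<gamma> borel fst = \<mu>" "distr \<gamma> borel snd = \<nu>" "emeasure \<gamma> (- (A \<times> B)) = 0"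
    using \<gamma> by (auto simp: transport_plan_def)
  have cyc: "cyclically_monotone (measure_support \<gamma>)"
  proof (rule cyclically_monotone_support[OF pf(1,3) A_borel B_borel _ _ dist(3)])
    show "bounded A" "bounded B" using compact_A compact_B by (simp_all add: compact_imp_bounded)
    fix \<gamma>' :: "((real ^ 'n) \<times> (real ^ 'n)) measure"
    assume *: "sets \<gamma>' = sets borel" "distr \<gamma>' borel fst = distr \<gamma> borel fst" "distr \<gamma>' borel snd = distr \<gamma> borel snd"
    have "transport_plan \<Delta> h \<mu> \<nu> \<gamma>'" by (rule transport_planI) (use * dist in auto)
    then show "(\<integral>z. indicator (A \<times> B) z * (fst z \<bullet> snd z) \<partial>\<gamma>') \<le> (\<integral>z. indicator (A \<times> B) z * (fst z \<bullet> snd z) \<partial>\<gamma>)"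
      using opt[of \<gamma>'] by (simp add: transport_cost_def set_lebesgue_integral_def)
  qed
  let ?S = "measure_support \<gamma> \<inter> (A \<times> B)"
  have cycS: "cyclically_monotone ?S" by (rule cyclically_monotone_subset[OF cyc]) blast
  obtain R where R: "R > 0" "\<And>n. n \<in> B \<Longrightarrow> norm n \<le> R"
    using compact_imp_bounded[OF compact_B] by (metis bounded_pos)
  obtain R' where R': "R' > 0" "\<And>m. m \<in> A \<Longrightarrow> norm m \<le> R'"
    using compact_imp_bounded[OF compact_A] by (metis bounded_pos)
  have "\<exists>f C. (\<forall>m\<in>A. \<bar>f m\<bar> \<le> C) \<and> (\<forall>(x, y)\<in>?S. \<forall>z. f x + y \<bullet> (z - x) \<le> f z)"
  proof (cases "?S = {}")
    case True
    \<comment> \<open>Rockafellar's construction needs a starting point; without one, any bounded f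
      serves.\<close>
    then show ?thesis by (intro exI[of _ "\<lambda>_. 0"] exI[of _ 0]) auto
  next
    case False
    then obtain z0 where z0: "z0 \<in> ?S" by blast
    have RS: "norm (snd z) \<le> R" if "z \<in> ?S" for z using R(2) that by auto
    obtain f where f: "\<And>x y z. (x, y) \<in> ?S \<Longrightarrow> f x + y \<bullet> (z - x) \<le> f z"
      "\<And>z. \<bar>f z\<bar> \<le> R * norm (z - fst z0)"
      using cyclically_monotone_potential[OF cycS z0 RS] by blast
    have "\<bar>f m\<bar> \<le> R * (R' + norm (fst z0))" if "m \<in> A" for m
    proof -
      have "norm (m - fst z0) \<le> R' + norm (fst z0)" using norm_triangle_ineq4[of m "fst z0"] R'(2)[OF that] by linarith
      then have "R * norm (m - fst z0) \<le> R * (R' + norm (fst z0))" using R(1) by simp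
      then show ?thesis using f(2)[of m] by linarith
    qed
    then show ?thesis using f(1) by (intro exI[of _ f] exI[of _ "R * (R' + norm (fst z0))"]) blast
  qed
  then obtain f C where f: "\<And>m. m \<in> A \<Longrightarrow> \<bar>f m\<bar> \<le> C" "\<And>x y z. (x, y) \<in> ?S \<Longrightarrow> f x + y \<bullet> (z - x) \<le> f z"
    by blast
  define \<Psi> where "\<Psi> = (\<lambda>n. SUP m\<in>A. m \<bullet> n - f m)"
  have \<Psi>: "\<Psi> \<in> P_class \<Delta>" unfolding \<Psi>_def by (rule conjugate_in_P_class[OF f(1)])
  have "?S \<subseteq> contact \<Psi>"
    unfolding \<Psi>_def using conjugate_contact[OF f(1)] f(2) by auto
  then have sub: "- contact \<Psi> \<subseteq> - measure_support \<gamma> \<union> - (A \<times> B)" by blast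
  have "- measure_support \<gamma> \<union> - (A \<times> B) \<in> null_sets \<gamma>"
    using emeasure_outside_support[OF pf(1)] dist(3) AB_borel pf(1)
    by (intro null_sets.Un) (auto simp: null_sets_def)
  moreover have "- contact \<Psi> \<in> sets \<gamma>"
    unfolding pf(1) by (rule borel_comp[OF borel_compact[OF compact_contact[OF P_class_continuous[OF \<Psi>]]]])
  ultimately have "- contact \<Psi> \<in> null_sets \<gamma>" using sub by (rule null_sets_subset)
  then show thesis using that[OF \<Psi>] by (simp add: null_sets_def)
qed

lemma MA_eq_if_stable:
  assumes "stable \<Delta> h b \<nu>"
  shows "\<exists>\<Psi>\<in>P_class \<Delta>. MA_eq \<Delta> h b \<Psi> \<nu>"
proof -
  let ?G = "\<Union>m \<in> A \<inter> int_lattice. St \<Delta> m \<times> tau_face \<Delta> h m"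
  obtain \<gamma> where opt: "optimal_plan \<Delta> h \<mu> \<nu> \<gamma>" and G: "emeasure \<gamma> (- ?G) = 0"
    using assms by (auto simp: stable_def)
  have \<gamma>: "transport_plan \<Delta> h \<mu> \<nu> \<gamma>" using opt by (simp add: optimal_plan_def)
  note pf = plan_facts[OF \<gamma>]
  obtain \<Psi> where \<Psi>: "\<Psi> \<in> P_class \<Delta>" and con: "emeasure \<gamma> (- contact \<Psi>) = 0"
    using optimal_plan_potential[OF opt] by blast
  note cont = P_class_continuous[OF \<Psi>]
  have "MA_eq \<Delta> h b \<Psi> \<nu>"
    unfolding MA_eq_iff[OF \<Psi>]
  proof (intro allI impI)
    fix \<tau> and E :: "(real ^ 'n) set" assume \<tau>: "\<tau> facet_of K" and E: "E \<in> sets borel" "E \<subseteq> rel_interior \<tau>"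
    let ?X = "transport_map \<Psi> -` E \<inter> transport_domain \<Psi>"
    have Xb: "?X \<in> sets borel"
      using measurable_sets[OF transport_map_borel[OF cont] E(1)] transport_domain_borel[OF cont] by auto
    have n1: "- contact \<Psi> \<in> null_sets \<gamma>"
      using con borel_comp[OF borel_compact[OF compact_contact[OF cont]]] pf(1) by (auto simp: null_sets_def)
    have n2: "- ?G \<in> null_sets \<gamma>"
      using G borel_comp[OF borel_closed[OF stable_region_closed]] pf(1) by (auto simp: null_sets_def)
    have n3: "UNIV \<times> (- facet_interiors K) \<in> null_sets \<gamma>"
      using pf(7)[of "- facet_interiors K"] nu_outside facet_interiors_borel pf(1)
      by (auto simp: null_sets_def intro!: borel_Times)
    have n4: "ambiguous \<Psi> \<times> UNIV \<in> null_sets \<gamma>"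
      using pf(6)[OF ambiguous_borel[OF cont]] ambiguous_null[OF cont] ambiguous_borel[OF cont] pf(1)
      by (auto simp: null_sets_def intro!: borel_Times)
    \<comment> \<open>Off the four null sets, z is a stable contact pair with unambiguous first
      component, so its second component is the value of the transport map. Comparing marginals then
      gives the equation.\<close>
    have "AE z in \<gamma>. z \<in> ?X \<times> UNIV \<longleftrightarrow> z \<in> UNIV \<times> E"
    proof (rule AE_outside_null_sets[OF n1 n2 n3 n4])
      fix z assume z: "z \<notin> - contact \<Psi>" "z \<notin> - ?G" "z \<notin> UNIV \<times> (- facet_interiors K)" "z \<notin> ambiguous \<Psi> \<times> UNIV"
      obtain m n where mn: "z = (m, n)" by (cases z)
      have "(m, n) \<in> stable_contact \<Psi>" by (rule stable_contact_iff[THEN iffD2]) (use z mn in auto)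
      then have "m \<in> transport_domain \<Psi>" "transport_map \<Psi> m = n"
        using transport_map_eqI[OF cont] z(4) mn by auto
      then show "z \<in> ?X \<times> UNIV \<longleftrightarrow> z \<in> UNIV \<times> E" unfolding mn by simp
    qed
    then have "emeasure \<gamma> (?X \<times> UNIV) = emeasure \<gamma> (UNIV \<times> E)"
      using Xb E(1) pf(1) by (intro emeasure_eq_AE) (auto intro!: borel_Times)
    then show "emeasure \<mu> ?X = emeasure \<nu> E" using pf(6)[OF Xb] pf(7)[OF E(1)] by simp
  qed
  then show ?thesis using \<Psi> by blast
qed

text \<open>Both graph plans compete in the same problem, so weak duality makes both dual values
  equal to its optimum up to sign. Equality for the plan of \<Psi> and the potential \<Psi>' then
  puts the graph of the first transport map into \<open>contact \<Psi>'\<close> as well,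
  \<mu>-almost everywhere.\<close>

lemma MA_eq_unique:
  assumes \<Psi>: "\<Psi> \<in> P_class \<Delta>" "\<Psi>' \<in> P_class \<Delta>" and MA: "MA_eq \<Delta> h b \<Psi> \<nu>" "MA_eq \<Delta> h b \<Psi>' \<nu>"
  shows "(\<lambda>n. \<Psi> n - \<Psi>' n) constant_on B"
proof -
  note cont = P_class_continuous[OF \<Psi>(1)] P_class_continuous[OF \<Psi>(2)]
  note gp = graph_plan[OF \<Psi>(1) MA(1)] and gp' = graph_plan[OF \<Psi>(2) MA(2)]
  let ?T = "transport_map \<Psi>"
  have "transport_cost \<Delta> h (graph_plan \<Psi>) = - dual_value \<Psi>" "transport_cost \<Delta> h (graph_plan \<Psi>') = - dual_value \<Psi>'"
    using weak_duality(2)[OF gp(1) cont(1)] weak_duality(2)[OF gp'(1) cont(2)] gp(4) gp'(4) by auto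
  moreover have "- dual_value \<Psi>' \<le> transport_cost \<Delta> h (graph_plan \<Psi>)" "- dual_value \<Psi> \<le> transport_cost \<Delta> h (graph_plan \<Psi>')"
    using weak_duality(1)[OF gp(1) cont(2)] weak_duality(1)[OF gp'(1) cont(1)] by auto
  ultimately have "transport_cost \<Delta> h (graph_plan \<Psi>) = - dual_value \<Psi>'" by linarith
  then have con': "emeasure (graph_plan \<Psi>) (- contact \<Psi>') = 0" using weak_duality(2)[OF gp(1) cont(2)] by simp
  have cb: "- contact \<Psi> \<in> sets borel" "- contact \<Psi>' \<in> sets borel"
    using borel_comp[OF borel_compact[OF compact_contact[OF cont(1)]]] borel_comp[OF borel_compact[OF compact_contact[OF cont(2)]]] by auto
  have gm: "(\<lambda>m. (m, ?T m)) \<in> borel_measurable borel"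
    using transport_map_borel[OF cont(1)] by (intro borel_measurable_Pair) auto
  let ?Q1 = "{m. (m, ?T m) \<in> - contact \<Psi>}" and ?Q2 = "{m. (m, ?T m) \<in> - contact \<Psi>'}"
  have Qb: "?Q1 \<in> sets borel" "?Q2 \<in> sets borel"
    using measurable_sets[OF gm cb(1)] measurable_sets[OF gm cb(2)] by (auto simp: vimage_def)
  have Q0: "emeasure \<mu> ?Q1 = 0" "emeasure \<mu> ?Q2 = 0"
    using gp(2)[OF cb(1)] gp(2)[OF cb(2)] gp(4) con' by auto
  have "?Q1 \<union> ?Q2 \<in> null_sets \<mu>" using Qb Q0 by (intro null_sets.Un) (auto simp: null_sets_def)
  then have Q: "?Q1 \<union> ?Q2 \<in> sets borel" "emeasure \<mu> (?Q1 \<union> ?Q2) = 0" by (auto simp: null_sets_def)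
  have common: "\<exists>n. (m, n) \<in> contact \<Psi> \<and> (m, n) \<in> contact \<Psi>'" if "m \<notin> ?Q1 \<union> ?Q2" for m
    using that by (intro exI[of _ "?T m"]) auto
  obtain c where "\<And>m. m \<in> A \<Longrightarrow> \<Phi> \<Psi> m - \<Phi> \<Psi>' m = c"
    using Phi_diff_constant[OF cont Q common] by blast
  then show ?thesis by (rule potential_diff_constant_on_B[OF \<Psi>])
qed

end

theorem theorem1:
  fixes \<Delta> :: "(real ^ 'n) set"
    and h :: "real ^ 'n \<Rightarrow> int"
    and b :: "(real ^ 'n) set \<Rightarrow> 'd::finite \<Rightarrow> real ^ 'n"
    and \<nu> :: "(real ^ 'n) measure"
  assumes "CARD('n) = CARD('d) + 1"
    and "reflexive_polytope \<Delta>"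
    and "height_function \<Delta> h"
    and "facet_bases \<Delta> b"
    and "sets \<nu> = sets borel"
    and "emeasure \<nu> (- facet_interiors (height_dual \<Delta> h)) = 0"
    and "emeasure \<nu> (facet_interiors (height_dual \<Delta> h)) = emeasure (mu_M \<Delta> b) (frontier \<Delta>)"
  shows "((\<exists>\<Psi> \<in> P_class \<Delta>. MA_eq \<Delta> h b \<Psi> \<nu>) \<longleftrightarrow> stable \<Delta> h b \<nu>) \<and>
    (\<forall>\<Psi> \<in> P_class \<Delta>. \<forall>\<Psi>' \<in> P_class \<Delta>. MA_eq \<Delta> h b \<Psi> \<nu> \<longrightarrow> MA_eq \<Delta> h b \<Psi>' \<nu> \<longrightarrow>
       (\<lambda>n. \<Psi> n - \<Psi>' n) constant_on frontier (height_dual \<Delta> h))"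
proof -
  interpret tropical_transport \<Delta> h b \<nu>
    by unfold_locales (rule assms)+
  show ?thesis
    using stable_if_MA_eq MA_eq_if_stable MA_eq_unique by blast
qed

end
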